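(* Let $w\in S_\infty$, let $r\ge 1$, and let $v(\lambda,r)\in S_\infty$ be the $r$-shuffle associated with a partition $\lambda$ having at most $r$ parts. Assume that at least one of the following holds: (i) $w$ is an $r$-semi-shuffle; (ii) $\lambda$ is a hook. Let $R\in\mathcal{RC}(w)$ and $Y\in\mathcal{RC}(v(\lambda,r))$. Then the insertion algorithm described in the context can be carried out on $(R,Y)$, its output graph $U=R\leftarrow Y$ is an rc-graph, and, with $T(R,Y)$ the output tableau of transpositions of $v(\lambda,r)$: (a) $E(w,T(R,Y))$ is a row and column strict tableau; (b) $(w,U,T(R,Y))$ is an $r$-Bruhat package; (c) $x^U=x^R x^Y$.
   Context: **Permutations.** $S_\infty$ is the group of permutations of $\mathbb N=\{1,2,\dots\}$ fixing all but finitely many integers; products are compositions of functions; $s_i=t_{i,i+1}$, where $t_{ij}$ is the transposition of $i$ and $j$; $l(w)$ is the Coxeter length. $w$ is an $r$-shuffle if $w(i)<w(i+1)$ for all $i\ne r$, and an $r$-semi-shuffle if $w(i)<w(i+1)$ for all $i>r$. For a partition $\lambda=(\lambda_1\ge\lambda_2\ge\dots)$ with at most $r$ nonzero parts, $v(\lambda,r)$ is the unique $r$-shuffle $v$ with $\lambda_j=v(r+1-j)-r-1+j$ for $1\le j\le r$. $\lambda$ is a hook if $\lambda=(\lambda_1,1,\dots,1)$ (rows and columns included). **Graphs.** A graph is a finite set $R\subset\mathbb N\times\mathbb N$ of crossings, $(i,j)$ meaning row $i$ (numbered from the top) and column $j$ (from the left). The crossing at $(i,j)$ has label $i+j-1$.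 Reading labels from the top row to the bottom row, and from right to left in each row, gives a word $i_1\dots i_m$; set $w(R)=s_{i_1}\cdots s_{i_m}$ and $|R|=m$. $R$ is an rc-graph of $w(R)$ if this word is reduced, i.e. $|R|=l(w(R))$; $\mathcal{RC}(w)$ is the set of rc-graphs of $w$. Strands: at a place $(i,j)\in R$ the strand entering from the left leaves to the right (it is the horizontal strand) and the strand entering from below leaves at the top (the vertical strand), and they cross; at a place $(i,j)\notin R$ the strand entering from the left leaves at the top and the strand entering from below leaves to the right. In both cases these two strands are said to pass the place $(i,j)$. Strand $i$ is the strand entering from the left end of row $i$; it ends at the top of column $w(R)(i)$. Write $a\boxplus b=\ell$ if strands $a$ and $b$ cross in row $\ell$ with $a$ the horizontal strand. $R_{\ge\ell}$ (resp. $R_\ell$) is the set of crossings of $R$ in rows $\ge\ell$ (resp. in row $\ell$); $x^R=\prod_i x_i^{|R_i|}$. **Tableaux.** Boxes of the Young diagram of $\lambda$ ($\lambda_i$ boxes in row $i$, row 1 on top) are numbered $1,\dots,m$ starting with the bottom row and going up, left to right in each row. A tableau is filled up to $i$ if exactly boxes $1,\dots,i$ are filled. A tableau of integers is row strict if entries strictly increase left to right and weakly increase top to bottom, column strict if they weakly increase left to right and strictly increase top to bottom (for partially filled tableaux, conditions are on filled boxes). A tableau of transpositions of $v(\lambda,r)$ is a filling of the diagram of $\lambda$ by pairs $(ab)$ with $a\le r<b$. If $T$ has entry $(a_kb_k)$ in box $k$, put $w_i(T)=t_{a_1b_1}\cdots t_{a_ib_i}$, and $w(T)=w_m(T)$ where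 $m$ is the number of filled boxes. $T$ (filled up to $m$) is an $r$-Bruhat chain of $w$ if $l(w\,w_i(T))=l(w)+i$ for $1\le i\le m$. $(w,R,T)$ is an $r$-Bruhat package if $R$ is an rc-graph, $w\,w(T)=w(R)$ and $T$ is an $r$-Bruhat chain of $w$. $E(w,T)$ is the tableau of the same shape whose box $i$ contains $w\,w_i(T)(b_i)$ for each filled box $i$. For an $r$-Bruhat package $\mathcal P=(w,R,T)$ with $m$ filled boxes, $S_m(\mathcal P)=R$, and $S_{j}(\mathcal P)$ ($0\le j<m$) is obtained from $S_{j+1}(\mathcal P)$ by removing the (unique) crossing of strands $a_{j+1}$ and $b_{j+1}$; these are rc-graphs with $w(S_j(\mathcal P))=w\,w_j(T)$. **Words of $Y$.** Let $Y\in\mathcal{RC}(v(\lambda,r))$. Strand $s\le r$ crosses exactly $\lambda_{r+1-s}$ other strands; list the rows of these crossings (with repetition) in weakly decreasing order to get $word(Y,s)$, and let $word(Y)$ be the concatenation $word(Y,1)\cdots word(Y,r)$. Its $i$-th letter corresponds to box $i$ of $\lambda=:sh(Y)$. For each $\ell$, $w(Y_{\ge\ell})$ is again an $r$-shuffle, with shape $sh(Y_{\ge\ell})$ a subdiagram of $\lambda$, and $sh(Y_{\ge\ell+1})\subset sh(Y_{\ge\ell})$. Let $m_\ell=|Y_{\ge\ell}|$. **Insertion algorithm.** Steps $(\ell,i)$, $r\ge\ell\ge1$, $0\le i\le m_\ell$, are performed in the order $(r,0),\dots,(r,m_r),(r-1,0),\dots,(r-1,m_{r-1}),\dots,(1,m_1)$.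 Step $(\ell,i)$ produces a graph $R(\ell,i)$ with no crossings above row $\ell$ and a tableau of transpositions $T(\ell,i)$ of shape $sh(Y_{\ge\ell})$ filled up to $i$. Put $R(\ell)=R(\ell,m_\ell)$, $T(\ell)=T(\ell,m_\ell)$, $\mathcal P(\ell)=(w(R_{\ge\ell}),R(\ell),T(\ell))$. *Start:* $R(r,0)=R_{\ge r}$, $T(r,0)$ empty of shape $sh(Y_{\ge r})$. *Row-to-row step $(\ell,0)$, $\ell<r$:* $R(\ell,0)=S_0(\mathcal P(\ell+1))\cup R_\ell$, $T(\ell,0)$ empty of shape $sh(Y_{\ge\ell})$. For $i\ge1$ let $word(Y_{\ge\ell})=k_1\dots k_{m_\ell}$. *Insertion (if $k_i=\ell$):* insertion into a place $(\ell,j)$ not a crossing of $R(\ell,i-1)$ is allowed if the strand $c$ entering it from the left and the strand $d$ entering it from below satisfy $c\le r<d$. Take the rightmost allowed place of row $\ell$, with strands $c,d$; add a crossing there to $R(\ell,i-1)$ to get $R(\ell,i)$; put $(cd)$ into box $i$ of $T(\ell,i-1)$ to get $T(\ell,i)$. *Rectification (if $k_i>\ell$):* let $i_+$ be the number, in $sh(Y_{\ge\ell+1})$, of box $i$ of $sh(Y_{\ge\ell})$. Let $R'$ be $R(\ell,i-1)$ with the crossing of $S_{i_+}(\mathcal P(\ell+1))$ that is not in $S_{i_+-1}(\mathcal P(\ell+1))$ added; let $T'$ be $T(\ell,i-1)$ with the entry $(ab)$ of box $i_+$ of $T(\ell+1)$ put in box $i$. If $E(w(R_{\ge\ell}),T')$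 is row and column strict and $(w(R_{\ge\ell}),R',T')$ is an $r$-Bruhat package, set $R(\ell,i)=R'$, $T(\ell,i)=T'$. Otherwise: - if $b\boxplus a=\ell$ in $R'$, remove this crossing in row $\ell$ from $R'$ to get $R''$, and empty box $i$ of $T'$ to get $T''$; - otherwise box $i-1$ of $T'$ has an entry of the form $(af)$ and $b\boxplus f=\ell$ in $R'$; remove this crossing to get $R''$, and get $T''$ from $T'$ by emptying box $i$ and replacing the entry of box $i-1$ by $(ab)$. Let $(\ell,j_0)$ be the place of the removed crossing. In $R''$, insertion into a non-crossing place $(\ell,j)$ is allowed if, writing the strand entering from the left first and the strand entering from below second, the strands are either (first type) $c,d$ with $c\le r<d$, or (second type) $g,d$ with $r<d$, where $(eg)$ is the entry of box $i-1$ of $T''$. Take the rightmost allowed place with $j<j_0$ and add a crossing there to $R''$ to get $R(\ell,i)$. For the first type put $(cd)$ into box $i$ of $T''$ to get $T(\ell,i)$; for the second type replace the entry of box $i-1$ of $T''$ by $(ed)$ and put $(eg)$ into box $i$ to get $T(\ell,i)$. *End:* $R\leftarrow Y=R(1,m_1)$, $T(R,Y)=T(1,m_1)$. "The algorithm can be carried out" means that all objects required at each step (allowed places, the crossings to be removed, the rc-graphs $S_j$) exist. *)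

theory Defs
  imports
    "HOL-Combinatorics.Permutations"
    "HOL-Combinatorics.Transposition"
    "HOL-Library.Multiset"
    "HOL-Library.Monad_Syntax"
    "HOL-Library.Poly_Mapping"
begin

section \<open>Permutations\<close>

text \<open>
  The set of positive integers is modelled inside \<^typ>\<open>nat\<close>: a permutation is a function on
  \<^typ>\<open>nat\<close> that fixes \<open>0\<close> and all but finitely many positive integers.
\<close>

definition S_inf :: "(nat \<Rightarrow> nat) set" where
  "S_inf = {w. \<exists>n. w permutes {1..n}}"

definition word_perm :: "nat list \<Rightarrow> nat \<Rightarrow> nat" where
  "word_perm ks = foldr (\<lambda>k u. transpose k (k + 1) \<circ> u) ks id"

definition cox_length :: "(nat \<Rightarrow> nat) \<Rightarrow> nat" where
  "cox_length w = (LEAST n. \<exists>ks. length ks = n \<and> (\<forall>k\<in>set ks. 1 \<le> k) \<and> word_perm ks = w)"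

definition is_shuffle :: "nat \<Rightarrow> (nat \<Rightarrow> nat) \<Rightarrow> bool" where
  "is_shuffle r w \<longleftrightarrow> w \<in> S_inf \<and> (\<forall>i\<ge>1. i \<noteq> r \<longrightarrow> w i < w (i + 1))"

definition is_semi_shuffle :: "nat \<Rightarrow> (nat \<Rightarrow> nat) \<Rightarrow> bool" where
  "is_semi_shuffle r w \<longleftrightarrow> w \<in> S_inf \<and> (\<forall>i>r. w i < w (i + 1))"

text \<open>
  A partition with at most \<open>r\<close> nonzero parts is the weakly decreasing list
  \<open>[lam\<^sub>1, \<dots>, lam\<^sub>r]\<close>, padded with zeros to length exactly \<open>r\<close>.
\<close>

definition is_partition :: "nat \<Rightarrow> nat list \<Rightarrow> bool" where
  "is_partition r lam \<longleftrightarrow> length lam = r \<and> sorted_wrt (\<ge>) lam"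

definition is_hook :: "nat list \<Rightarrow> bool" where
  "is_hook lam \<longleftrightarrow> (\<forall>x\<in>set (tl lam). x \<le> 1)"

text \<open>\<open>is_v lam r v\<close> says that \<open>v = v(lam, r)\<close>.\<close>

definition is_v :: "nat list \<Rightarrow> nat \<Rightarrow> (nat \<Rightarrow> nat) \<Rightarrow> bool" where
  "is_v lam r v \<longleftrightarrow> is_shuffle r v \<and>
     (\<forall>j\<in>{1..r}. int (lam ! (j - 1)) = int (v (r + 1 - j)) - int r - 1 + int j)"

text \<open>
  Conversely, the partition of an \<open>r\<close>-shuffle; the truncated subtraction is harmless since
  \<open>v (r + 1 - j) \<ge> r + 1 - j\<close> for an \<open>r\<close>-shuffle \<open>v\<close>.
\<close>

definition shuffle_shape :: "nat \<Rightarrow> (nat \<Rightarrow> nat) \<Rightarrow> nat list" where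
  "shuffle_shape r v = map (\<lambda>j. v (r + 1 - j) + j - (r + 1)) [1..<r + 1]"


section \<open>Graphs and strands\<close>

type_synonym graph = "(nat \<times> nat) set"

definition graph_word :: "graph \<Rightarrow> nat list" where
  "graph_word R = concat (map (\<lambda>i. map (\<lambda>j. i + j - 1) (rev (sorted_list_of_set {j. (i, j) \<in> R})))
     (sorted_list_of_set (fst ` R)))"

definition graph_perm :: "graph \<Rightarrow> nat \<Rightarrow> nat" where
  "graph_perm R = word_perm (graph_word R)"

definition rc_graph :: "graph \<Rightarrow> bool" where
  "rc_graph R \<longleftrightarrow> finite R \<and> R \<subseteq> {1..} \<times> {1..} \<and> card R = cox_length (graph_perm R)"

definition RC :: "(nat \<Rightarrow> nat) \<Rightarrow> graph set" where
  "RC w = {R. rc_graph R \<and> graph_perm R = w}"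

definition rows_ge :: "graph \<Rightarrow> nat \<Rightarrow> graph" where
  "rows_ge R l = {p \<in> R. l \<le> fst p}"

definition row_of :: "graph \<Rightarrow> nat \<Rightarrow> graph" where
  "row_of R l = {p \<in> R. fst p = l}"

text \<open>
  \<open>enters_left R c i j\<close> (\<open>enters_below R c i j\<close>): strand \<open>c\<close> of \<open>R\<close> enters the place \<open>(i, j)\<close> from
  the left (from below). A strand leaving a place of row 1 at the top ends there.
\<close>

inductive enters_left :: "graph \<Rightarrow> nat \<Rightarrow> nat \<Rightarrow> nat \<Rightarrow> bool"
  and enters_below :: "graph \<Rightarrow> nat \<Rightarrow> nat \<Rightarrow> nat \<Rightarrow> bool"
  for R :: graph
where
  start: "1 \<le> i \<Longrightarrow> enters_left R i i 1"
| cross_right: "enters_left R c i j \<Longrightarrow> (i, j) \<in> R \<Longrightarrow> enters_left R c i (j + 1)"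
| turn_up: "enters_left R c i j \<Longrightarrow> (i, j) \<notin> R \<Longrightarrow> 1 < i \<Longrightarrow> enters_below R c (i - 1) j"
| cross_up: "enters_below R c i j \<Longrightarrow> (i, j) \<in> R \<Longrightarrow> 1 < i \<Longrightarrow> enters_below R c (i - 1) j"
| turn_right: "enters_below R c i j \<Longrightarrow> (i, j) \<notin> R \<Longrightarrow> enters_left R c i (j + 1)"

definition passes :: "graph \<Rightarrow> nat \<Rightarrow> nat \<times> nat \<Rightarrow> bool" where
  "passes R c p \<longleftrightarrow> enters_left R c (fst p) (snd p) \<or> enters_below R c (fst p) (snd p)"

definition strands_at :: "graph \<Rightarrow> nat \<Rightarrow> nat \<Rightarrow> nat \<Rightarrow> nat \<Rightarrow> bool" where
  "strands_at R c d i j \<longleftrightarrow> enters_left R c i j \<and> enters_below R d i j"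

definition crossing_of :: "graph \<Rightarrow> nat \<Rightarrow> nat \<Rightarrow> nat \<times> nat \<Rightarrow> bool" where
  "crossing_of R a b p \<longleftrightarrow> p \<in> R \<and>
     (strands_at R a b (fst p) (snd p) \<or> strands_at R b a (fst p) (snd p))"

text \<open>\<open>h_cross R a b l j\<close> witnesses \<open>a \<boxplus> b = l\<close>: at \<open>(l, j)\<close> the horizontal strand \<open>a\<close> crosses \<open>b\<close>.\<close>

definition h_cross :: "graph \<Rightarrow> nat \<Rightarrow> nat \<Rightarrow> nat \<Rightarrow> nat \<Rightarrow> bool" where
  "h_cross R a b l j \<longleftrightarrow> (l, j) \<in> R \<and> strands_at R a b l j"

text \<open>
  Monomials live in the polynomial ring in the variables \<open>x\<^sub>1, x\<^sub>2, \<dots>\<close> over the integers;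
  \<^typ>\<open>nat \<Rightarrow>\<^sub>0 nat\<close> is the type of exponent vectors.
\<close>

definition xvar :: "nat \<Rightarrow> (nat \<Rightarrow>\<^sub>0 nat) \<Rightarrow>\<^sub>0 int" where
  "xvar i = Poly_Mapping.single (Poly_Mapping.single i 1) 1"

definition graph_monom :: "graph \<Rightarrow> (nat \<Rightarrow>\<^sub>0 nat) \<Rightarrow>\<^sub>0 int" where
  "graph_monom R = (\<Prod>i\<in>fst ` R. xvar i ^ card (row_of R i))"


section \<open>Tableaux\<close>

text \<open>
  The tableaux here are filled up to some \<open>i\<close>, so a tableau is a shape together with the list of
  the entries of boxes \<open>1, \<dots>, i\<close>. Box \<open>k\<close> has position \<open>boxes sh ! (k - 1)\<close> in the diagram.
\<close>

datatype 'a tableau = Tableau (shape: "nat list") (entries: "'a list")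

definition boxes :: "nat list \<Rightarrow> (nat \<times> nat) list" where
  "boxes sh = concat (map (\<lambda>i. map (\<lambda>j. (i, j)) [1..<sh ! (i - 1) + 1]) (rev [1..<length sh + 1]))"

definition row_strict :: "nat tableau \<Rightarrow> bool" where
  "row_strict T \<longleftrightarrow>
     (\<forall>k<length (entries T). \<forall>k'<length (entries T).
        let p = boxes (shape T) ! k; p' = boxes (shape T) ! k' in
        (fst p = fst p' \<and> snd p < snd p' \<longrightarrow> entries T ! k < entries T ! k') \<and>
        (snd p = snd p' \<and> fst p < fst p' \<longrightarrow> entries T ! k \<le> entries T ! k'))"

definition col_strict :: "nat tableau \<Rightarrow> bool" where
  "col_strict T \<longleftrightarrow>
     (\<forall>k<length (entries T). \<forall>k'<length (entries T).
        let p = boxes (shape T) ! k; p' = boxes (shape T) ! k' in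
        (fst p = fst p' \<and> snd p < snd p' \<longrightarrow> entries T ! k \<le> entries T ! k') \<and>
        (snd p = snd p' \<and> fst p < fst p' \<longrightarrow> entries T ! k < entries T ! k'))"

definition transp_tableau :: "nat \<Rightarrow> (nat \<times> nat) tableau \<Rightarrow> bool" where
  "transp_tableau r T \<longleftrightarrow> length (entries T) \<le> length (boxes (shape T)) \<and>
     (\<forall>(a, b)\<in>set (entries T). 1 \<le> a \<and> a \<le> r \<and> r < b)"

text \<open>\<open>tab_perm i T\<close> is \<open>w\<^sub>i(T)\<close>.\<close>

definition tab_perm :: "nat \<Rightarrow> (nat \<times> nat) tableau \<Rightarrow> nat \<Rightarrow> nat" where
  "tab_perm i T = foldr (\<lambda>(a, b) u. transpose a b \<circ> u) (take i (entries T)) id"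

definition full_perm :: "(nat \<times> nat) tableau \<Rightarrow> nat \<Rightarrow> nat" where
  "full_perm T = tab_perm (length (entries T)) T"

definition bruhat_chain :: "nat \<Rightarrow> (nat \<Rightarrow> nat) \<Rightarrow> (nat \<times> nat) tableau \<Rightarrow> bool" where
  "bruhat_chain r w T \<longleftrightarrow> transp_tableau r T \<and>
     (\<forall>i\<in>{1..length (entries T)}. cox_length (w \<circ> tab_perm i T) = cox_length w + i)"

type_synonym package = "(nat \<Rightarrow> nat) \<times> graph \<times> (nat \<times> nat) tableau"

definition bruhat_package :: "nat \<Rightarrow> package \<Rightarrow> bool" where
  "bruhat_package r P = (case P of (w, R, T) \<Rightarrow>
     rc_graph R \<and> w \<circ> full_perm T = graph_perm R \<and> bruhat_chain r w T)"

definition E_tab :: "(nat \<Rightarrow> nat) \<Rightarrow> (nat \<times> nat) tableau \<Rightarrow> nat tableau" where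
  "E_tab w T = Tableau (shape T)
     (map (\<lambda>i. (w \<circ> tab_perm i T) (snd (entries T ! (i - 1)))) [1..<length (entries T) + 1])"

definition push :: "'a tableau \<Rightarrow> 'a \<Rightarrow> 'a tableau" where
  "push T x = Tableau (shape T) (entries T @ [x])"

definition set_last :: "'a tableau \<Rightarrow> 'a \<Rightarrow> 'a tableau" where
  "set_last T x = Tableau (shape T) (butlast (entries T) @ [x])"

definition word_of :: "nat \<Rightarrow> graph \<Rightarrow> nat list" where
  "word_of r Y = concat (map (\<lambda>s.
     rev (sorted_list_of_multiset (image_mset fst (mset_set {p \<in> Y. passes Y s p})))) [1..<r + 1])"


section \<open>The insertion algorithm\<close>

text \<open>
  A computation returns \<open>None\<close> as soon as an object required by the algorithm does not exist or
  is not unique.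
\<close>

definition the_unique :: "('a \<Rightarrow> bool) \<Rightarrow> 'a option" where
  "the_unique Q = (if \<exists>!x. Q x then Some (THE x. Q x) else None)"

text \<open>\<open>rightmost Q\<close> returns the greatest column \<open>j\<close> with \<open>Q j c d\<close>, together with \<open>c\<close> and \<open>d\<close>.\<close>

definition rightmost :: "(nat \<Rightarrow> nat \<Rightarrow> nat \<Rightarrow> bool) \<Rightarrow> (nat \<times> nat \<times> nat) option" where
  "rightmost Q = the_unique (\<lambda>(j, c, d). Q j c d \<and> (\<forall>j' c' d'. Q j' c' d' \<longrightarrow> j' \<le> j))"

text \<open>
  \<open>S_down r P k\<close> is \<open>S\<^sub>m\<^sub>-\<^sub>k(P)\<close>, where \<open>m\<close> is the number of filled boxes; it is defined only for
  packages \<open>P\<close>, and all the graphs occurring have to be rc-graphs. Passing from \<open>k\<close> to \<open>k + 1\<close>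
  removes the crossing of the two strands recorded in box \<open>m - k\<close>.
\<close>

primrec S_down :: "nat \<Rightarrow> package \<Rightarrow> nat \<Rightarrow> graph option" where
  "S_down r P 0 = (if bruhat_package r P then Some (fst (snd P)) else None)"
| "S_down r P (Suc k) = do {
     G \<leftarrow> S_down r P k;
     let ab = (let es = entries (snd (snd P)) in es ! (length es - Suc k));
     p \<leftarrow> the_unique (crossing_of G (fst ab) (snd ab));
     if rc_graph (G - {p}) then Some (G - {p}) else None
   }"

definition S_graph :: "nat \<Rightarrow> package \<Rightarrow> nat \<Rightarrow> graph option" where
  "S_graph r P j = S_down r P (length (entries (snd (snd P))) - j)"

definition insertion_step ::
  "nat \<Rightarrow> nat \<Rightarrow> graph \<times> (nat \<times> nat) tableau \<Rightarrow> (graph \<times> (nat \<times> nat) tableau) option" where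
  "insertion_step r l GT = (case GT of (G, T) \<Rightarrow> do {
     (j, c, d) \<leftarrow> rightmost (\<lambda>j c d. (l, j) \<notin> G \<and> strands_at G c d l j \<and> c \<le> r \<and> r < d);
     Some (insert (l, j) G, push T (c, d))
   })"

text \<open>
  In \<open>rectification_step r wl l p (a, b) (G, T)\<close>, step \<open>(l, i)\<close> starts with \<open>G = R(l, i-1)\<close> and
  \<open>T = T(l, i-1)\<close>; \<open>wl\<close> is the permutation of the rows \<open>\<ge> l\<close> of \<open>R\<close>, \<open>p\<close> is the crossing
  to be added, and \<open>(a, b)\<close> is the entry to be put in box \<open>i\<close>. Since \<open>T\<close> is filled up to \<open>i - 1\<close>, its
  last entry is the one of box \<open>i - 1\<close>. At an allowed place, the two types are told apart by \<open>c \<le> r\<close>: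
  the second components of the entries of a tableau of transpositions are \<open>> r\<close>.
\<close>

definition rectification_step ::
  "nat \<Rightarrow> (nat \<Rightarrow> nat) \<Rightarrow> nat \<Rightarrow> nat \<times> nat \<Rightarrow> nat \<times> nat \<Rightarrow>
     graph \<times> (nat \<times> nat) tableau \<Rightarrow> (graph \<times> (nat \<times> nat) tableau) option" where
  "rectification_step r wl l p ab GT = (case (ab, GT) of ((a, b), (G, T)) \<Rightarrow>
     let R' = insert p G; T' = push T (a, b) in
     if row_strict (E_tab wl T') \<and> col_strict (E_tab wl T') \<and> bruhat_package r (wl, R', T')
     then Some (R', T')
     else do {
       (j0, T'') \<leftarrow>
         (if \<exists>j. h_cross R' b a l j
          then do { j \<leftarrow> the_unique (h_cross R' b a l); Some (j, T) }
          else if entries T \<noteq> [] \<and> fst (last (entries T)) = a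
          then do { j \<leftarrow> the_unique (h_cross R' b (snd (last (entries T))) l);
                    Some (j, set_last T (a, b)) }
          else None);
       let R'' = R' - {(l, j0)};
       (j, c, d) \<leftarrow> rightmost (\<lambda>j c d. j < j0 \<and> (l, j) \<notin> R'' \<and> strands_at R'' c d l j \<and> r < d \<and>
         (c \<le> r \<or> (entries T'' \<noteq> [] \<and> c = snd (last (entries T'')))));
       Some (insert (l, j) R'',
         if c \<le> r then push T'' (c, d)
         else (let (e, g) = last (entries T'') in push (set_last T'' (e, d)) (e, g)))
     })"

text \<open>
  \<open>row_pass r R Y l G0 old i\<close> is the pair \<open>(R(l, i), T(l, i))\<close>, where \<open>G0 = R(l, 0)\<close> and \<open>old i\<close>
  provides the crossing and the entry that a rectification step \<open>(l, i)\<close> brings back.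
\<close>

primrec row_pass ::
  "nat \<Rightarrow> graph \<Rightarrow> graph \<Rightarrow> nat \<Rightarrow> graph \<Rightarrow> (nat \<Rightarrow> ((nat \<times> nat) \<times> (nat \<times> nat)) option) \<Rightarrow> nat \<Rightarrow>
     (graph \<times> (nat \<times> nat) tableau) option" where
  "row_pass r R Y l G0 old 0 = Some (G0, Tableau (shuffle_shape r (graph_perm (rows_ge Y l))) [])"
| "row_pass r R Y l G0 old (Suc i) = do {
     GT \<leftarrow> row_pass r R Y l G0 old i;
     if word_of r (rows_ge Y l) ! i = l
     then insertion_step r l GT
     else do {
       (p, ab) \<leftarrow> old (Suc i);
       rectification_step r (graph_perm (rows_ge R l)) l p ab GT
     }
   }"

text \<open>
  The crossing and the entry needed at the rectification step \<open>(l, i)\<close>, taken from the package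
  \<open>P = P(l+1)\<close>; here \<open>ip\<close> is the number \<open>i\<^sub>+\<close> that box \<open>i\<close> has in the smaller diagram.
\<close>

definition old_data ::
  "nat \<Rightarrow> graph \<Rightarrow> nat \<Rightarrow> package \<Rightarrow> nat \<Rightarrow> ((nat \<times> nat) \<times> (nat \<times> nat)) option" where
  "old_data r Y l P i = (
     let sh = shuffle_shape r (graph_perm (rows_ge Y l));
         sh' = shuffle_shape r (graph_perm (rows_ge Y (l + 1)))
     in do {
       ip \<leftarrow> the_unique (\<lambda>k. 1 \<le> k \<and> k \<le> length (boxes sh') \<and> boxes sh' ! (k - 1) = boxes sh ! (i - 1));
       G1 \<leftarrow> S_graph r P ip;
       G0 \<leftarrow> S_graph r P (ip - 1);
       p \<leftarrow> the_unique (\<lambda>p. p \<in> G1 \<and> p \<notin> G0);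
       Some (p, entries (snd (snd P)) ! (ip - 1))
     })"

text \<open>\<open>row_result r R Y k\<close> is \<open>(R(l), T(l))\<close> for \<open>l = r - k\<close>; the rows are processed from \<open>r\<close> up to 1.\<close>

primrec row_result ::
  "nat \<Rightarrow> graph \<Rightarrow> graph \<Rightarrow> nat \<Rightarrow> (graph \<times> (nat \<times> nat) tableau) option" where
  "row_result r R Y 0 = row_pass r R Y r (rows_ge R r) (\<lambda>_. None) (card (rows_ge Y r))"
| "row_result r R Y (Suc k) = do {
     (G, T) \<leftarrow> row_result r R Y k;
     let l = r - Suc k;
     let P = (graph_perm (rows_ge R (l + 1)), G, T);
     G0 \<leftarrow> S_graph r P 0;
     row_pass r R Y l (G0 \<union> row_of R l) (old_data r Y l P) (card (rows_ge Y l))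
   }"

text \<open>\<open>Some (R \<leftarrow> Y, T(R, Y))\<close> if the algorithm can be carried out on \<open>(R, Y)\<close>, otherwise \<open>None\<close>.\<close>

definition rc_insert ::
  "nat \<Rightarrow> graph \<Rightarrow> graph \<Rightarrow> (graph \<times> (nat \<times> nat) tableau) option" where
  "rc_insert r R Y = row_result r R Y (r - 1)"

end

theory Submission
  imports Defs
begin

text \<open>
  A permutation \<open>w\<close> is encoded by its line \<open>f = inv w\<close>, which lists the strands by their positions.
  Adding a row with label set \<open>K\<close> cuts the line into blocks, the maximal runs of positions joined by
  labels of \<open>K\<close>, and moves the first strand of each block, its head, to the end of the block; the
  graph is reduced iff in each row every head is the smallest strand of its block. A rectification step swaps, in the line
  below the current row, a strand \<open>a \<le> r\<close> at position \<open>P\<close> with a strand \<open>b > r\<close> at position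
  \<open>Q\<close>. The result stays reduced unless \<open>a\<close> is the head of a block containing \<open>b\<close>. In that case the
  block is cut before \<open>Q\<close>, and a search to the left joins two other blocks; between the place where
  the search ends and \<open>P\<close> all strands are \<open>> r\<close>. This makes the entries of \<open>E(w, T)\<close>
  increase along a row of boxes for arbitrary \<open>w\<close>. Along the first column of a hook the same
  zones force the entries to decrease. If \<open>w\<close> is a semi-shuffle, all lines that occur list the strands
  \<open>> r\<close> in increasing order, so neither second-type insertions nor the removal of a crossing with the
  strand in box \<open>i - 1\<close> ever happen, and each entry can be compared directly with the one below it.
\<close>

section \<open>Inversions\<close>

text \<open>A row pass is governed by one equation,
  \<open>f \<circ> sigma K = chain_line es g\<close>: \<open>f\<close> is the line below the row,
  \<open>K\<close> its current labels, \<open>g\<close> the line above the row when the pass starts,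
  and \<open>es\<close> the entries put in so far. Counting inversions on both sides turns the
  length conditions of a Bruhat package into reducedness of this single row. An entry of
  \<open>E(w, T)\<close> is itself a position, the left one of the two that the swap of its box
  exchanges. So the entries obtained in one row are the positions at which the next row is
  rectified, and their strictness, the conclusion of one pass, is a hypothesis of the next.

  The obstacle is the comparison with the box below: it may have been filled many steps earlier,
  whereas the equation only controls the present line. For a hook, wherever there is a box below, it
  is the box filled just before, so a condition on the last box is enough. In the semi-shuffle case
  a separate record is carried for each box of the current row and for each box of the row below
  that is still to be compared.\<close>

definition fin_perm :: "(nat \<Rightarrow> nat) \<Rightarrow> bool" where
  "fin_perm f \<longleftrightarrow> bij f \<and> f 0 = 0 \<and> (\<exists>n. \<forall>k>n. f k = k)"

lemma fin_perm_S_inf: "fin_perm f \<longleftrightarrow> f \<in> S_inf"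
proof
  assume f: "fin_perm f"
  then obtain n where n: "\<forall>k>n. f k = k" unfolding fin_perm_def by auto
  have "f permutes {1..n}"
    unfolding permutes_def
    using f n unfolding fin_perm_def bij_iff
    by (metis atLeastAtMost_iff leI less_one)
  then show "f \<in> S_inf" unfolding S_inf_def by auto
next
  assume "f \<in> S_inf"
  then obtain n where n: "f permutes {1..n}" unfolding S_inf_def by auto
  show "fin_perm f"
    unfolding fin_perm_def
  proof (intro conjI exI allI impI)
    show "bij f" using n by (rule permutes_bij)
    show "f 0 = 0" using n by (simp add: permutes_def)
    fix k assume "k > n" then show "f k = k" using n by (simp add: permutes_def)
  qed
qed

lemma fin_perm_id [simp]: "fin_perm id" by (auto simp: fin_perm_def)

lemma fin_perm_bij: "fin_perm f \<Longrightarrow> bij f" by (auto simp: fin_perm_def)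

lemma fin_perm_inj: "fin_perm f \<Longrightarrow> inj f" by (auto simp: fin_perm_def bij_def)

lemma fin_perm_eq_iff: "fin_perm f \<Longrightarrow> f p = f q \<longleftrightarrow> p = q"
  using fin_perm_inj by (meson injD)

lemma fin_perm_zero: "fin_perm f \<Longrightarrow> f p = 0 \<longleftrightarrow> p = 0"
  by (metis fin_perm_def fin_perm_eq_iff)

lemma fin_perm_comp: "fin_perm f \<Longrightarrow> fin_perm g \<Longrightarrow> fin_perm (f \<circ> g)"
  unfolding fin_perm_def
  apply (intro conjI)
  apply (simp add: bij_comp)
  apply simp
  by (metis comp_apply max_less_iff_conj)

lemma fin_perm_transpose: "1 \<le> a \<Longrightarrow> 1 \<le> b \<Longrightarrow> fin_perm (transpose a b)"
  unfolding fin_perm_def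
  by (auto simp: transpose_def intro!: exI[of _ "max a b"])

lemma fin_perm_inv: "fin_perm f \<Longrightarrow> fin_perm (inv f)"
  unfolding fin_perm_def
  by (metis bij_imp_bij_inv bij_inv_eq_iff)

lemma inv_fin_perm_f: "fin_perm f \<Longrightarrow> inv f (f x) = x"
  by (simp add: fin_perm_inj)

lemma f_inv_fin_perm: "fin_perm f \<Longrightarrow> f (inv f x) = x"
  by (simp add: bij_is_surj fin_perm_bij surj_f_inv_f)

lemma inv_inv_fin_perm: "fin_perm f \<Longrightarrow> inv (inv f) = f"
  by (simp add: fin_perm_bij inv_inv_eq)

lemma inv_comp_fin_perm: "fin_perm f \<Longrightarrow> fin_perm g \<Longrightarrow> inv (f \<circ> g) = inv g \<circ> inv f"
  by (simp add: fin_perm_bij o_inv_distrib)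

definition inversions :: "(nat \<Rightarrow> nat) \<Rightarrow> (nat \<times> nat) set" where
  "inversions f = {(p, q). p < q \<and> f q < f p}"

definition ninv :: "(nat \<Rightarrow> nat) \<Rightarrow> nat" where "ninv f = card (inversions f)"

lemma finite_inversions:
  assumes "fin_perm f"
  shows "finite (inversions f)"
proof -
  obtain n where n: "\<forall>k>n. f k = k" using assms unfolding fin_perm_def by auto
  have "inversions f \<subseteq> {0..n} \<times> {0..n}"
  proof
    fix z assume "z \<in> inversions f"
    then obtain p q where z: "z = (p, q)" "p < q" "f q < f p" unfolding inversions_def by auto
    have "q \<le> n"
    proof (rule ccontr)
      assume "\<not> q \<le> n"
      then have fq: "f q = q" using n by auto
      then have "f p > q" using z by simp
      then have "f (f p) = f p" using n \<open>\<not> q \<le> n\<close> by auto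
      then have "f p = p" using assms fin_perm_eq_iff by blast
      then show False using \<open>f p > q\<close> z by simp
    qed
    then show "z \<in> {0..n} \<times> {0..n}" using z by auto
  qed
  then show ?thesis using finite_subset by blast
qed

lemma transpose_adj_less:
  fixes p q :: nat
  shows "p < q \<Longrightarrow> (p, q) \<noteq> (k, Suc k) \<Longrightarrow> transpose k (Suc k) p < transpose k (Suc k) q"
  by (auto simp: transpose_def)

text \<open>An adjacent swap reverses the order of no pair of positions except
  \<open>(k, Suc k)\<close>. So \<open>?m\<close>, which applies the swap to both coordinates,
  carries the inversions of \<open>f\<close> bijectively to those of the new function other than
  that one pair.\<close>

lemma ninv_adj:
  assumes f: "fin_perm f" and lt: "f k < f (Suc k)"
  shows "ninv (f \<circ> transpose k (Suc k)) = Suc (ninv f)"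
proof -
  let ?s = "transpose k (Suc k)"
  let ?m = "map_prod ?s ?s"
  have *: "inversions (f \<circ> ?s) = insert (k, Suc k) (?m ` inversions f)"
  proof (intro set_eqI iffI)
    fix z assume "z \<in> inversions (f \<circ> ?s)"
    then obtain p q where z: "z = (p, q)" "p < q" "f (?s q) < f (?s p)" unfolding inversions_def by auto
    show "z \<in> insert (k, Suc k) (?m ` inversions f)"
    proof (cases "(p, q) = (k, Suc k)")
      case False
      then have "(?s p, ?s q) \<in> inversions f" using z transpose_adj_less[of p q k] unfolding inversions_def by auto
      then have "?m (?s p, ?s q) \<in> ?m ` inversions f" by blast
      then show ?thesis using z by simp
    qed (use z in simp)
  next
    fix z assume "z \<in> insert (k, Suc k) (?m ` inversions f)"
    then show "z \<in> inversions (f \<circ> ?s)"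
    proof
      assume "z = (k, Suc k)" then show ?thesis using lt by (simp add: inversions_def)
    next
      assume "z \<in> ?m ` inversions f"
      then obtain p q where pq: "p < q" "f q < f p" "z = (?s p, ?s q)" unfolding inversions_def by auto
      then have "(p, q) \<noteq> (k, Suc k)" using lt by auto
      then show ?thesis using pq transpose_adj_less[of p q k] by (simp add: inversions_def)
    qed
  qed
  have nin: "(k, Suc k) \<notin> ?m ` inversions f"
  proof
    assume "(k, Suc k) \<in> ?m ` inversions f"
    then obtain p q where pq: "p < q" "f q < f p" "k = ?s p" "Suc k = ?s q" unfolding inversions_def by auto
    then have "p = Suc k" "q = k" by (metis transpose_involutory transpose_apply_first, metis transpose_involutory transpose_apply_second)
    then show False using pq by simp
  qed
  have "inj ?m" by (simp add: bij_is_inj prod.inj_map)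
  then have "card (?m ` inversions f) = card (inversions f)" by (meson card_image inj_on_subset subset_UNIV)
  then show ?thesis unfolding ninv_def * using nin finite_inversions[OF f] by simp
qed

lemma ninv_adj_down:
  assumes f: "fin_perm f" and lt: "f (Suc k) < f k" and k: "1 \<le> k"
  shows "ninv f = Suc (ninv (f \<circ> transpose k (Suc k)))"
proof -
  let ?g = "f \<circ> transpose k (Suc k)"
  have "fin_perm ?g" using f k by (intro fin_perm_comp fin_perm_transpose) auto
  moreover have "?g k < ?g (Suc k)" using lt by simp
  ultimately have "ninv (?g \<circ> transpose k (Suc k)) = Suc (ninv ?g)" by (rule ninv_adj)
  then show ?thesis by (simp add: comp_assoc)
qed

text \<open>\<open>transpose p q\<close> is \<open>transpose (Suc p) q\<close> conjugated by the
  adjacent swap at \<open>p\<close>. Since \<open>f p < f q\<close>, at most one of the two outer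
  swaps lowers the count, and then the other one raises it, so the strict gain of the inner swap
  survives.\<close>

lemma ninv_swap_up:
  assumes "fin_perm f" and "1 \<le> p" and "p < q" and "f p < f q"
  shows "ninv f < ninv (f \<circ> transpose p q)"
  using assms
proof (induction "q - p" arbitrary: f p q rule: less_induct)
  case less
  show ?case
  proof (cases "q = Suc p")
    case True
    then show ?thesis using ninv_adj[of f p] less.prems by simp
  next
    case False
    let ?s = "transpose p (Suc p)" and ?t = "transpose (Suc p) q"
    let ?f1 = "f \<circ> ?s" let ?f2 = "?f1 \<circ> ?t" let ?f3 = "?f2 \<circ> ?s"
    have eq: "?f3 = f \<circ> transpose p q"
      using False less.prems by (auto simp: fun_eq_iff transpose_def)
    have fs: "fin_perm ?s" "fin_perm ?t" using less.prems by (auto intro!: fin_perm_transpose)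
    have f1: "fin_perm ?f1" using less.prems fs by (auto intro: fin_perm_comp)
    have f2: "fin_perm ?f2" using f1 fs by (auto intro: fin_perm_comp)
    have ih: "ninv ?f1 < ninv ?f2"
    proof (rule less.hyps)
      show "q - Suc p < q - p" using less.prems by simp
      show "?f1 (Suc p) < ?f1 q" using less.prems False by (simp add: transpose_def)
      show "fin_perm ?f1" by (rule f1)
    qed (use less.prems False in auto)
    have d: "f p \<noteq> f (Suc p)" "f (Suc p) \<noteq> f q" using less.prems False by (auto simp: fin_perm_eq_iff)
    have v2: "?f2 p = f (Suc p)" "?f2 (Suc p) = f q" using less.prems False by (auto simp: transpose_def)
    have a: "f p < f (Suc p) \<Longrightarrow> ninv ?f1 = Suc (ninv f)" using ninv_adj less.prems by blast
    have b: "f p > f (Suc p) \<Longrightarrow> ninv f = Suc (ninv ?f1)" using ninv_adj_down less.prems by blast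
    have c: "f (Suc p) < f q \<Longrightarrow> ninv ?f3 = Suc (ninv ?f2)" using ninv_adj[OF f2, of p] v2 by simp
    have e: "f (Suc p) > f q \<Longrightarrow> ninv ?f2 = Suc (ninv ?f3)" using ninv_adj_down[OF f2, of p] v2 less.prems by simp
    show ?thesis using a b c d e ih less.prems unfolding eq by linarith
  qed
qed

lemma ninv_swap_iff:
  assumes "fin_perm f" and "1 \<le> p" and "p < q"
  shows "ninv f < ninv (f \<circ> transpose p q) \<longleftrightarrow> f p < f q"
proof
  assume *: "ninv f < ninv (f \<circ> transpose p q)"
  show "f p < f q"
  proof (rule ccontr)
    assume "\<not> f p < f q"
    then have "f q < f p" using assms fin_perm_eq_iff[of f p q] by linarith
    then have "ninv (f \<circ> transpose p q) < ninv ((f \<circ> transpose p q) \<circ> transpose p q)"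
      using assms by (intro ninv_swap_up) (auto intro!: fin_perm_comp fin_perm_transpose)
    then show False using * by (simp add: comp_assoc)
  qed
qed (use ninv_swap_up assms in blast)

text \<open>A value between the two swapped ones splits the swap into three swaps, each of which
  raises the count. Hence a swap that gains exactly one inversion has no such value between its
  positions; the last clause of \<open>bcover\<close> is obtained in this way.\<close>

lemma ninv_swap_between:
  assumes "fin_perm f" and "1 \<le> p" and "p < k" and "k < q" and "f p < f k" and "f k < f q"
  shows "ninv f + 3 \<le> ninv (f \<circ> transpose p q)"
proof -
  let ?f1 = "f \<circ> transpose p k" let ?f2 = "?f1 \<circ> transpose p q" let ?f3 = "?f2 \<circ> transpose k q"
  have eq: "?f3 = f \<circ> transpose p q" using assms by (auto simp: fun_eq_iff transpose_def)
  have f1: "fin_perm ?f1" using assms by (auto intro!: fin_perm_comp fin_perm_transpose)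
  have f2: "fin_perm ?f2" using f1 assms by (auto intro!: fin_perm_comp fin_perm_transpose)
  have "ninv f < ninv ?f1" using assms by (intro ninv_swap_up) auto
  moreover have "ninv ?f1 < ninv ?f2" using assms f1 by (intro ninv_swap_up) (auto simp: transpose_def)
  moreover have "ninv ?f2 < ninv ?f3" using assms f2 by (intro ninv_swap_up) (auto simp: transpose_def)
  ultimately show ?thesis unfolding eq by simp
qed

section \<open>Words of adjacent transpositions and the Coxeter length\<close>

lemma word_perm_Nil [simp]: "word_perm [] = id" by (simp add: word_perm_def)
lemma word_perm_Cons [simp]: "word_perm (k # ks) = transpose k (Suc k) \<circ> word_perm ks"
  by (simp add: word_perm_def)
lemma word_perm_append: "word_perm (xs @ ys) = word_perm xs \<circ> word_perm ys"
  by (induction xs) (auto simp: comp_assoc)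

lemma fin_perm_word: "\<forall>k\<in>set ks. 1 \<le> k \<Longrightarrow> fin_perm (word_perm ks)"
  by (induction ks) (auto intro!: fin_perm_comp fin_perm_transpose)

text \<open>Prepending a letter multiplies the permutation on the left, which exchanges values; on
  the inverse it becomes a swap of two adjacent positions. This is why lines are inverses and
  lengths are counted on inverses.\<close>

lemma inv_word_Cons:
  assumes "\<forall>k\<in>set (k # ks). 1 \<le> k"
  shows "inv (word_perm (k # ks)) = inv (word_perm ks) \<circ> transpose k (Suc k)"
  using assms fin_perm_word[of ks] by (simp add: inv_comp_fin_perm fin_perm_transpose)

lemma ninv_adj_le:
  assumes "fin_perm f" "1 \<le> k"
  shows "ninv (f \<circ> transpose k (Suc k)) \<le> Suc (ninv f)"
  using ninv_adj[of f k] ninv_adj_down[of f k] assms fin_perm_eq_iff[of f k "Suc k"]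
  by (metis Suc_n_not_le_n lessI less_or_eq_imp_le nat_le_linear nat_neq_iff le_SucI)

lemma ninv_id [simp]: "ninv (\<lambda>k. k) = 0"
proof -
  have "inversions (\<lambda>k. k) = {}" by (auto simp: inversions_def)
  then show ?thesis by (simp add: ninv_def)
qed

lemma ninv_id' [simp]: "ninv id = 0" by (simp add: id_def)

lemma ninv_word: "\<forall>k\<in>set ks. 1 \<le> k \<Longrightarrow> ninv (inv (word_perm ks)) \<le> length ks"
proof (induction ks)
  case Nil
  then show ?case by (simp add: inv_id)
next
  case (Cons k ks)
  then have "ninv (inv (word_perm ks)) \<le> length ks" by simp
  moreover have "ninv (inv (word_perm ks) \<circ> transpose k (Suc k)) \<le> Suc (ninv (inv (word_perm ks)))"
    using Cons.prems by (intro ninv_adj_le fin_perm_inv fin_perm_word) auto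
  ultimately show ?case unfolding inv_word_Cons[OF Cons.prems] by (metis Suc_le_mono length_Cons order_trans)
qed

lemma fin_perm_ascending:
  assumes f: "fin_perm f" and asc: "\<forall>k\<ge>1. f k < f (Suc k)"
  shows "f = id"
proof -
  have 0: "f 0 < f (Suc 0)" using f fin_perm_zero[OF f, of "Suc 0"] by (auto simp: fin_perm_def)
  then have asc': "\<And>k. f k < f (Suc k)" using asc by (metis One_nat_def not_less_eq_eq le0 Suc_le_eq neq0_conv)
  then have sm: "strict_mono f" by (simp add: strict_mono_Suc_iff)
  obtain n where n: "\<forall>k>n. f k = k" using f by (auto simp: fin_perm_def)
  have ge: "\<And>k. k \<le> f k" using sm by (simp add: strict_mono_imp_increasing)
  have "k \<le> Suc n \<Longrightarrow> f k \<le> k" for k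
  proof (induction k rule: inc_induct)
    case base show ?case using n by simp
  next
    case (step m) then show ?case using asc'[of m] by linarith
  qed
  then have "f k = k" for k using ge[of k] n by (metis dual_order.antisym leI le_SucI)
  then show ?thesis by auto
qed

text \<open>Sorting: a line other than the identity has a descent at a positive position, and the
  swap there removes exactly one inversion and contributes one letter.\<close>

lemma ex_reduced_word:
  "fin_perm f \<Longrightarrow> \<exists>ks. length ks = ninv f \<and> (\<forall>k\<in>set ks. 1 \<le> k) \<and> inv (word_perm ks) = f"
proof (induction "ninv f" arbitrary: f rule: less_induct)
  case less
  show ?case
  proof (cases "f = id")
    case True
    then show ?thesis by (intro exI[of _ "[]"]) (simp add: inv_id)
  next
    case False
    then obtain k where k: "1 \<le> k" "\<not> f k < f (Suc k)" using fin_perm_ascending less.prems by blast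
    then have lt: "f (Suc k) < f k" using fin_perm_eq_iff[OF less.prems, of k "Suc k"] by linarith
    let ?g = "f \<circ> transpose k (Suc k)"
    have g: "ninv f = Suc (ninv ?g)" using ninv_adj_down[OF less.prems lt k(1)] .
    have fg: "fin_perm ?g" using less.prems k by (auto intro!: fin_perm_comp fin_perm_transpose)
    obtain ks where ks: "length ks = ninv ?g" "\<forall>k\<in>set ks. 1 \<le> k" "inv (word_perm ks) = ?g"
      using less.hyps[OF _ fg] g by auto
    have "inv (word_perm (k # ks)) = f"
      using inv_word_Cons[of k ks] ks k by (simp add: comp_assoc)
    then show ?thesis using ks k g by (intro exI[of _ "k # ks"]) auto
  qed
qed

lemma cox_length_ninv:
  assumes "fin_perm w"
  shows "cox_length w = ninv (inv w)"
  unfolding cox_length_def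
proof (rule Least_equality)
  obtain ks where ks: "length ks = ninv (inv w)" "\<forall>k\<in>set ks. 1 \<le> k" "inv (word_perm ks) = inv w"
    using ex_reduced_word[OF fin_perm_inv[OF assms]] by blast
  then have "word_perm ks = w" using fin_perm_word[OF ks(2)] assms by (metis inv_inv_fin_perm)
  then show "\<exists>ks. length ks = ninv (inv w) \<and> (\<forall>k\<in>set ks. 1 \<le> k) \<and> word_perm ks = w" using ks by blast
next
  fix n assume "\<exists>ks. length ks = n \<and> (\<forall>k\<in>set ks. 1 \<le> k) \<and> word_perm ks = w"
  then show "ninv (inv w) \<le> n" using ninv_word by blast
qed

lemma inv_comp_transpose:
  assumes "fin_perm w" "1 \<le> a" "1 \<le> b"
  shows "inv (w \<circ> transpose a b) = transpose a b \<circ> inv w"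
  using assms by (simp add: inv_comp_fin_perm fin_perm_transpose)

lemma transpose_comp_fin_perm:
  assumes "fin_perm f"
  shows "transpose (f p) (f q) \<circ> f = f \<circ> transpose p q"
  using assms by (auto simp: fun_eq_iff transpose_def fin_perm_eq_iff)

section \<open>One row of a graph\<close>

text \<open>
  The label set \<open>K\<close> of a row splits the positions into blocks; \<open>block_start K k\<close> and \<open>block_end K k\<close> are
  the first and the last position of the block of \<open>k\<close>. The strand at position \<open>k\<close> above the row comes from
  position \<open>sigma K k\<close> below it, and \<open>rho K\<close> is the inverse of \<open>sigma K\<close>.
\<close>

primrec block_start :: "nat set \<Rightarrow> nat \<Rightarrow> nat" where
  "block_start K 0 = 0"
| "block_start K (Suc k) = (if k \<in> K then block_start K k else Suc k)"

definition block_end :: "nat set \<Rightarrow> nat \<Rightarrow> nat" where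
  "block_end K p = (LEAST q. p \<le> q \<and> q \<notin> K)"

definition sigma :: "nat set \<Rightarrow> nat \<Rightarrow> nat" where
  "sigma K k = (if k \<in> K then Suc k else block_start K k)"

definition rho :: "nat set \<Rightarrow> nat \<Rightarrow> nat" where
  "rho K p = (if 0 < p \<and> p - 1 \<in> K then p - 1 else block_end K p)"

text \<open>At label \<open>k\<close> the horizontal strand is the head of the block of
  \<open>k\<close>, and the vertical strand is the one at \<open>Suc k\<close>. So the condition
  asks that at each crossing of the row the horizontal strand be the smaller one.\<close>

definition reduced_row :: "nat set \<Rightarrow> (nat \<Rightarrow> nat) \<Rightarrow> bool" where
  "reduced_row K f \<longleftrightarrow> (\<forall>k\<in>K. f (block_start K k) < f (Suc k))"

lemma block_start_le: "block_start K k \<le> k" by (induction k) auto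

lemma block_start_mem: "block_start K k \<le> j \<Longrightarrow> j < k \<Longrightarrow> j \<in> K"
proof (induction k)
  case (Suc k)
  then show ?case by (cases "j = k") (auto split: if_splits)
qed simp

lemma block_start_pred: "0 < block_start K k \<Longrightarrow> block_start K k - 1 \<notin> K"
  by (induction k) auto

lemma block_start_eqI:
  assumes "s \<le> k" "\<And>j. s \<le> j \<Longrightarrow> j < k \<Longrightarrow> j \<in> K" "s = 0 \<or> s - 1 \<notin> K"
  shows "block_start K k = s"
  using assms
proof (induction k)
  case (Suc k)
  then show ?case by (cases "s = Suc k") auto
qed simp

lemma block_start_cong: "(\<And>j. j < k \<Longrightarrow> j \<in> K \<longleftrightarrow> j \<in> K') \<Longrightarrow> block_start K k = block_start K' k"
  by (induction k) auto

lemma block_start_head: "p = 0 \<or> p - 1 \<notin> K \<Longrightarrow> block_start K p = p"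
  by (cases p) auto

lemma block_start_self_iff: "block_start K p = p \<longleftrightarrow> p = 0 \<or> p - 1 \<notin> K"
proof (cases p)
  case (Suc k) then show ?thesis using block_start_le[of K k] by auto
qed simp

lemma block_start_same: "block_start K k \<le> j \<Longrightarrow> j \<le> k \<Longrightarrow> block_start K j = block_start K k"
  by (intro block_start_eqI) (use block_start_mem block_start_pred block_start_le in \<open>auto simp: Suc_le_eq\<close>)

lemma block_start_idem [simp]: "block_start K (block_start K k) = block_start K k"
  by (rule block_start_same) (auto simp: block_start_le)


context
  fixes K :: "nat set"
  assumes fin: "finite K"
begin

lemma block_end_ex: "\<exists>q\<ge>p. q \<notin> K"
proof -
  obtain n where "\<forall>k\<in>K. k < n" using fin finite_nat_set_iff_bounded by auto
  then show ?thesis by (intro exI[of _ "max p n"]) auto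
qed

lemma block_end_props: "p \<le> block_end K p" "block_end K p \<notin> K"
  using LeastI_ex[of "\<lambda>q. p \<le> q \<and> q \<notin> K"] block_end_ex[of p] unfolding block_end_def by auto

lemma block_end_mem: "p \<le> j \<Longrightarrow> j < block_end K p \<Longrightarrow> j \<in> K"
  using not_less_Least[of j "\<lambda>q. p \<le> q \<and> q \<notin> K"] unfolding block_end_def by auto

lemma block_end_eqI: "p \<le> e \<Longrightarrow> e \<notin> K \<Longrightarrow> (\<And>j. p \<le> j \<Longrightarrow> j < e \<Longrightarrow> j \<in> K) \<Longrightarrow> block_end K p = e"
  by (metis block_end_mem block_end_props nat_neq_iff)

lemma block_start_block_end: "p \<le> j \<Longrightarrow> j \<le> block_end K p \<Longrightarrow> block_start K j = block_start K p"
proof -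
  assume a: "p \<le> j" "j \<le> block_end K p"
  show ?thesis
  proof (rule block_start_eqI)
    show "block_start K p \<le> j" using a block_start_le[of K p] by linarith
    show "block_start K p = 0 \<or> block_start K p - 1 \<notin> K" using block_start_pred by auto
    fix i assume "block_start K p \<le> i" "i < j"
    then show "i \<in> K" using a block_start_mem[of K p i] block_end_mem[of p i] by (cases "i < p") auto
  qed
qed

lemma sigma_rho: "sigma K (rho K p) = p"
proof (cases "0 < p \<and> p - 1 \<in> K")
  case True then show ?thesis by (simp add: rho_def sigma_def)
next
  case False
  then have "block_start K (block_end K p) = p" using block_start_block_end[of p "block_end K p"] block_end_props[of p] block_start_head[of p K] by auto
  then show ?thesis using False block_end_props by (auto simp: rho_def sigma_def)
qed

lemma rho_sigma: "rho K (sigma K k) = k"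
proof (cases "k \<in> K")
  case True then show ?thesis by (simp add: rho_def sigma_def)
next
  case False
  have "block_end K (block_start K k) = k" by (rule block_end_eqI) (use False block_start_le block_start_mem in auto)
  then show ?thesis using False block_start_pred[of K k] by (auto simp: rho_def sigma_def)
qed

lemma bij_sigma: "bij (sigma K)"
  by (metis bijI' rho_sigma sigma_rho)

lemma rho_inj: "rho K p = rho K q \<longleftrightarrow> p = q" by (metis sigma_rho)

lemma fin_perm_sigma: "0 \<notin> K \<Longrightarrow> fin_perm (sigma K)"
  unfolding fin_perm_def
proof (intro conjI)
  assume "0 \<notin> K" then show "sigma K 0 = 0" by (simp add: sigma_def)
  obtain n where n: "\<forall>k\<in>K. k < n" using fin finite_nat_set_iff_bounded by auto
  have "sigma K k = k" if "k > n" for k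
    using n that by (auto simp: sigma_def block_start_self_iff)
  then show "\<exists>n. \<forall>k>n. sigma K k = k" by auto
qed (rule bij_sigma)

end

lemma rho_ge: "finite K \<Longrightarrow> p \<le> Suc (rho K p)"
  using block_end_props(1)[of K p] by (auto simp: rho_def)

text \<open>A label beyond all others appends one adjacent swap of positions. This is the induction
  step both for counting inversions and for the word of a row.\<close>

lemma sigma_insert:
  assumes "\<And>k. k \<in> K \<Longrightarrow> k < m"
  shows "sigma (insert m K) = sigma K \<circ> transpose m (Suc m)"
proof
  fix k
  have eq: "block_start (insert m K) j = block_start K j" if "j \<le> m" for j
    using that by (intro block_start_cong) auto
  have big: "block_start (insert m K) j = j" "block_start K j = j" if "j > Suc m" for j
    using assms[of "j - 1"] that by (auto intro!: block_start_head)
  have mm: "m \<notin> K" "Suc m \<notin> K" using assms by fastforce+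
  consider "k < m" | "k = m" | "k = Suc m" | "k > Suc m" by linarith
  then show "sigma (insert m K) k = (sigma K \<circ> transpose m (Suc m)) k"
  proof cases
    case 1 then show ?thesis by (simp add: sigma_def eq transpose_def)
  next
    case 2 then show ?thesis using mm by (simp add: sigma_def)
  next
    case 3 then show ?thesis using mm by (simp add: sigma_def eq)
  next
    case 4 then have "k \<notin> K" using assms by force
    then show ?thesis using 4 by (simp add: sigma_def big transpose_def)
  qed
qed

lemma reduced_row_insert:
  assumes "\<And>k. k \<in> K \<Longrightarrow> k < m"
  shows "reduced_row (insert m K) f \<longleftrightarrow> reduced_row K f \<and> f (block_start K m) < f (Suc m)"
proof -
  have eq: "block_start (insert m K) j = block_start K j" if "j \<le> m" for j
    using that by (intro block_start_cong) auto
  then show ?thesis unfolding reduced_row_def using assms eq by (auto simp: less_imp_le)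
qed

text \<open>Each label contributes one adjacent swap, which changes the count by one, up or down.
  The maximal gain \<open>card K\<close> is therefore reached iff every swap goes up, and for the
  largest label \<open>m\<close> the swap compares the head of its block with the strand at
  \<open>Suc m\<close>.\<close>

lemma ninv_row:
  assumes "finite K" "fin_perm f" "0 \<notin> K"
  shows "ninv (f \<circ> sigma K) \<le> ninv f + card K \<and> (ninv (f \<circ> sigma K) = ninv f + card K \<longleftrightarrow> reduced_row K f)"
  using assms(1,3)
proof (induction K rule: finite_linorder_max_induct)
  case empty
  have "sigma {} = id" by (auto simp: sigma_def block_start_self_iff)
  then show ?case by (simp add: reduced_row_def)
next
  case (insert m A)
  let ?g = "f \<circ> sigma A"
  have fg: "fin_perm ?g" using insert assms(2) by (auto intro!: fin_perm_comp fin_perm_sigma)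
  have m: "m \<notin> A" "Suc m \<notin> A" "1 \<le> m" using insert by (auto simp: Suc_le_eq) 
  have s: "f \<circ> sigma (insert m A) = ?g \<circ> transpose m (Suc m)"
    using sigma_insert[of A m] insert by (auto simp: fun_eq_iff)
  have c: "card (insert m A) = Suc (card A)" using m insert by simp
  have r: "reduced_row (insert m A) f \<longleftrightarrow> reduced_row A f \<and> ?g m < ?g (Suc m)"
    using reduced_row_insert[of A m f] insert m by (auto simp: sigma_def)
  have ne: "?g m \<noteq> ?g (Suc m)" using fin_perm_eq_iff[OF fg, of m "Suc m"] by simp
  have up: "?g m < ?g (Suc m) \<Longrightarrow> ninv (?g \<circ> transpose m (Suc m)) = Suc (ninv ?g)" by (rule ninv_adj[OF fg])
  have down: "?g (Suc m) < ?g m \<Longrightarrow> ninv ?g = Suc (ninv (?g \<circ> transpose m (Suc m)))" by (rule ninv_adj_down[OF fg _ m(3)])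
  have 1: "0 \<notin> A" using insert by simp
  note ih = insert.IH[OF 1]
  show ?case
  proof (cases "?g m < ?g (Suc m)")
    case True
    have "n \<le> a \<and> (n = a \<longleftrightarrow> R) \<Longrightarrow> m = Suc n \<Longrightarrow> L \<Longrightarrow> m \<le> b + Suc d \<and> (m = b + Suc d \<longleftrightarrow> R \<and> L)"
      if "a = b + d" for n m a b d :: nat and R L using that by auto
    from this[OF refl ih up[OF True] True] show ?thesis unfolding s c r .
  next
    case False
    then have "ninv (?g \<circ> transpose m (Suc m)) < ninv f + Suc (card A)" using down ne ih by linarith
    then have "m \<le> b + Suc d \<and> (m = b + Suc d \<longleftrightarrow> R \<and> L)" if "\<not> L" "m < b + Suc d" for m b d :: nat and R L
      using that by auto
    from this[OF False \<open>ninv (?g \<circ> transpose m (Suc m)) < ninv f + Suc (card A)\<close>] show ?thesis unfolding s c r .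
  qed
qed

lemma map_sorted_list_of_set:
  assumes "finite A" "strict_mono_on A f"
  shows "map f (sorted_list_of_set A) = sorted_list_of_set (f ` A)"
proof (rule sorted_distinct_set_unique)
  have inj: "inj_on f A" using assms strict_mono_on_imp_inj_on by blast
  show "distinct (map f (sorted_list_of_set A))" using assms inj by (simp add: distinct_map)
  have "sorted_wrt (<) (sorted_list_of_set A)" by simp
  then have "sorted_wrt (\<lambda>x y. f x < f y) (sorted_list_of_set A)"
    by (rule sorted_wrt_mono_rel[rotated]) (use assms in \<open>auto simp: strict_mono_on_def\<close>)
  then show "sorted (map f (sorted_list_of_set A))" by (simp add: sorted_wrt_map sorted_wrt_mono_rel[where P="\<lambda>x y. f x < f y"])
qed (use assms in auto)

lemma sorted_list_insert_max:
  fixes A :: "nat set"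
  assumes "finite A" "\<And>a. a \<in> A \<Longrightarrow> a < m"
  shows "sorted_list_of_set (insert m A) = sorted_list_of_set A @ [m]"
proof -
  have "sorted_list_of_set (set (sorted_list_of_set A @ [m])) = sorted_list_of_set A @ [m]"
    by (rule sorted_list_of_set.idem_if_sorted_distinct)
      (use assms in \<open>auto simp: sorted_append less_imp_le\<close>)
  then show ?thesis using assms by simp
qed

text \<open>The word of a row is read from right to left, so the largest label is its first letter;
  on the inverse it acts last, as in \<open>sigma_insert\<close>.\<close>

lemma inv_word_row:
  assumes "finite K" "0 \<notin> K"
  shows "inv (word_perm (rev (sorted_list_of_set K))) = sigma K"
  using assms
proof (induction K rule: finite_linorder_max_induct)
  case empty
  have "sigma {} = id" by (auto simp: sigma_def block_start_self_iff)
  then show ?case by (simp add: inv_id)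
next
  case (insert m A)
  have "inv (word_perm (m # rev (sorted_list_of_set A))) = sigma A \<circ> transpose m (Suc m)"
  proof (subst inv_word_Cons)
    have "\<forall>k\<in>insert m A. 1 \<le> k" using insert.prems by (metis One_nat_def Suc_leI gr0I)
    then show "\<forall>k\<in>set (m # rev (sorted_list_of_set A)). 1 \<le> k" using insert by simp
  qed (use insert in simp)
  moreover have "sigma (insert m A) = sigma A \<circ> transpose m (Suc m)" using insert by (intro sigma_insert) auto
  moreover have "rev (sorted_list_of_set (insert m A)) = m # rev (sorted_list_of_set A)"
    using insert by (subst sorted_list_insert_max) auto
  ultimately show ?case by (simp only:)
qed

section \<open>Strands\<close>

definition pos_graph :: "graph \<Rightarrow> bool" where
  "pos_graph G \<longleftrightarrow> finite G \<and> G \<subseteq> {1..} \<times> {1..}"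

definition labels :: "graph \<Rightarrow> nat \<Rightarrow> nat set" where
  "labels G i = {k. \<exists>j. (i, j) \<in> G \<and> k = i + j - 1}"

text \<open>The line just above row \<open>i\<close>. A position \<open>k\<close> with
  \<open>1 <= k < i\<close> stands for the left end of row \<open>k\<close>, whose strand has not
  been met yet when coming from below; a position \<open>k >= i\<close> stands for the top of column
  \<open>k + 1 - i\<close> of row \<open>i\<close>. Position 0 is a dummy, fixed by every
  line.\<close>

definition strand_line :: "graph \<Rightarrow> nat \<Rightarrow> nat \<Rightarrow> nat" where
  "strand_line G i = inv (graph_perm (rows_ge G i))"

lemma labels_image: "labels G i = (\<lambda>j. i + j - 1) ` {j. (i, j) \<in> G}" by (auto simp: labels_def)

lemma pos_graph_row_finite: "pos_graph G \<Longrightarrow> finite {j. (i, j) \<in> G}"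
proof -
  assume "pos_graph G"
  then have "finite (snd ` G)" by (simp add: pos_graph_def)
  then show ?thesis by (rule finite_subset[rotated]) force
qed

lemma finite_labels: "pos_graph G \<Longrightarrow> finite (labels G i)"
  by (simp add: labels_image pos_graph_row_finite)

lemma labels_ge: "pos_graph G \<Longrightarrow> k \<in> labels G i \<Longrightarrow> i \<le> k \<and> 1 \<le> k"
proof -
  assume G: "pos_graph G" and "k \<in> labels G i"
  then obtain j where "(i, j) \<in> G" "k = i + j - 1" by (auto simp: labels_def)
  moreover from this G have "1 \<le> i" "1 \<le> j" by (auto simp: pos_graph_def)
  ultimately show ?thesis by arith
qed

lemma zero_labels: "pos_graph G \<Longrightarrow> 0 \<notin> labels G i" using labels_ge[of G 0 i] by auto

lemma labels_iff: "pos_graph G \<Longrightarrow> 1 \<le> j \<Longrightarrow> i + j - 1 \<in> labels G i \<longleftrightarrow> (i, j) \<in> G"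
proof -
  assume G: "pos_graph G" and j: "1 \<le> j"
  have "j' = j" if "(i, j') \<in> G" "i + j - 1 = i + j' - 1" for j'
  proof -
    have "1 \<le> j'" using that(1) G by (auto simp: pos_graph_def)
    then show ?thesis using that(2) j by simp
  qed
  then show ?thesis unfolding labels_def by auto
qed

lemma pos_graph_rows_ge: "pos_graph G \<Longrightarrow> pos_graph (rows_ge G i)"
  by (auto simp: pos_graph_def rows_ge_def)

lemma card_labels: "pos_graph G \<Longrightarrow> card (labels G i) = card {j. (i, j) \<in> G}"
  unfolding labels_image by (rule card_image) (force simp: inj_on_def pos_graph_def)

lemma row_of_image: "row_of G i = Pair i ` {j. (i, j) \<in> G}"
  by (auto simp: row_of_def)

lemma card_row_of: "pos_graph G \<Longrightarrow> card (row_of G i) = card (labels G i)"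
  by (simp add: card_labels row_of_image card_image inj_on_def)

lemma rows_ge_row: "rows_ge G i = row_of G i \<union> rows_ge G (Suc i)" "row_of G i \<inter> rows_ge G (Suc i) = {}"
  by (auto simp: rows_ge_def row_of_def)

lemma card_rows_ge:
  assumes "pos_graph G"
  shows "card (rows_ge G i) = card (labels G i) + card (rows_ge G (Suc i))"
proof -
  have "finite (row_of G i)" "finite (rows_ge G (Suc i))" using assms by (auto simp: pos_graph_def rows_ge_def row_of_def)
  then show ?thesis unfolding rows_ge_row(1)[of G i]
    by (simp add: rows_ge_row(2) card_Un_disjoint card_row_of[OF assms])
qed

lemma graph_word_rows_ge:
  assumes "pos_graph G"
  shows "graph_word (rows_ge G i) = rev (sorted_list_of_set (labels G i)) @ graph_word (rows_ge G (Suc i))"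
proof -
  let ?A = "rows_ge G i" let ?B = "rows_ge G (Suc i)"
  let ?w = "\<lambda>G i. map (\<lambda>j. i + j - 1) (rev (sorted_list_of_set {j. (i, j) \<in> G}))"
  have fB: "finite (fst ` ?B)" using assms by (auto simp: pos_graph_def rows_ge_def)
  have wi: "?w ?A i = rev (sorted_list_of_set (labels G i))"
  proof -
    have "{j. (i, j) \<in> ?A} = {j. (i, j) \<in> G}" by (auto simp: rows_ge_def)
    moreover have "map (\<lambda>j. i + j - 1) (sorted_list_of_set {j. (i, j) \<in> G}) = sorted_list_of_set (labels G i)"
      unfolding labels_image
      by (rule map_sorted_list_of_set[OF pos_graph_row_finite[OF assms]])
        (use assms in \<open>force simp: pos_graph_def strict_mono_on_def\<close>)
    ultimately show ?thesis by (simp add: rev_map[symmetric])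
  qed
  have rest: "map (?w ?A) (sorted_list_of_set (fst ` ?B)) = map (?w ?B) (sorted_list_of_set (fst ` ?B))"
  proof (rule map_cong[OF refl])
    fix i' assume "i' \<in> set (sorted_list_of_set (fst ` ?B))"
    then have "i' \<in> fst ` ?B" using fB by simp
    then have "Suc i \<le> i'" by (auto simp: rows_ge_def)
    then have "{j. (i', j) \<in> ?A} = {j. (i', j) \<in> ?B}" by (auto simp: rows_ge_def)
    then show "?w ?A i' = ?w ?B i'" by simp
  qed
  show ?thesis
  proof (cases "{j. (i, j) \<in> G} = {}")
    case True
    then have "?A = ?B" by (auto simp: rows_ge_def le_eq_less_or_eq Suc_le_eq)
    moreover have "labels G i = {}" using True by (simp add: labels_image)
    ultimately show ?thesis by simp
  next
    case False
    then have im: "fst ` ?A = insert i (fst ` ?B)"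
      by (force simp: rows_ge_def le_eq_less_or_eq Suc_le_eq)
    have "sorted_list_of_set (set (i # sorted_list_of_set (fst ` ?B))) = i # sorted_list_of_set (fst ` ?B)"
      by (rule sorted_list_of_set.idem_if_sorted_distinct) (use fB in \<open>auto simp: rows_ge_def\<close>)
    then have "sorted_list_of_set (insert i (fst ` ?B)) = i # sorted_list_of_set (fst ` ?B)"
      using fB by simp
    then have "graph_word ?A = concat (map (?w ?A) (i # sorted_list_of_set (fst ` ?B)))"
      unfolding graph_word_def im by (simp only:)
    also have "\<dots> = ?w ?A i @ concat (map (?w ?A) (sorted_list_of_set (fst ` ?B)))"
      by (simp only: list.map concat.simps)
    finally show ?thesis unfolding wi rest by (simp only: graph_word_def)
  qed
qed

lemma graph_word_pos:
  assumes "pos_graph G"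
  shows "\<forall>k\<in>set (graph_word G). 1 \<le> k"
proof
  fix k assume "k \<in> set (graph_word G)"
  then obtain i where i: "k \<in> set (map (\<lambda>j. i + j - 1) (rev (sorted_list_of_set {j. (i, j) \<in> G})))"
    unfolding graph_word_def by auto
  then obtain j where "(i, j) \<in> G" "k = i + j - 1" using pos_graph_row_finite[OF assms, of i] by auto
  moreover from this assms have "1 \<le> i" "1 \<le> j" by (auto simp: pos_graph_def)
  ultimately show "1 \<le> k" by simp
qed

lemma fin_perm_graph: "pos_graph G \<Longrightarrow> fin_perm (graph_perm G)"
  unfolding graph_perm_def by (rule fin_perm_word) (rule graph_word_pos)

lemma fin_perm_strand_line: "pos_graph G \<Longrightarrow> fin_perm (strand_line G i)"
  unfolding strand_line_def by (intro fin_perm_inv fin_perm_graph pos_graph_rows_ge)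

lemma strand_line_rec:
  assumes "pos_graph G"
  shows "strand_line G i = strand_line G (Suc i) \<circ> sigma (labels G i)"
proof -
  have 1: "fin_perm (word_perm (rev (sorted_list_of_set (labels G i))))"
    using finite_labels[OF assms] labels_ge[OF assms] by (intro fin_perm_word) auto
  have 2: "fin_perm (word_perm (graph_word (rows_ge G (Suc i))))"
    using fin_perm_graph[OF pos_graph_rows_ge[OF assms]] unfolding graph_perm_def .
  show ?thesis
    unfolding strand_line_def graph_perm_def graph_word_rows_ge[OF assms, of i] word_perm_append
    using inv_comp_fin_perm[OF 1 2] inv_word_row[OF finite_labels[OF assms] zero_labels[OF assms]] by simp
qed

lemma strand_line_empty: "rows_ge G i = {} \<Longrightarrow> strand_line G i = id"
  by (simp add: strand_line_def graph_perm_def graph_word_def inv_id)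

lemma rows_ge_bound:
  assumes "pos_graph G" obtains N where "\<And>i. N \<le> i \<Longrightarrow> rows_ge G i = {}"
proof -
  have "finite (fst ` G)" using assms by (simp add: pos_graph_def)
  then obtain N where "\<forall>i\<in>fst ` G. i < N" using finite_nat_set_iff_bounded by auto
  then show ?thesis by (intro that[of N]) (force simp: rows_ge_def)
qed

text \<open>Lines are built from the bottom, and far enough down all rows are empty. The induction
  therefore starts at empty rows and moves up.\<close>

lemma graph_down_induct [consumes 1, case_names base step]:
  assumes "pos_graph G" and "\<And>i. rows_ge G i = {} \<Longrightarrow> P i" and "\<And>i. P (Suc i) \<Longrightarrow> P i"
  shows "P i"
proof -
  obtain N where N: "\<And>i. N \<le> i \<Longrightarrow> rows_ge G i = {}" using rows_ge_bound[OF assms(1)] by blast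
  show ?thesis
  proof (cases "i \<le> N")
    case True then show ?thesis by (induction i rule: inc_induct) (use assms N in auto)
  next
    case False then show ?thesis using assms N by auto
  qed
qed

lemma strand_line_low:
  assumes "pos_graph G" shows "k < i \<Longrightarrow> strand_line G i k = k"
  using assms
proof (induction i rule: graph_down_induct)
  case (base i) then show ?case by (simp add: strand_line_empty)
next
  case (step i)
  have "j < k \<Longrightarrow> j \<notin> labels G i" "k \<notin> labels G i" for j using labels_ge[OF assms] step by fastforce+
  then have "sigma (labels G i) k = k" by (auto simp: sigma_def block_start_self_iff)
  then show ?case using step by (simp add: strand_line_rec[OF assms, of i])
qed

text \<open>The bounds of \<open>ninv_row\<close> add up over the rows, and a sum of upper bounds is
  attained iff each of them is. So reducedness of a graph becomes a condition on each row
  separately, given the line below it.\<close>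

lemma ninv_strand_line:
  assumes "pos_graph G"
  shows "ninv (strand_line G i) \<le> card (rows_ge G i) \<and>
    (ninv (strand_line G i) = card (rows_ge G i) \<longleftrightarrow> (\<forall>i'\<ge>i. reduced_row (labels G i') (strand_line G (Suc i'))))"
  using assms
proof (induction i rule: graph_down_induct)
  case (base i)
  have "labels G i' = {}" if "i \<le> i'" for i' using base that by (force simp: labels_def rows_ge_def)
  then show ?case using base by (simp add: strand_line_empty reduced_row_def)
next
  case (step i)
  note r = ninv_row[OF finite_labels[OF assms] fin_perm_strand_line[OF assms] zero_labels[OF assms], of "Suc i" i]
  have "(\<forall>i'\<ge>i. reduced_row (labels G i') (strand_line G (Suc i'))) \<longleftrightarrow>
    reduced_row (labels G i) (strand_line G (Suc i)) \<and> (\<forall>i'\<ge>Suc i. reduced_row (labels G i') (strand_line G (Suc i')))"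
    by (metis Suc_leD Suc_leI le_neq_implies_less order_refl)
  note all = this
  have ar: "z \<le> c + y \<and> (z = c + y \<longleftrightarrow> a)"
    if "a \<longleftrightarrow> p \<and> q" "x \<le> y \<and> (x = y \<longleftrightarrow> q)" "z \<le> x + c \<and> (z = x + c \<longleftrightarrow> p)"
    for a p q and x y z c :: nat using that by auto
  show ?case unfolding card_rows_ge[OF assms, of i] strand_line_rec[OF assms, of i]
    by (rule ar[OF all step r])
qed

lemma rows_ge_1: "pos_graph G \<Longrightarrow> rows_ge G 1 = G"
  by (auto simp: pos_graph_def rows_ge_def)

lemma cox_length_graph: "pos_graph G \<Longrightarrow> cox_length (graph_perm (rows_ge G i)) = ninv (strand_line G i)"
  by (simp add: cox_length_ninv fin_perm_graph pos_graph_rows_ge strand_line_def)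

lemma rc_graph_iff:
  "rc_graph G \<longleftrightarrow> pos_graph G \<and> (\<forall>i\<ge>1. reduced_row (labels G i) (strand_line G (Suc i)))"
proof (cases "pos_graph G")
  case True
  then show ?thesis using ninv_strand_line[OF True, of 1] cox_length_graph[OF True, of 1] rows_ge_1[OF True]
    by (auto simp: rc_graph_def pos_graph_def)
qed (auto simp: rc_graph_def pos_graph_def)

text \<open>The place \<open>(i, j)\<close> lies above position \<open>i + j\<close> of the line
  below row \<open>i\<close>. The strand entering it from the left has gone straight through the
  crossings since it came into the row, so it is the head of the block of label
  \<open>i + j - 1\<close>.\<close>

lemma enters_sound:
  assumes "pos_graph G"
  shows "(enters_left G c i j \<longrightarrow> 1 \<le> i \<and> 1 \<le> j \<and> c = strand_line G (Suc i) (block_start (labels G i) (i + j - 1))) \<and>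
    (enters_below G c' i' j' \<longrightarrow> 1 \<le> i' \<and> 1 \<le> j' \<and> c' = strand_line G (Suc i') (i' + j'))"
proof (intro enters_left_enters_below.induct[where
   ?P1.0 = "\<lambda>c i j. 1 \<le> i \<and> 1 \<le> j \<and> c = strand_line G (Suc i) (block_start (labels G i) (i + j - 1))" and
   ?P2.0 = "\<lambda>c i j. 1 \<le> i \<and> 1 \<le> j \<and> c = strand_line G (Suc i) (i + j)"])
  fix i :: nat assume i: "1 \<le> i"
  have "block_start (labels G i) i = i" using labels_ge[OF assms, of "i - 1" i] i by (intro block_start_head) auto
  then show "1 \<le> i \<and> 1 \<le> (1::nat) \<and> i = strand_line G (Suc i) (block_start (labels G i) (i + 1 - 1))"
    using i strand_line_low[OF assms, of i "Suc i"] by simp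
next
  fix c i j assume *: "1 \<le> i \<and> 1 \<le> j \<and> c = strand_line G (Suc i) (block_start (labels G i) (i + j - 1))" "(i, j) \<in> G"
  then have "i + j - 1 \<in> labels G i" using labels_iff[OF assms] by simp
  then have "block_start (labels G i) (Suc (i + j - 1)) = block_start (labels G i) (i + j - 1)" by simp
  then show "1 \<le> i \<and> 1 \<le> j + 1 \<and> c = strand_line G (Suc i) (block_start (labels G i) (i + (j + 1) - 1))" using * by simp
next
  fix c i j assume *: "1 \<le> i \<and> 1 \<le> j \<and> c = strand_line G (Suc i) (block_start (labels G i) (i + j - 1))" "(i, j) \<notin> G" "1 < i"
  then have "i + j - 1 \<notin> labels G i" using labels_iff[OF assms] by simp
  then have "strand_line G i (i + j - 1) = c" using * by (simp add: strand_line_rec[OF assms, of i] sigma_def)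
  then show "1 \<le> i - 1 \<and> 1 \<le> j \<and> c = strand_line G (Suc (i - 1)) (i - 1 + j)" using * by simp
next
  fix c i j assume *: "1 \<le> i \<and> 1 \<le> j \<and> c = strand_line G (Suc i) (i + j)" "(i, j) \<in> G" "1 < i"
  then have "i + j - 1 \<in> labels G i" using labels_iff[OF assms] by simp
  then have "strand_line G i (i + j - 1) = c" using * by (simp add: strand_line_rec[OF assms, of i] sigma_def)
  then show "1 \<le> i - 1 \<and> 1 \<le> j \<and> c = strand_line G (Suc (i - 1)) (i - 1 + j)" using * by simp
next
  fix c i j assume *: "1 \<le> i \<and> 1 \<le> j \<and> c = strand_line G (Suc i) (i + j)" "(i, j) \<notin> G"
  then have "i + j - 1 \<notin> labels G i" using labels_iff[OF assms] by simp
  then have "block_start (labels G i) (i + j) = i + j" using * by (intro block_start_head) auto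
  then show "1 \<le> i \<and> 1 \<le> j + 1 \<and> c = strand_line G (Suc i) (block_start (labels G i) (i + (j + 1) - 1))" using * by simp
qed

lemma enters_left_of_below:
  assumes "pos_graph G" and below: "\<And>j. 1 \<le> j \<Longrightarrow> enters_below G (strand_line G (Suc i) (i + j)) i j" and "1 \<le> i"
  shows "1 \<le> j \<Longrightarrow> enters_left G (strand_line G (Suc i) (block_start (labels G i) (i + j - 1))) i j"
proof (induction j)
  case (Suc j)
  show ?case
  proof (cases "j = 0")
    case True
    then show ?thesis using enters_left_enters_below.start[of i G] enters_sound[OF assms(1)] assms(3) by fastforce
  next
    case False
    show ?thesis
    proof (cases "(i, j) \<in> G")
      case True
      then have "enters_left G (strand_line G (Suc i) (block_start (labels G i) (i + j - 1))) i (j + 1)"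
        using Suc False by (intro enters_left_enters_below.cross_right) auto
      then show ?thesis using enters_sound[OF assms(1)] by fastforce
    next
      case nin: False
      then have "enters_left G (strand_line G (Suc i) (i + j)) i (j + 1)"
        using below False by (intro enters_left_enters_below.turn_right) auto
      then show ?thesis using enters_sound[OF assms(1)] by fastforce
    qed
  qed
qed simp

lemma enters_complete_empty:
  assumes "pos_graph G"
  shows "rows_ge G i = {} \<Longrightarrow> 1 \<le> i \<Longrightarrow> 1 \<le> j \<Longrightarrow> enters_below G (i + j) i j"
proof (induction j arbitrary: i)
  case (Suc j)
  have e: "rows_ge G (Suc i) = {}" "(Suc i, Suc j) \<notin> G" "(Suc i, j) \<notin> G" using Suc.prems by (auto simp: rows_ge_def)
  have "enters_left G (i + Suc j) (Suc i) (Suc j)"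
  proof (cases "j = 0")
    case True then show ?thesis using enters_left_enters_below.start[of "Suc i" G] by simp
  next
    case False
    then have "enters_below G (Suc i + j) (Suc i) j" using Suc.IH[OF e(1)] by simp
    then show ?thesis using enters_left_enters_below.turn_right[of G _ "Suc i" j] e by simp
  qed
  then show ?case using enters_left_enters_below.turn_up[of G _ "Suc i" "Suc j"] e Suc.prems by simp
qed simp

lemma enters_complete:
  assumes "pos_graph G"
  shows "1 \<le> i \<Longrightarrow> 1 \<le> j \<Longrightarrow> enters_below G (strand_line G (Suc i) (i + j)) i j"
  using assms
proof (induction i arbitrary: j rule: graph_down_induct)
  case (base i)
  then have "rows_ge G (Suc i) = {}" by (auto simp: rows_ge_def)
  then show ?case using enters_complete_empty[OF assms base(1)] base by (simp add: strand_line_empty)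
next
  case (step i)
  have left: "enters_left G (strand_line G (Suc (Suc i)) (block_start (labels G (Suc i)) (Suc i + j - 1))) (Suc i) j"
    using step by (intro enters_left_of_below[OF assms]) auto
  show ?case
  proof (cases "(Suc i, j) \<in> G")
    case True
    then have "enters_below G (strand_line G (Suc (Suc i)) (Suc i + j)) (Suc i - 1) j"
      using step by (intro enters_left_enters_below.cross_up) auto
    then show ?thesis using enters_sound[OF assms] by fastforce
  next
    case False
    then have "enters_below G (strand_line G (Suc (Suc i)) (block_start (labels G (Suc i)) (Suc i + j - 1))) (Suc i - 1) j"
      using step left by (intro enters_left_enters_below.turn_up) auto
    then show ?thesis using enters_sound[OF assms] by fastforce
  qed
qed

lemma enters_below_iff:
  "pos_graph G \<Longrightarrow> enters_below G c i j \<longleftrightarrow> 1 \<le> i \<and> 1 \<le> j \<and> c = strand_line G (Suc i) (i + j)"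
  using enters_sound enters_complete by blast

lemma enters_left_iff:
  "pos_graph G \<Longrightarrow> enters_left G c i j \<longleftrightarrow> 1 \<le> i \<and> 1 \<le> j \<and> c = strand_line G (Suc i) (block_start (labels G i) (i + j - 1))"
  using enters_sound enters_left_of_below[OF _ enters_complete] by blast

lemma strands_at_iff:
  "pos_graph G \<Longrightarrow> strands_at G c d i j \<longleftrightarrow> 1 \<le> i \<and> 1 \<le> j \<and>
     c = strand_line G (Suc i) (block_start (labels G i) (i + j - 1)) \<and> d = strand_line G (Suc i) (i + j)"
  by (auto simp: strands_at_def enters_left_iff enters_below_iff)

section \<open>Covers and the search for an allowed place\<close>

text \<open>One step of the \<open>r\<close>-Bruhat order, written for lines: \<open>P\<close> and
  \<open>Q\<close> are positions, and the strands on them are the two components of a tableau entry.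
  The last clause expresses that the length grows by one only.\<close>

definition bcover :: "nat \<Rightarrow> (nat \<Rightarrow> nat) \<Rightarrow> nat \<Rightarrow> nat \<Rightarrow> bool" where
  "bcover r f P Q \<longleftrightarrow> 1 \<le> P \<and> P < Q \<and> f P \<le> r \<and> r < f Q \<and>
     (\<forall>k. P < k \<longrightarrow> k < Q \<longrightarrow> \<not> (f P < f k \<and> f k < f Q))"

lemma bcover_gt:
  assumes "fin_perm f" "bcover r f P Q" "P < k" "k < Q" "f P < f k"
  shows "f Q < f k"
  using assms fin_perm_eq_iff[OF assms(1), of k Q] unfolding bcover_def by force

lemma reduced_row_tail: "reduced_row K f \<Longrightarrow> block_start K q < q \<Longrightarrow> f (block_start K q) < f q"
  by (cases q) (auto simp: reduced_row_def split: if_splits)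

text \<open>If \<open>P\<close> is a head and \<open>Q\<close> is outside its block, the tails of
  the block lie between \<open>P\<close> and \<open>Q\<close> and exceed \<open>f P\<close>, hence
  \<open>f Q\<close> by the cover condition. If \<open>Q\<close> is a tail, it receives the smaller
  strand \<open>f P\<close>; a head to the left of \<open>P\<close> is below \<open>f P\<close>
  because \<open>P\<close> is in its block, and a head between \<open>P\<close> and \<open>Q\<close>
  is below \<open>f Q\<close>, hence below \<open>f P\<close>, again by the cover condition.\<close>

lemma reduced_row_swap:
  assumes f: "fin_perm f" and reduced_row: "reduced_row K f" and c: "bcover r f P Q" and ne: "block_start K Q \<noteq> P"
  shows "reduced_row K (f \<circ> transpose P Q)"
  unfolding reduced_row_def
proof
  fix k assume k: "k \<in> K"
  let ?h = "block_start K k" let ?f = "f \<circ> transpose P Q"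
  have PQ: "P < Q" "f P < f Q" using c by (auto simp: bcover_def)
  have hk: "?h \<le> k" by (rule block_start_le)
  have lt: "f ?h < f (Suc k)" using reduced_row k by (auto simp: reduced_row_def)
  have not_between: "f j < f P \<or> f Q < f j" if "P < j" "j < Q" for j
    using bcover_gt[OF f c that] fin_perm_eq_iff[OF f, of j P] that by force
  show "?f ?h < ?f (Suc k)"
  proof (cases "?h = P")
    case True
    have n1: "Suc k \<noteq> Q" using ne True k by auto
    have n2: "\<not> Q \<le> k" using block_start_same[of K k Q] True ne PQ by auto
    have "Suc k < Q" "P < Suc k" using n1 n2 True hk by auto
    then have "f Q < f (Suc k)" using not_between[of "Suc k"] lt True by auto
    then show ?thesis using True \<open>Suc k < Q\<close> \<open>P < Suc k\<close> by (simp add: transpose_def)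
  next
    case hP: False
    show ?thesis
    proof (cases "?h = Q")
      case True then show ?thesis using lt PQ hk by (simp add: transpose_def)
    next
      case hQ: False
      have fh: "?f ?h = f ?h" using hP hQ by (simp add: transpose_def)
      consider "Suc k = P" | "Suc k = Q" | "Suc k \<noteq> P" "Suc k \<noteq> Q" by blast
      then show ?thesis
      proof cases
        case 1 then show ?thesis using fh lt PQ by (simp add: transpose_def)
      next
        case 2
        have "f ?h < f P"
        proof (cases "?h < P")
          case True
          have "block_start K P = ?h" using True 2 PQ by (intro block_start_same) auto
          then show ?thesis using reduced_row_tail[OF reduced_row, of P] True by simp
        next
          case False
          then show ?thesis using not_between[of ?h] lt 2 hP hk by fastforce
        qed
        then show ?thesis using fh 2 by (simp add: transpose_def)
      next
        case 3 then show ?thesis using fh lt by (simp add: transpose_def)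
      qed
    qed
  qed
qed

text \<open>Cutting a block after \<open>k\<close> exchanges the exits of two strands: the head of
  the block now leaves at \<open>k\<close>, and the strand at \<open>Suc k\<close> heads the
  remainder and leaves at the old end.\<close>

lemma sigma_remove:
  assumes "k \<in> K"
  shows "sigma (K - {k}) = transpose (block_start K k) (Suc k) \<circ> sigma K"
proof
  fix j
  let ?a = "block_start K k" let ?K = "K - {k}"
  have ak: "?a \<le> k" by (rule block_start_le)
  have below: "block_start ?K k = ?a" by (rule block_start_cong) auto
  show "sigma ?K j = (transpose ?a (Suc k) \<circ> sigma K) j"
  proof (cases "j \<in> K")
    case True
    show ?thesis
    proof (cases "j = k")
      case True then show ?thesis using assms by (simp add: sigma_def below)
    next
      case False
      have "Suc j \<noteq> ?a" using block_start_pred[of K k] True by (metis diff_Suc_1 zero_less_Suc)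
      then show ?thesis using True False by (simp add: sigma_def transpose_def)
    qed
  next
    case jK: False
    then have jk: "j \<noteq> k" using assms by auto
    show ?thesis
    proof (cases "k < j \<and> block_start K j \<le> k")
      case True
      have e: "block_start K j = ?a" using block_start_same[of K j k] True by simp
      have "block_start ?K j = Suc k" by (rule block_start_eqI) (use True block_start_mem[of K j] in auto)
      then show ?thesis using jK e by (simp add: sigma_def)
    next
      case False
      have e: "block_start ?K j = block_start K j"
        using False block_start_mem[of K j] block_start_pred[of K j] block_start_le[of K j] jk
        by (intro block_start_eqI) auto
      have "block_start K j \<noteq> ?a"
        using False jK jk block_start_mem[of K k j] block_start_le[of K j] ak by (metis nat_neq_iff)
      moreover have "block_start K j \<noteq> Suc k" using block_start_pred[of K j] assms by (metis diff_Suc_1 zero_less_Suc)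
      ultimately show ?thesis using jK e by (simp add: sigma_def transpose_def)
    qed
  qed
qed

lemma block_start_insert_below: "j \<le> k \<Longrightarrow> block_start (insert k K) j = block_start K j"
  by (rule block_start_cong) auto

lemma block_start_remove_below: "j \<le> k \<Longrightarrow> block_start (K - {k}) j = block_start K j"
  by (rule block_start_cong) auto

lemma sigma_insert_any:
  assumes "k \<notin> K"
  shows "sigma (insert k K) = transpose (block_start K k) (Suc k) \<circ> sigma K"
proof -
  have "sigma K = transpose (block_start K k) (Suc k) \<circ> sigma (insert k K)"
    using sigma_remove[of k "insert k K"] assms by (simp add: block_start_insert_below)
  then show ?thesis by (simp add: fun_eq_iff)
qed

text \<open>Joining two blocks puts the tails of the right one under the head of the left one; it is
  enough to compare the two heads, as the right head is already below its own tails.\<close>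

lemma reduced_row_insert_any:
  assumes "reduced_row K f" "k \<notin> K" "f (block_start K k) < f (Suc k)"
  shows "reduced_row (insert k K) f"
  unfolding reduced_row_def
proof
  fix j assume j: "j \<in> insert k K"
  let ?K = "insert k K"
  show "f (block_start ?K j) < f (Suc j)"
  proof (cases "j \<le> k")
    case True
    then show ?thesis using j assms by (auto simp: block_start_insert_below reduced_row_def)
  next
    case False
    then have jK: "j \<in> K" using j by auto
    then have lt: "f (block_start K j) < f (Suc j)" using assms by (auto simp: reduced_row_def)
    have kb: "k < block_start K j" using assms(2) block_start_mem[of K j k] False by force
    show ?thesis
    proof (cases "block_start K j = Suc k")
      case True
      have "block_start ?K j = block_start ?K k"
      proof (rule block_start_eqI)
        fix i assume i: "block_start ?K k \<le> i" "i < j"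
        then show "i \<in> ?K" using block_start_mem[of ?K k i] block_start_mem[of K j i] True by (cases "i < k"; cases "i = k") auto
      qed (use block_start_le[of ?K k] block_start_pred[of ?K k] False in auto)
      then show ?thesis using assms(3) lt True by (simp add: block_start_insert_below)
    next
      case ne: False
      have "block_start ?K j = block_start K j"
        by (rule block_start_eqI) (use kb ne block_start_le block_start_mem[of K j] block_start_pred[of K j] in auto)
      then show ?thesis using lt by simp
    qed
  qed
qed

text \<open>The swap below the row and the removal of label \<open>Q - 1\<close> both exchange the
  strands at \<open>P\<close> and \<open>Q\<close>, so they cancel and the line above the row stays
  the same: box \<open>i\<close> can be emptied again. The claim that the row with label
  \<open>Q - 1\<close> kept is not reduced shows that the package test of the algorithm fails
  here.\<close>

lemma cut_head:
  assumes f: "fin_perm f" and reduced_row: "reduced_row K f" and c: "bcover r f P Q" and h: "block_start K Q = P"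
  shows "Q - 1 \<in> K" "reduced_row (K - {Q - 1}) (f \<circ> transpose P Q)" "\<not> reduced_row K (f \<circ> transpose P Q)"
    "f \<circ> transpose P Q \<circ> sigma (K - {Q - 1}) = f \<circ> sigma K"
    "P = 0 \<or> P - 1 \<notin> K" "\<And>j. P \<le> j \<Longrightarrow> j < Q \<Longrightarrow> j \<in> K"
proof -
  let ?f = "f \<circ> transpose P Q"
  have PQ: "P < Q" "f P < f Q" using c by (auto simp: bcover_def)
  show mem: "\<And>j. P \<le> j \<Longrightarrow> j < Q \<Longrightarrow> j \<in> K" using block_start_mem[of K Q] h by auto
  show head: "P = 0 \<or> P - 1 \<notin> K" using block_start_pred[of K Q] h by auto
  show q: "Q - 1 \<in> K" using mem[of "Q - 1"] PQ by auto
  have b: "block_start K (Q - 1) = P" using block_start_same[of K Q "Q - 1"] h PQ by auto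
  have sQ: "Suc (Q - 1) = Q" using PQ by simp
  show "?f \<circ> sigma (K - {Q - 1}) = f \<circ> sigma K"
    using sigma_remove[OF q] unfolding b sQ by (simp add: fun_eq_iff)
  have "\<not> ?f (block_start K (Q - 1)) < ?f (Suc (Q - 1))" unfolding b sQ using PQ by simp
  then show "\<not> reduced_row K ?f" using q unfolding reduced_row_def by blast
  show "reduced_row (K - {Q - 1}) ?f"
    unfolding reduced_row_def
  proof
    fix j assume j: "j \<in> K - {Q - 1}"
    have lt: "f (block_start K j) < f (Suc j)" using reduced_row j by (auto simp: reduced_row_def)
    show "?f (block_start (K - {Q - 1}) j) < ?f (Suc j)"
    proof (cases "block_start K j = P")
      case True
      have Pj: "P \<le> j" using True block_start_le[of K j] by simp
      show ?thesis
      proof (cases "j < Q - 1")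
        case True
        then have "f Q < f (Suc j)" using bcover_gt[OF f c, of "Suc j"] lt Pj \<open>block_start K j = P\<close> by auto
        moreover have "Suc j \<noteq> Q" using True by linarith
        ultimately show ?thesis using True \<open>block_start K j = P\<close> Pj by (simp add: block_start_remove_below transpose_def)
      next
        case False
        then have "Q \<le> j" using j by auto
        then have "block_start (K - {Q - 1}) j = Q"
          using True PQ block_start_mem[of K j] by (intro block_start_eqI) auto
        then show ?thesis using lt True \<open>Q \<le> j\<close> Pj by (simp add: transpose_def)
      qed
    next
      case False
      have "\<not> (Q - 1 < j \<and> block_start K j \<le> Q - 1)"
        using block_start_same[of K j "Q - 1"] b False by auto
      then have e: "block_start (K - {Q - 1}) j = block_start K j"
        using j block_start_mem[of K j] block_start_pred[of K j] block_start_le[of K j]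
        by (intro block_start_eqI) auto
      have "block_start K j \<noteq> Q" using block_start_pred[of K j] q PQ by auto
      moreover have "Suc j \<noteq> P" using head j by auto
      moreover have "Suc j \<noteq> Q" using j by auto
      ultimately show ?thesis using e lt False by (simp add: transpose_def)
    qed
  qed
qed

text \<open>The argument \<open>k\<close> is a label, not a column. \<open>B\<close> contains the
  second strand of the last filled box when second-type places count, and is empty for an
  insertion.\<close>

definition allowed :: "nat \<Rightarrow> (nat \<Rightarrow> nat) \<Rightarrow> nat set \<Rightarrow> nat set \<Rightarrow> nat \<Rightarrow> bool" where
  "allowed r f K B k \<longleftrightarrow> k \<notin> K \<and> r < f (Suc k) \<and> (f (block_start K k) \<le> r \<or> f (block_start K k) \<in> B)"

definition last_allowed :: "nat \<Rightarrow> (nat \<Rightarrow> nat) \<Rightarrow> nat set \<Rightarrow> nat set \<Rightarrow> nat \<Rightarrow> nat \<Rightarrow> bool" where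
  "last_allowed r f K B j0 k \<longleftrightarrow> k < j0 \<and> allowed r f K B k \<and> (\<forall>k'<j0. allowed r f K B k' \<longrightarrow> k' \<le> k)"

text \<open>Walk left from a head \<open>H\<close> with a strand \<open>> r\<close>. The block
  before it ends at label \<open>H - 1\<close>, which is allowed if the head of that block is
  \<open><= r\<close>; otherwise continue from that head. The walk stops because position 0 carries
  0.\<close>

lemma allowed_ex:
  assumes "fin_perm f" "reduced_row K f"
  shows "H = 0 \<or> H - 1 \<notin> K \<Longrightarrow> r < f H \<Longrightarrow> \<exists>k<H. allowed r f K B k"
proof (induction H rule: less_induct)
  case (less H)
  have "H \<noteq> 0" using less.prems assms(1) by (cases "H = 0") (auto simp: fin_perm_def)
  then have k: "H - 1 \<notin> K" "H - 1 < H" using less.prems by auto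
  let ?h = "block_start K (H - 1)"
  show ?case
  proof (cases "f ?h \<le> r")
    case True
    then show ?thesis using k less.prems \<open>H \<noteq> 0\<close> by (intro exI[of _ "H - 1"]) (auto simp: allowed_def)
  next
    case False
    have "?h < H" using block_start_le[of K "H - 1"] \<open>H \<noteq> 0\<close> by linarith
    moreover have "?h = 0 \<or> ?h - 1 \<notin> K" using block_start_pred by auto
    ultimately obtain k where "k < ?h" "allowed r f K B k" using less.IH[of ?h] False by auto
    then show ?thesis using \<open>?h < H\<close> by (intro exI[of _ k]) auto
  qed
qed

lemma last_allowed_ex:
  assumes "k < j0" "allowed r f K B k"
  shows "\<exists>k. last_allowed r f K B j0 k"
proof -
  let ?A = "{k. k < j0 \<and> allowed r f K B k}"
  have "finite ?A" "?A \<noteq> {}" using assms by auto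
  then show ?thesis using Max_in[of ?A] Max_ge[of ?A] unfolding last_allowed_def
    by (intro exI[of _ "Max ?A"]) auto
qed

text \<open>Go left from \<open>H\<close> block by block. Next to a head \<open>> r\<close>, the end
  of the preceding block would be allowed if the head of that block were \<open><= r\<close> or in
  \<open>B\<close>. Since the search passed over it, that head is \<open>> r\<close> too, and so are
  its tails in a reduced row.\<close>

lemma zone:
  assumes f: "fin_perm f" and fin: "finite K" and reduced_row: "reduced_row K f"
    and H: "H = 0 \<or> H - 1 \<notin> K" "r < f H"
    and Hj: "H \<le> j0" "\<forall>j. H \<le> j \<longrightarrow> j < j0 \<longrightarrow> j \<in> K"
    and la: "last_allowed r f K B j0 k1"
  shows "k1 < H" "\<And>k. k1 < k \<Longrightarrow> k < H \<Longrightarrow> k \<notin> K \<Longrightarrow> r < f (block_start K k) \<and> f (block_start K k) \<notin> B"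
    "\<And>p. k1 < p \<Longrightarrow> p \<le> H \<Longrightarrow> r < f p"
proof -
  have k1: "k1 < j0" "k1 \<notin> K" "\<And>k. k < j0 \<Longrightarrow> allowed r f K B k \<Longrightarrow> k \<le> k1"
    using la by (auto simp: last_allowed_def allowed_def)
  show k1H: "k1 < H" using Hj(2) k1(1,2) by (meson linorder_not_le)
  have heads: "k1 < p \<Longrightarrow> p \<le> H \<Longrightarrow> block_start K p = p \<Longrightarrow> r < f p" for p
  proof (induction "H - p" arbitrary: p rule: less_induct)
    case less
    show ?case
    proof (cases "p = H")
      case False
      let ?e = "block_end K p"
      note be = block_end_props[OF fin, of p]
      have "?e < H"
      proof (rule ccontr)
        assume "\<not> ?e < H"
        then have "H - 1 \<in> K" using block_end_mem[OF fin, of p "H - 1"] False less.prems by auto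
        then show False using H(1) False less.prems by auto
      qed
      have "r < f (Suc ?e)"
        by (rule less.hyps) (use \<open>?e < H\<close> be less.prems in auto)
      moreover have "\<not> allowed r f K B ?e" using k1(3)[of ?e] \<open>?e < H\<close> Hj(1) be less.prems by auto
      moreover have "block_start K ?e = p" using block_start_block_end[OF fin, of p ?e] be less.prems by auto
      ultimately show ?thesis using be unfolding allowed_def by auto
    qed (use H in simp)
  qed
  have bgt: "k1 < block_start K k" if "k1 < k" for k
    using block_start_mem[of K k k1] that k1(2) by force
  show "r < f (block_start K k) \<and> f (block_start K k) \<notin> B" if k: "k1 < k" "k < H" "k \<notin> K" for k
  proof -
    have "r < f (Suc k)" using heads[of "Suc k"] k by auto
    moreover have "\<not> allowed r f K B k" using k1(3)[of k] k Hj(1) by auto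
    ultimately show ?thesis using k unfolding allowed_def by auto
  qed
  show "r < f p" if p: "k1 < p" "p \<le> H" for p
  proof -
    have "block_start K p \<le> p" by (rule block_start_le)
    then have "r < f (block_start K p)" using bgt[of p] p by (intro heads) auto
    then show ?thesis using reduced_row_tail[OF reduced_row, of p] \<open>block_start K p \<le> p\<close> by (cases "block_start K p = p") auto
  qed
qed

text \<open>
  These two conditions on the entry \<open>E\<close> of the last filled box (with strands \<open>e\<close> and \<open>g\<close>) make the next
  entry larger if the next rectification takes place at a position after \<open>\<kappa>\<close>, and smaller if it takes place
  at a position in \<open>N\<close>.
\<close>

definition rowinv :: "nat \<Rightarrow> (nat \<Rightarrow> nat) \<Rightarrow> nat set \<Rightarrow> nat \<Rightarrow> nat \<Rightarrow> nat \<Rightarrow> bool" where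
  "rowinv r f K g E \<kappa> \<longleftrightarrow> (\<forall>p>\<kappa>. f p \<le> r \<longrightarrow> E < rho K p) \<and>
     (f (block_start K E) \<le> r \<or> f (block_start K E) = g) \<and> block_start K E \<le> \<kappa>"

definition colinv :: "nat \<Rightarrow> (nat \<Rightarrow> nat) \<Rightarrow> nat set \<Rightarrow> nat \<Rightarrow> nat \<Rightarrow> nat set \<Rightarrow> bool" where
  "colinv r f K e E N \<longleftrightarrow> (\<forall>p\<in>N. f p \<le> r \<longrightarrow> p \<le> E) \<and>
     (\<forall>P Q. P \<in> N \<longrightarrow> bcover r f P Q \<longrightarrow> P = block_start K E \<longrightarrow> E \<in> K \<longrightarrow> f P \<noteq> e \<longrightarrow> block_start K Q = P)"

lemma rho_tail: "p - 1 \<in> K \<Longrightarrow> 0 < p \<Longrightarrow> rho K p = p - 1" by (simp add: rho_def)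
lemma rho_head: "p = 0 \<or> p - 1 \<notin> K \<Longrightarrow> rho K p = block_end K p" by (auto simp: rho_def)

lemma rho_le:
  assumes "finite K" "k \<notin> K" "p \<le> k"
  shows "rho K p \<le> k"
proof (cases "0 < p \<and> p - 1 \<in> K")
  case True then show ?thesis using assms by (simp add: rho_def)
next
  case False
  then have "rho K p = block_end K p" by (auto simp: rho_def)
  then show ?thesis using block_end_mem[OF assms(1), of p k] assms by force
qed

text \<open>If \<open>P\<close> is a tail, its strand leaves at \<open>P - 1\<close>, and the head
  of its block is below the old \<open>f P\<close>, hence \<open><= r\<close>. If \<open>P\<close>
  is a head, its strand leaves at the end of the block, and after the swap the whole block carries
  strands \<open>> r\<close>, so a strand \<open><= r\<close> further right leaves beyond
  it.\<close>

lemma keep_rowinv: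
  assumes f: "fin_perm f" and fin: "finite K" and reduced_row: "reduced_row K f" and c: "bcover r f P Q" and ne: "block_start K Q \<noteq> P"
  shows "rowinv r (f \<circ> transpose P Q) K (f Q) (rho K P) P"
proof -
  let ?f = "f \<circ> transpose P Q"
  have PQ: "1 \<le> P" "P < Q" "f P \<le> r" "r < f Q" using c by (auto simp: bcover_def)
  have reduced_row': "reduced_row K ?f" by (rule reduced_row_swap[OF f reduced_row c ne])
  show ?thesis
  proof (cases "P - 1 \<in> K")
    case True
    then have E: "rho K P = P - 1" using PQ by (simp add: rho_def)
    have b: "block_start K P = block_start K (P - 1)" using True PQ by (cases P) auto
    have bl: "block_start K (P - 1) < P" using block_start_le[of K "P - 1"] PQ by linarith
    have "f (block_start K (P - 1)) < f P" using reduced_row_tail[OF reduced_row, of P] b bl by simp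
    then have "?f (block_start K (P - 1)) \<le> r" using bl PQ by (simp add: transpose_def)
    moreover have "P - 1 < rho K p" if "P < p" for p
      using rho_ge[OF fin, of p] that PQ by linarith
    ultimately show ?thesis unfolding rowinv_def E using bl by auto
  next
    case False
    then have E: "rho K P = block_end K P" by (auto simp: rho_def)
    have b: "block_start K (block_end K P) = P"
      using block_start_block_end[OF fin, of P "block_end K P"] block_end_props[OF fin, of P] block_start_head[of P K] False by auto
    have "block_end K P < rho K p" if p: "P < p" "?f p \<le> r" for p
    proof -
      have "\<not> p \<le> block_end K P"
      proof
        assume "p \<le> block_end K P"
        then have "block_start K p = P" using block_start_block_end[OF fin, of P p] p block_start_head[of P K] False by auto
        then have "?f P < ?f p" using reduced_row_tail[OF reduced_row', of p] p by simp
        then show False using PQ p by simp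
      qed
      then have "block_end K P < p" by simp
      then show ?thesis
        using block_end_props[OF fin, of P] block_end_props(1)[OF fin, of p] by (cases "p - 1 = block_end K P") (auto simp: rho_def)
    qed
    then show ?thesis unfolding rowinv_def E b by auto
  qed
qed

text \<open>Only a tail \<open>P\<close> is of interest, since a head leaves at a position that is
  not a label. Then \<open>P2\<close> is the head of the block of \<open>P\<close>, with a strand
  below the old \<open>f P\<close>. A cover from \<open>P2\<close> ends at or before
  \<open>P\<close>, inside the block: beyond \<open>Q\<close> it would pass the old
  \<open>f P\<close>, now at \<open>Q\<close>, and between \<open>P\<close> and \<open>Q\<close> it
  would pass the old \<open>f Q\<close>, now at \<open>P\<close>.\<close>

lemma keep_colinv:
  assumes f: "fin_perm f" and fin: "finite K" and reduced_row: "reduced_row K f" and c: "bcover r f P Q" and ne: "block_start K Q \<noteq> P"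
  shows "colinv r (f \<circ> transpose P Q) K e (rho K P) {..<P}"
  unfolding colinv_def
proof (intro conjI ballI allI impI)
  let ?f = "f \<circ> transpose P Q"
  have PQ: "1 \<le> P" "P < Q" "f P \<le> r" "r < f Q" using c by (auto simp: bcover_def)
  show "p \<le> rho K P" if "p \<in> {..<P}" for p using rho_ge[OF fin, of P] that by auto
  fix P2 Q2 assume *: "P2 \<in> {..<P}" "bcover r ?f P2 Q2" "P2 = block_start K (rho K P)" "rho K P \<in> K"
  have tl: "P - 1 \<in> K"
  proof (rule ccontr)
    assume "P - 1 \<notin> K" then have "rho K P = block_end K P" by (auto simp: rho_def)
    then show False using block_end_props(2)[OF fin, of P] * by simp
  qed
  then have E: "rho K P = P - 1" using PQ by (simp add: rho_def)
  have b: "block_start K P = P2" using * E tl PQ by (cases P) auto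
  have P2: "P2 < P" using * by simp
  have fP2: "?f P2 = f P2" using P2 PQ by (simp add: transpose_def)
  have lt: "f P2 < f P" using reduced_row_tail[OF reduced_row, of P] b P2 by simp
  have c2: "P2 < Q2" "r < ?f Q2" "\<And>k. P2 < k \<Longrightarrow> k < Q2 \<Longrightarrow> \<not> (f P2 < ?f k \<and> ?f k < ?f Q2)"
    using *(2) fP2 by (auto simp: bcover_def)
  have "\<not> Q < Q2" using c2(3)[of Q] P2 PQ lt c2(2) by auto
  moreover have "Q2 \<noteq> Q" using c2(2) PQ by auto
  moreover have "\<not> (P < Q2 \<and> Q2 < Q)"
  proof
    assume a: "P < Q2 \<and> Q2 < Q"
    then have "?f Q2 = f Q2" by (simp add: transpose_def)
    then have "f Q < f Q2" using bcover_gt[OF f c, of Q2] a c2(2) PQ by auto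
    then show False using c2(3)[of P] P2 a PQ lt \<open>?f Q2 = f Q2\<close> by auto
  qed
  ultimately have "Q2 \<le> P" by linarith
  then show "block_start K Q2 = P2" using block_start_same[of K P Q2] b c2(1) by auto
qed

lemma merge_rowinv:
  assumes fin: "finite K" and k1: "k1 < P" "k1 \<notin> K"
    and z: "\<forall>p. k1 < p \<longrightarrow> p \<le> P \<longrightarrow> r < f p" and c: "f (block_start K k1) \<le> r"
  shows "rowinv r f (insert k1 K) d k1 P"
  unfolding rowinv_def
proof (intro conjI allI impI disjI1)
  have fin': "finite (insert k1 K)" using fin by simp
  show "k1 < rho (insert k1 K) p" if "P < p" for p using rho_ge[OF fin', of p] that k1 by linarith
  show "f (block_start (insert k1 K) k1) \<le> r" using c by (simp add: block_start_insert_below)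
  show "block_start (insert k1 K) k1 \<le> P" using block_start_le[of "insert k1 K" k1] k1 by linarith
qed

lemma merge_colinv:
  assumes "\<And>p. p \<in> N \<Longrightarrow> k1 < p \<Longrightarrow> r < f p" and e: "e = f (block_start K k1)"
  shows "colinv r f (insert k1 K) e k1 N"
  unfolding colinv_def using assms by (force simp: block_start_insert_below)

text \<open>In the first column of a hook this leaves only the cases for which the algorithm has an
  instruction. A tail \<open>P\<close> leaves at \<open>P - 1 < E\<close>. A head \<open>P\<close>
  leaves at the end of its block; if that is not before \<open>E\<close>, then \<open>P\<close>
  heads the block of \<open>E\<close>, and \<open>E\<close> must be a label, since otherwise the
  strand leaving at \<open>E\<close> would be \<open>f P <= r\<close>.\<close>

lemma col_next:
  assumes f: "fin_perm f" and fin: "finite K" and inv: "colinv r f K e E N"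
    and P: "P \<in> N" and c: "bcover r f P Q" and g: "r < f (sigma K E)"
  shows "P \<le> E" and "block_start K Q = P \<or> rho K P < E \<or> (E \<in> K \<and> block_start K E = P \<and> f P = e)"
proof -
  have PQ: "1 \<le> P" "P < Q" "f P \<le> r" "r < f Q" using c by (auto simp: bcover_def)
  show PE: "P \<le> E" using inv P PQ by (auto simp: colinv_def)
  show "block_start K Q = P \<or> rho K P < E \<or> (E \<in> K \<and> block_start K E = P \<and> f P = e)"
  proof (cases "P - 1 \<in> K")
    case True
    then have "rho K P = P - 1" using PQ by (simp add: rho_def)
    then show ?thesis using PE PQ by linarith
  next
    case False
    then have R: "rho K P = block_end K P" by (auto simp: rho_def)
    show ?thesis
    proof (cases "block_end K P < E")
      case True then show ?thesis using R by simp
    next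
      case F: False
      have bE: "block_start K E = P"
        using block_start_block_end[OF fin, of P E] PE F block_start_head[of P K] False by auto
      have "E \<in> K"
      proof (rule ccontr)
        assume "E \<notin> K"
        then have "sigma K E = P" using bE by (simp add: sigma_def)
        then show False using g PQ by simp
      qed
      then show ?thesis using inv P c bE unfolding colinv_def by auto
    qed
  qed
qed

lemma row_next:
  assumes f: "fin_perm f" and fin: "finite K" and reduced_row: "reduced_row K f" and inv: "rowinv r f K g E \<kappa>"
    and P: "\<kappa> < P" and c: "bcover r f P Q"
  shows "E < rho K P"
  using inv P c unfolding rowinv_def bcover_def by auto

text \<open>The search cannot run past the previous entry \<open>E\<close>: the block of
  \<open>E\<close> ends before the head \<open>P\<close>, and its own head is \<open><= r\<close> or
  equal to \<open>g\<close>, so the label at its end is allowed. Equality with \<open>E\<close> is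
  impossible for a place of the first type, because the strand leaving at \<open>E\<close> is
  \<open>g > r\<close>.\<close>

lemma row_next_cut:
  assumes f: "fin_perm f" and fin: "finite K" and reduced_row: "reduced_row K f" and inv: "rowinv r f K g E \<kappa>"
    and P: "\<kappa> < P" and c: "bcover r f P Q" and h: "block_start K Q = P"
    and la: "last_allowed r (f \<circ> transpose P Q) (K - {Q - 1}) {g} (Q - 1) k1"
    and g: "f (sigma K E) = g" "r < g"
  shows "E \<le> k1" "(f \<circ> transpose P Q) (block_start (K - {Q - 1}) k1) \<le> r \<Longrightarrow> E < k1"
proof -
  let ?f = "f \<circ> transpose P Q" let ?K = "K - {Q - 1}"
  note ch = cut_head[OF f reduced_row c h]
  have PQ: "1 \<le> P" "P < Q" "f P \<le> r" "r < f Q" using c by (auto simp: bcover_def)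
  have f': "fin_perm ?f" using f PQ by (intro fin_perm_comp fin_perm_transpose) auto
  have fin': "finite ?K" using fin by simp
  have H: "P = 0 \<or> P - 1 \<notin> ?K" using ch(5) by blast
  have Hj: "P \<le> Q - 1" using PQ by simp
  have fP: "r < ?f P" using PQ by simp
  have mem: "\<forall>j. P \<le> j \<longrightarrow> j < Q - 1 \<longrightarrow> j \<in> ?K" using ch(6) by auto
  note zn = zone(1,2)[OF f' fin' ch(2) H fP Hj mem la]
  let ?e = "block_end K E"
  note be = block_end_props[OF fin, of E]
  have bE: "block_start K E \<le> \<kappa>" using inv by (auto simp: rowinv_def)
  have eb: "block_start K ?e = block_start K E" using block_start_block_end[OF fin be(1) order_refl] .
  have eP: "?e < P"
  proof (rule ccontr)
    assume "\<not> ?e < P"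
    then have "P - 1 < ?e" "block_start K ?e \<le> P - 1" using eb bE P PQ(1) by linarith+
    then have "P - 1 \<in> K" by (intro block_start_mem)
    then show False using ch(5) PQ(1) by linarith
  qed
  have agree: "block_start ?K ?e = block_start K E" using block_start_remove_below[of ?e "Q - 1" K] eP PQ(2) eb by linarith
  have "block_start K E < P" using bE P by simp
  then have "?f (block_start ?K ?e) = f (block_start K E)" unfolding agree using PQ by (simp add: transpose_def)
  then have dis: "?f (block_start ?K ?e) \<le> r \<or> ?f (block_start ?K ?e) = g" using inv by (auto simp: rowinv_def)
  have "?e \<notin> ?K" using be(2) by blast
  have "\<not> k1 < ?e"
  proof
    assume "k1 < ?e"
    from zn(2)[OF this eP \<open>?e \<notin> ?K\<close>] dis show False by auto
  qed
  then show Ek: "E \<le> k1" using be(1) by linarith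
  assume s: "?f (block_start ?K k1) \<le> r"
  have "k1 \<notin> ?K" using la by (auto simp: last_allowed_def allowed_def)
  then have "(?f \<circ> sigma ?K) k1 = ?f (block_start ?K k1)" unfolding sigma_def comp_apply by (simp only: if_False)
  then have "f (sigma K k1) \<le> r" using s ch(4) by (metis comp_apply)
  then have "k1 \<noteq> E" using g by auto
  then show "E < k1" using Ek by simp
qed

text \<open>
  Here \<open>f\<close> joins the block headed by the second strand of the last entry with the next block, and \<open>y\<close> is
  the line before that entry was added; this is the situation of a second-type insertion.
\<close>

lemma double_merge:
  assumes f: "fin_perm f" and fin: "finite K" and reduced_row: "reduced_row K f"
    and k1: "k1 < P" "k1 \<notin> K" and z: "\<forall>p. k1 < p \<longrightarrow> p \<le> P \<longrightarrow> r < f p"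
    and y: "fin_perm y" "f \<circ> sigma K = y \<circ> transpose k1 X" "bcover r y k1 X"
  shows "y X < f (Suc k1)" "k1 < rho K (Suc k1)" "rho K (Suc k1) < X" "y (rho K (Suc k1)) = f (Suc k1)"
    "f (block_start K k1) = y X"
proof -
  let ?D = "rho K (Suc k1)" let ?p = "sigma K X"
  have yX: "k1 < X" "y k1 \<le> r" "r < y X" using y(3) by (auto simp: bcover_def)
  have D: "?D = block_end K (Suc k1)" using k1 by (simp add: rho_def)
  show kD: "k1 < ?D" unfolding D using block_end_props(1)[OF fin, of "Suc k1"] by simp
  \<comment> \<open>The last swap moved the strand \<open>y k1 <= r\<close> to \<open>X\<close>, and
    below the row this strand is at \<open>?p\<close>. The block starting at \<open>Suc k1\<close>
    carries only strands \<open>> r\<close>, so it ends before \<open>?p\<close>; this places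
    \<open>?D\<close> strictly between \<open>k1\<close> and \<open>X\<close>, and the cover
    condition for \<open>y\<close> then forces its strand above \<open>y X\<close>.\<close>
  have fp: "f ?p = y k1" using fun_cong[OF y(2), of X] yX by simp
  show "f (block_start K k1) = y X" using fun_cong[OF y(2), of k1] k1 yX by (simp add: sigma_def)
  have rp: "rho K ?p = X" by (rule rho_sigma[OF fin])
  have "k1 < ?p" using rho_le[OF fin k1(2), of ?p] rp yX by force
  have blk: "r < f q" if q: "Suc k1 \<le> q" "q \<le> block_end K (Suc k1)" for q
  proof -
    have "block_start K q = Suc k1" using block_start_block_end[OF fin q] block_start_head[of "Suc k1" K] k1 by simp
    moreover have "r < f (Suc k1)" using z k1 by simp
    ultimately show ?thesis using reduced_row_tail[OF reduced_row, of q] q by (cases "q = Suc k1") auto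
  qed
  have "?D < ?p" using blk[of ?p] \<open>k1 < ?p\<close> fp yX unfolding D by force
  then have "?D \<le> X" using rho_ge[OF fin, of ?p] rp by simp
  moreover have "?D \<noteq> X" 
  proof
    assume "?D = X"
    then have "?p = Suc k1" using rp rho_inj[OF fin] by metis
    then show False using z k1 fp yX by force
  qed
  ultimately show DX: "?D < X" by simp
  have "f (sigma K ?D) = y ?D" using fun_cong[OF y(2), of ?D] kD DX by (simp add: transpose_def)
  then show yD: "y ?D = f (Suc k1)" by (simp add: sigma_rho[OF fin])
  have "r < f (Suc k1)" using z k1 by simp
  then show "y X < f (Suc k1)"
    using y(3) kD DX yD yX fin_perm_eq_iff[OF y(1), of ?D X] unfolding bcover_def
    by (metis le_less_trans nat_neq_iff order_less_trans leD linorder_le_less_linear)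
qed

text \<open>After the two blocks are joined, \<open>g\<close> is the head of the longer block and
  leaves at its end. All strands of this block are \<open>> r\<close>, so a strand
  \<open><= r\<close> to the right of \<open>P\<close> leaves further to the right.\<close>

lemma double_merge_rowinv:
  assumes fin: "finite K" and reduced_row: "reduced_row (insert k1 K) f"
    and k1: "k1 < P" "k1 \<notin> K" and g: "f (block_start K k1) = g" "r < g"
  shows "rowinv r f (insert k1 K) g (rho (insert k1 K) (block_start K k1)) P"
proof -
  let ?K = "insert k1 K" let ?h = "block_start K k1"
  have fin': "finite ?K" using fin by simp
  have hh: "block_start ?K k1 = ?h" by (simp add: block_start_insert_below)
  have head: "?h = 0 \<or> ?h - 1 \<notin> ?K" using block_start_pred[of ?K k1] hh by auto
  then have R: "rho ?K ?h = block_end ?K ?h" by (rule rho_head)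
  let ?E = "block_end ?K ?h"
  have bE: "block_start ?K ?E = ?h"
    using block_start_block_end[OF fin', of ?h ?E] block_end_props(1)[OF fin', of ?h] block_start_head[OF head] by simp
  have hP: "?h \<le> P" using block_start_le[of K k1] k1 by simp
  have "?E < rho ?K p" if p: "P < p" "f p \<le> r" for p
  proof -
    have "\<not> p \<le> ?E"
    proof
      assume "p \<le> ?E"
      then have "block_start ?K p = ?h" using block_start_block_end[OF fin', of ?h p] p hP block_start_head[OF head] by simp
      then have "f ?h < f p" using reduced_row_tail[OF reduced_row, of p] p hP by simp
      then show False using g p by simp
    qed
    then have "?E < p" by simp
    show ?thesis
    proof (cases "p - 1 = ?E")
      case True
      then have "p - 1 \<notin> ?K" using block_end_props(2)[OF fin', of ?h] by simp
      then have "rho ?K p = block_end ?K p" by (simp add: rho_def)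
      then show ?thesis using block_end_props(1)[OF fin', of p] \<open>?E < p\<close> by linarith
    next
      case False
      then show ?thesis using rho_ge[OF fin', of p] \<open>?E < p\<close> by linarith
    qed
  qed
  then show ?thesis unfolding R rowinv_def bE using g hP by auto
qed

section \<open>Lines that list the strands greater than \<open>r\<close> in increasing order\<close>

definition big_sorted :: "nat \<Rightarrow> (nat \<Rightarrow> nat) \<Rightarrow> bool" where
  "big_sorted r f \<longleftrightarrow> (\<forall>p q. p < q \<longrightarrow> r < f p \<longrightarrow> r < f q \<longrightarrow> f p < f q)"

text \<open>A strand \<open>> r\<close> between the two positions would lie below \<open>f Q\<close>
  by the ordering and above \<open>f P\<close>, against the cover condition. So the strand at
  \<open>P\<close> is swapped with the first strand \<open>> r\<close> to its right.\<close>

lemma semi_cover_small: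
  assumes "fin_perm f" "big_sorted r f" "bcover r f P Q" "P < k" "k < Q"
  shows "f k \<le> r" "f k < f P"
proof -
  have "\<not> r < f k"
  proof
    assume "r < f k"
    then have "f k < f Q" using assms by (auto simp: big_sorted_def bcover_def)
    then show False using assms \<open>r < f k\<close> by (force simp: bcover_def)
  qed
  then show "f k \<le> r" by simp
  then show "f k < f P" using bcover_gt[OF assms(1,3,4,5)] assms fin_perm_eq_iff[OF assms(1), of k P]
    by (force simp: bcover_def)
qed

lemma semi_swap:
  assumes f: "fin_perm f" and s: "big_sorted r f" and c: "bcover r f P Q"
  shows "big_sorted r (f \<circ> transpose P Q)"
  unfolding big_sorted_def
proof (intro allI impI)
  fix p q assume *: "p < q" "r < (f \<circ> transpose P Q) p" "r < (f \<circ> transpose P Q) q"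
  have PQ: "1 \<le> P" "P < Q" "f P \<le> r" "r < f Q" using c by (auto simp: bcover_def)
  have nQ: "p \<noteq> Q" "q \<noteq> Q" using * PQ by auto
  have nb: "\<not> (P < k \<and> k < Q \<and> r < f k)" for k using semi_cover_small(1)[OF f s c, of k] by force
  show "(f \<circ> transpose P Q) p < (f \<circ> transpose P Q) q"
  proof (cases "p = P \<or> q = P")
    case True
    then show ?thesis
    proof
      assume "p = P"
      moreover from this have "Q < q" using nb[of q] * nQ PQ by (force simp: transpose_def split: if_splits)
      ultimately show ?thesis using s * PQ nQ by (auto simp: big_sorted_def transpose_def split: if_splits)
    next
      assume "q = P" then show ?thesis using s * PQ nQ by (auto simp: big_sorted_def transpose_def split: if_splits)
    qed
  next
    case False then show ?thesis using s * nQ by (auto simp: big_sorted_def transpose_def split: if_splits)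
  qed
qed

text \<open>A position strictly between \<open>P\<close> and \<open>Q\<close> carries a strand below
  \<open>f P\<close>. Before \<open>Q\<close> it meets no strand \<open>> r\<close>, and past
  \<open>Q\<close> it is blocked by \<open>f P\<close>, which now sits there. The resulting bound
  \<open>Q <= P2\<close> provides the \<open>F\<close> of \<open>semi_inv\<close>.\<close>

lemma semi_row:
  assumes f: "fin_perm f" and s: "big_sorted r f" and c: "bcover r f P Q"
    and c2: "bcover r (f \<circ> transpose P Q) P2 Q2" and lt: "P < P2"
  shows "Q \<le> P2"
proof (rule ccontr)
  assume "\<not> Q \<le> P2"
  then have P2: "P < P2" "P2 < Q" using lt by auto
  let ?f = "f \<circ> transpose P Q"
  have PQ: "1 \<le> P" "P < Q" "f P \<le> r" "r < f Q" using c by (auto simp: bcover_def)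
  have a: "f P2 < f P" by (rule semi_cover_small(2)[OF f s c P2])
  have e: "?f P2 = f P2" "?f Q = f P" using P2 by (auto simp: transpose_def)
  have C2: "P2 < Q2" "r < ?f Q2" "\<And>k. P2 < k \<Longrightarrow> k < Q2 \<Longrightarrow> \<not> (f P2 < ?f k \<and> ?f k < ?f Q2)"
    using c2 e by (auto simp: bcover_def)
  have "\<not> Q < Q2" using C2(3)[of Q] e a P2 C2 PQ by auto
  moreover have "Q2 \<noteq> Q" using C2 PQ by auto
  moreover have "\<not> Q2 < Q"
  proof
    assume "Q2 < Q"
    then have "?f Q2 = f Q2" using C2 P2 by (simp add: transpose_def)
    then show False using semi_cover_small(1)[OF f s c, of Q2] C2 P2 \<open>Q2 < Q\<close> by auto
  qed
  ultimately show False by linarith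
qed

text \<open>A head \<open>> r\<close> with a tail would leave at the end of its block, to the right
  of a larger strand, and would spoil the order of the line above.\<close>

lemma semi_heads:
  assumes fin: "finite K" and reduced_row: "reduced_row K f" and s: "big_sorted r (f \<circ> sigma K)" and k: "k \<in> K"
  shows "f (block_start K k) \<le> r"
proof (rule ccontr)
  assume *: "\<not> f (block_start K k) \<le> r"
  let ?h = "block_start K k" let ?e = "block_end K k"
  have lt: "f ?h < f (Suc k)" using reduced_row k by (auto simp: reduced_row_def)
  have e: "k < ?e" "?e \<notin> K" using block_end_props[OF fin, of k] k by (auto simp: le_less)
  have "block_start K ?e = ?h" using block_start_block_end[OF fin, of k ?e] e by simp
  then have "(f \<circ> sigma K) ?e = f ?h" "(f \<circ> sigma K) k = f (Suc k)" using e k by (auto simp: sigma_def)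
  then show False using s e lt * unfolding big_sorted_def by (metis leI less_asym order_less_trans)
qed

text \<open>If the block of the head \<open>P\<close> went on, the strand at \<open>Suc P\<close>
  would exceed \<open>f P\<close>. By \<open>semi_cover_small\<close> this forces
  \<open>Suc P = Q\<close>, and \<open>Q\<close> would lie in the block headed by
  \<open>P\<close>.\<close>

lemma semi_no_cut:
  assumes f: "fin_perm f" and fin: "finite K" and reduced_row: "reduced_row K f" and s: "big_sorted r f"
    and c: "bcover r f P Q" and ne: "block_start K Q \<noteq> P" and P: "P - 1 \<notin> K"
  shows "P \<notin> K" "rho K P = P"
proof -
  have PQ: "1 \<le> P" "P < Q" "f P \<le> r" "r < f Q" using c by (auto simp: bcover_def)
  have b: "block_start K P = P" using P by (intro block_start_head) auto
  show "P \<notin> K"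
  proof
    assume PK: "P \<in> K"
    then have "f P < f (Suc P)" using reduced_row b by (auto simp: reduced_row_def)
    then have "Suc P = Q" using semi_cover_small(2)[OF f s c, of "Suc P"] PQ by force
    then show False using ne PK b by auto
  qed
  then have "block_end K P = P" by (intro block_end_eqI[OF fin]) auto
  then show "rho K P = P" using P by (simp add: rho_head)
qed

lemma semi_cut:
  assumes f: "fin_perm f" and reduced_row: "reduced_row K f" and s: "big_sorted r f"
    and c: "bcover r f P Q" and h: "block_start K Q = P"
  shows "Q = Suc P"
proof (rule ccontr)
  assume n: "Q \<noteq> Suc P"
  have PQ: "P < Q" using c by (auto simp: bcover_def)
  have "P \<in> K" using cut_head(6)[OF f reduced_row c h] PQ by auto
  moreover have "block_start K P = P" using block_start_same[of K Q P] h PQ by auto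
  ultimately have "f P < f (Suc P)" using reduced_row by (auto simp: reduced_row_def)
  then show False using semi_cover_small(2)[OF f s c, of "Suc P"] PQ n by force
qed

section \<open>Chains\<close>

text \<open>Started from \<open>g = inv w\<close>, this is the inverse of \<open>w w_i(T)\<close>:
  on inverses the transpositions multiply on the left and exchange strands.\<close>

definition chain_line :: "(nat \<times> nat) list \<Rightarrow> (nat \<Rightarrow> nat) \<Rightarrow> nat \<Rightarrow> nat" where
  "chain_line es g = fold (\<lambda>(a, b) h. transpose a b \<circ> h) es g"

definition chain_ok :: "nat \<Rightarrow> (nat \<Rightarrow> nat) \<Rightarrow> (nat \<times> nat) list \<Rightarrow> bool" where
  "chain_ok r g es \<longleftrightarrow> (\<forall>(a, b)\<in>set es. 1 \<le> a \<and> a \<le> r \<and> r < b) \<and>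
     (\<forall>i\<le>length es. ninv (chain_line (take i es) g) = ninv g + i)"

definition chain_entries :: "(nat \<Rightarrow> nat) \<Rightarrow> (nat \<times> nat) list \<Rightarrow> nat list" where
  "chain_entries g es = map (\<lambda>i. inv (chain_line (take (Suc i) es) g) (snd (es ! i))) [0..<length es]"

lemma chain_line_Nil [simp]: "chain_line [] g = g" by (simp add: chain_line_def)
lemma chain_line_snoc: "chain_line (es @ [(a, b)]) g = transpose a b \<circ> chain_line es g" by (simp add: chain_line_def)

lemma length_chain_entries [simp]: "length (chain_entries g es) = length es" by (simp add: chain_entries_def)

lemma chain_entries_snoc: "chain_entries g (es @ [x]) = chain_entries g es @ [inv (chain_line (es @ [x]) g) (snd x)]"
proof (rule nth_equalityI)
  fix i assume "i < length (chain_entries g (es @ [x]))"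
  then show "chain_entries g (es @ [x]) ! i = (chain_entries g es @ [inv (chain_line (es @ [x]) g) (snd x)]) ! i"
    by (cases "i < length es") (auto simp: chain_entries_def nth_append less_Suc_eq)
qed simp

lemma chain_entries_Nil [simp]: "chain_entries g [] = []" by (simp add: chain_entries_def)

lemma chain_ok_Nil [simp]: "chain_ok r g []" by (simp add: chain_ok_def)

lemma chain_ok_snoc:
  "chain_ok r g (es @ [(a, b)]) \<longleftrightarrow> chain_ok r g es \<and> 1 \<le> a \<and> a \<le> r \<and> r < b \<and>
     ninv (chain_line (es @ [(a, b)]) g) = ninv g + Suc (length es)"
proof -
  have "(\<forall>i\<le>length (es @ [(a, b)]). ninv (chain_line (take i (es @ [(a, b)])) g) = ninv g + i) \<longleftrightarrow>
     (\<forall>i\<le>length es. ninv (chain_line (take i es) g) = ninv g + i) \<and> ninv (chain_line (es @ [(a, b)]) g) = ninv g + Suc (length es)"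
    by (auto simp: le_Suc_eq)
  then show ?thesis unfolding chain_ok_def by (auto split: prod.splits)
qed

lemma chain_ok_ninv: "chain_ok r g es \<Longrightarrow> ninv (chain_line es g) = ninv g + length es"
  unfolding chain_ok_def by (metis order_refl take_all_iff)

lemma fin_perm_chain_line:
  assumes "fin_perm g"
  shows "chain_ok r g es \<Longrightarrow> fin_perm (chain_line es g)"
proof (induction es rule: rev_induct)
  case (snoc x xs)
  obtain a b where x: "x = (a, b)" by fastforce
  show ?case unfolding x chain_line_snoc
    by (intro fin_perm_comp fin_perm_transpose) (use snoc x in \<open>auto simp: chain_ok_snoc\<close>)
qed (use assms in simp)

text \<open>The last claim is the pivot between consecutive rows: the entry of \<open>E\<close> in a
  box with strands \<open>a\<close>, \<open>b\<close> is the position that \<open>a\<close> had just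
  before the swap. Hence the entries of one pass tell where the swaps below the next row take
  place.\<close>

lemma chain_bcover:
  assumes g: "fin_perm g" and c: "chain_ok r g (es @ [(a, b)])"
  defines "y \<equiv> chain_line es g"
  shows "bcover r y (inv y a) (inv y b)" "y (inv y a) = a" "y (inv y b) = b"
    "chain_line (es @ [(a, b)]) g = y \<circ> transpose (inv y a) (inv y b)"
    "inv (chain_line (es @ [(a, b)]) g) b = inv y a"
proof -
  let ?P = "inv y a" let ?Q = "inv y b"
  have ok: "chain_ok r g es" "1 \<le> a" "a \<le> r" "r < b" using c by (auto simp: chain_ok_snoc)
  have y: "fin_perm y" unfolding y_def by (rule fin_perm_chain_line[OF g ok(1)])
  show yP: "y ?P = a" and yQ: "y ?Q = b" by (simp_all add: f_inv_fin_perm[OF y])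
  have pos: "1 \<le> ?P" "1 \<le> ?Q" using yP yQ ok fin_perm_zero[OF y, of ?P] fin_perm_zero[OF y, of ?Q] by auto
  show eq: "chain_line (es @ [(a, b)]) g = y \<circ> transpose ?P ?Q"
    unfolding chain_line_snoc y_def[symmetric] using transpose_comp_fin_perm[OF y, of ?P ?Q] yP yQ by simp
  have n: "ninv (y \<circ> transpose ?P ?Q) = Suc (ninv y)"
    using c chain_ok_ninv[OF ok(1)] unfolding chain_ok_snoc eq unfolding y_def[symmetric] by linarith
  have ne: "?P \<noteq> ?Q" using yP yQ ok by force
  have lt: "?P < ?Q"
  proof (rule ccontr)
    assume "\<not> ?P < ?Q"
    then have "?Q < ?P" using ne by simp
    then have "y ?Q < y ?P" using ninv_swap_iff[OF y pos(2), of ?P] n by (simp add: transpose_commute)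
    then show False using yP yQ ok by simp
  qed
  show "bcover r y ?P ?Q"
    unfolding bcover_def using pos lt yP yQ ok ninv_swap_between[OF y pos(1), of _ ?Q] n by force
  have y': "fin_perm (y \<circ> transpose ?P ?Q)" using y pos by (intro fin_perm_comp fin_perm_transpose)
  have "(y \<circ> transpose ?P ?Q) ?P = b" using yQ by simp
  then show "inv (chain_line (es @ [(a, b)]) g) b = ?P" unfolding eq using inv_fin_perm_f[OF y'] by metis
qed

text \<open>The state during a row pass, without graphs: \<open>f\<close> is the line below the
  current row, \<open>K\<close> the labels now present in the row, \<open>g\<close> the line above
  the row at the start of the pass, and \<open>es\<close> the filled boxes.\<close>

definition row_state :: "nat \<Rightarrow> (nat \<Rightarrow> nat) \<Rightarrow> (nat \<Rightarrow> nat) \<Rightarrow> nat set \<Rightarrow> (nat \<times> nat) list \<Rightarrow> bool" where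
  "row_state r g f K es \<longleftrightarrow> fin_perm g \<and> fin_perm f \<and> finite K \<and> 0 \<notin> K \<and> reduced_row K f \<and>
     chain_ok r g es \<and> f \<circ> sigma K = chain_line es g"

lemma row_stateD:
  assumes "row_state r g f K es"
  shows "fin_perm g" "fin_perm f" "finite K" "0 \<notin> K" "reduced_row K f" "chain_ok r g es" "f \<circ> sigma K = chain_line es g"
    "f (sigma K k) = chain_line es g k" "ninv f + card K = ninv g + length es"
proof -
  show *: "fin_perm g" "fin_perm f" "finite K" "0 \<notin> K" "reduced_row K f" "chain_ok r g es" "f \<circ> sigma K = chain_line es g"
    using assms by (auto simp: row_state_def)
  show "f (sigma K k) = chain_line es g k" using fun_cong[OF *(7), of k] by simp
  \<comment> \<open>Both sides count the inversions of the line above the row. From this identity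
    come the lengths along the chain and, at the end, the number of crossings in the row.\<close>
  show "ninv f + card K = ninv g + length es"
    using ninv_row[OF *(3,2,4)] *(5,7) chain_ok_ninv[OF *(6)] by simp
qed


definition last_name :: "(nat \<times> nat) list \<Rightarrow> nat set" where
  "last_name es = (if es = [] then {} else {snd (last es)})"

lemma row_state_last:
  assumes S: "row_state r g f K (es @ [(e, g0)])"
  shows "f (sigma K (last (chain_entries g (es @ [(e, g0)])))) = g0"
proof -
  note D = row_stateD[OF S]
  have "fin_perm (chain_line (es @ [(e, g0)]) g)" using fin_perm_chain_line D by blast
  then show ?thesis unfolding D(8) chain_entries_snoc by (simp add: f_inv_fin_perm)
qed

lemma insert_row_state:
  assumes S: "row_state r g f K es" and k: "k \<notin> K" "1 \<le> k"
    and c: "f (block_start K k) \<le> r" and d: "r < f (Suc k)"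
  shows "row_state r g f (insert k K) (es @ [(f (block_start K k), f (Suc k))])"
    "chain_entries g (es @ [(f (block_start K k), f (Suc k))]) = chain_entries g es @ [k]"
proof -
  note D = row_stateD[OF S]
  let ?K = "insert k K" let ?c = "f (block_start K k)" let ?d = "f (Suc k)"
  have reduced_row': "reduced_row ?K f" by (rule reduced_row_insert_any) (use D k c d in auto)
  have line: "f \<circ> sigma ?K = chain_line (es @ [(?c, ?d)]) g"
    unfolding chain_line_snoc sigma_insert_any[OF k(1)] D(7)[symmetric]
    using transpose_comp_fin_perm[OF D(2), of "block_start K k" "Suc k"] by (simp add: fun_eq_iff)
  have "block_start K k \<noteq> 0" using block_start_mem[of K k 0] D(4) k by (metis bot_nat_0.extremum less_le_trans zero_less_one le_refl)
  then have c1: "1 \<le> ?c" using fin_perm_zero[OF D(2), of "block_start K k"] by simp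
  have fin': "finite ?K" "0 \<notin> ?K" using D k by auto
  have "ninv (f \<circ> sigma ?K) = ninv f + card ?K" using ninv_row[OF fin'(1) D(2) fin'(2)] reduced_row' by simp
  then have "ninv (chain_line (es @ [(?c, ?d)]) g) = ninv g + Suc (length es)" using line D(9) D(3) k by simp
  then have ok: "chain_ok r g (es @ [(?c, ?d)])" using D(6) c1 c d by (simp add: chain_ok_snoc)
  then show "row_state r g f ?K (es @ [(?c, ?d)])" using D fin' reduced_row' line by (simp add: row_state_def)
  have fp: "fin_perm (chain_line (es @ [(?c, ?d)]) g)" by (rule fin_perm_chain_line[OF D(1) ok])
  have "chain_line (es @ [(?c, ?d)]) g k = ?d" using fun_cong[OF line, of k] by (simp add: sigma_def)
  then have "inv (chain_line (es @ [(?c, ?d)]) g) ?d = k" using inv_fin_perm_f[OF fp, of k] by simp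
  then show "chain_entries g (es @ [(?c, ?d)]) = chain_entries g es @ [k]" by (simp add: chain_entries_snoc)
qed

lemma keep_row_state:
  assumes S: "row_state r g f K es" and c: "bcover r f P Q" and ne: "block_start K Q \<noteq> P"
    and n: "ninv (f \<circ> transpose P Q) = Suc (ninv f)"
  shows "row_state r g (f \<circ> transpose P Q) K (es @ [(f P, f Q)])"
    "chain_entries g (es @ [(f P, f Q)]) = chain_entries g es @ [rho K P]"
proof -
  note D = row_stateD[OF S]
  let ?f = "f \<circ> transpose P Q"
  have PQ: "1 \<le> P" "P < Q" "f P \<le> r" "r < f Q" using c by (auto simp: bcover_def)
  have f': "fin_perm ?f" using D PQ by (intro fin_perm_comp fin_perm_transpose) auto
  have reduced_row': "reduced_row K ?f" by (rule reduced_row_swap[OF D(2,5) c ne])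
  have line: "?f \<circ> sigma K = chain_line (es @ [(f P, f Q)]) g"
    unfolding chain_line_snoc D(7)[symmetric] using transpose_comp_fin_perm[OF D(2), of P Q] by (simp add: fun_eq_iff)
  have "ninv (?f \<circ> sigma K) = ninv ?f + card K" using ninv_row[OF D(3) f' D(4)] reduced_row' by simp
  then have "ninv (chain_line (es @ [(f P, f Q)]) g) = ninv g + Suc (length es)" using line D(9) n by simp
  moreover have "1 \<le> f P" using fin_perm_zero[OF D(2), of P] PQ by simp
  ultimately have ok: "chain_ok r g (es @ [(f P, f Q)])" using D(6) PQ by (simp add: chain_ok_snoc)
  then show "row_state r g ?f K (es @ [(f P, f Q)])" using D f' reduced_row' line by (simp add: row_state_def)
  have fp: "fin_perm (chain_line (es @ [(f P, f Q)]) g)" by (rule fin_perm_chain_line[OF D(1) ok])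
  have "chain_line (es @ [(f P, f Q)]) g (rho K P) = f Q"
    using fun_cong[OF line, of "rho K P"] sigma_rho[OF D(3), of P] by simp
  then have "inv (chain_line (es @ [(f P, f Q)]) g) (f Q) = rho K P" using inv_fin_perm_f[OF fp, of "rho K P"] by simp
  then show "chain_entries g (es @ [(f P, f Q)]) = chain_entries g es @ [rho K P]" by (simp add: chain_entries_snoc)
qed

lemma cut_row_state:
  assumes S: "row_state r g f K es" and c: "bcover r f P Q" and h: "block_start K Q = P"
  shows "row_state r g (f \<circ> transpose P Q) (K - {Q - 1}) es"
proof -
  note D = row_stateD[OF S]
  have PQ: "1 \<le> P" "P < Q" using c by (auto simp: bcover_def)
  have "fin_perm (f \<circ> transpose P Q)" using D PQ by (intro fin_perm_comp fin_perm_transpose) auto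
  then show ?thesis using D cut_head[OF D(2,5) c h] by (simp add: row_state_def)
qed

text \<open>The new entry \<open>(e, f Q)\<close> has the same small strand as the previous entry
  \<open>(e, g0)\<close>. The label \<open>E\<close>, whose removal takes out the crossing of
  \<open>f Q\<close> with \<open>g0\<close>, accounts for the transposition of these two strands,
  and together the three transpositions reduce to the single \<open>(e, f Q)\<close>. The strand
  \<open>f Q\<close> then leaves at \<open>E\<close>, so the entry of the tableau
  \<open>E(w, T)\<close> in the previous box does not change.\<close>

lemma column_row_state:
  assumes S: "row_state r g f K (es @ [(e, g0)])" and c: "bcover r f P Q" and ne: "block_start K Q \<noteq> P"
    and n: "ninv (f \<circ> transpose P Q) = Suc (ninv f)"
    and E: "E = last (chain_entries g (es @ [(e, g0)]))" "E \<in> K" "block_start K E = P" "f P = e"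
  shows "row_state r g (f \<circ> transpose P Q) (K - {E}) (es @ [(e, f Q)])"
    "chain_entries g (es @ [(e, f Q)]) = chain_entries g (es @ [(e, g0)])" "f (Suc E) = g0" "P \<le> E"
proof -
  note D = row_stateD[OF S]
  let ?f = "f \<circ> transpose P Q" let ?K = "K - {E}"
  have PQ: "1 \<le> P" "P < Q" "f P \<le> r" "r < f Q" using c by (auto simp: bcover_def)
  have f': "fin_perm ?f" using D PQ by (intro fin_perm_comp fin_perm_transpose) auto
  show PE: "P \<le> E" using block_start_le[of K E] E by simp
  have fg: "f (sigma K E) = g0" using row_state_last[OF S] E by simp
  then show fSE: "f (Suc E) = g0" using E by (simp add: sigma_def)
  have SEQ: "Suc E \<noteq> Q" using ne E by auto
  have g0: "r < g0" and e1: "1 \<le> e" using D(6) by (auto simp: chain_ok_snoc)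
  have reduced_row': "reduced_row K ?f" by (rule reduced_row_swap[OF D(2,5) c ne])
  have reduced_row'': "reduced_row ?K ?f"
    unfolding reduced_row_def
  proof
    fix j assume j: "j \<in> ?K"
    have lt: "?f (block_start K j) < ?f (Suc j)" using reduced_row' j by (auto simp: reduced_row_def)
    show "?f (block_start ?K j) < ?f (Suc j)"
    proof (cases "E < j \<and> block_start K j \<le> E")
      case True
      have bj: "block_start K j = P" using block_start_same[of K j E] True E by auto
      have "block_start ?K j = Suc E" by (rule block_start_eqI) (use True block_start_mem[of K j] in auto)
      moreover have Qj: "\<not> (Suc E \<le> Q \<and> Q \<le> j)" using block_start_same[of K j Q] bj ne PE by auto
      have fE: "?f (Suc E) = g0" using SEQ PE fSE by (simp add: transpose_def)
      \<comment> \<open>The remainder of the block is now headed by \<open>g0\<close>. A tail below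
        \<open>g0\<close> would, before the last entry was added, have stood at \<open>j\<close>,
        strictly between the two positions exchanged by \<open>(e, g0)\<close>, with a value between
        \<open>e\<close> and \<open>g0\<close>; that contradicts the cover condition.\<close>
      have "g0 < ?f (Suc j)"
      proof (rule ccontr)
        assume a: "\<not> g0 < ?f (Suc j)"
        have lt2: "f P < f (Suc j)" using D(5) j bj by (auto simp: reduced_row_def)
        have fjQ: "Suc j \<noteq> Q"
          using ne bj j by auto
        then have fj: "?f (Suc j) = f (Suc j)" using True PE by (simp add: transpose_def)
        have "fin_perm (f \<circ> sigma K)" using D fin_perm_chain_line by metis
        let ?y = "chain_line es g"
        have ok: "chain_ok r g (es @ [(e, g0)])" using D by simp
        note cb = chain_bcover[OF D(1) ok]
        have y: "fin_perm ?y" using fin_perm_chain_line[OF D(1)] D(6) by (auto simp: chain_ok_snoc)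
        have EP: "inv ?y e = E" using cb(5) E(1) by (simp add: chain_entries_snoc)
        let ?X = "inv ?y g0"
        have xl: "f (sigma K k) = (?y \<circ> transpose E ?X) k" for k using D(8)[of k] cb(4) EP by simp
        have EX: "E < ?X" using cb(1) EP by (auto simp: bcover_def)
        have "?y E = e" using cb(2) EP by simp
        then have "(?y \<circ> transpose E ?X) ?X = e" by simp
        then have "f (sigma K ?X) = f P" using xl E(4) by simp
        then have "sigma K ?X = P" using fin_perm_eq_iff[OF D(2)] by simp
        then have "rho K P = ?X" using rho_sigma[OF D(3)] by metis
        moreover have "rho K P = block_end K P" using block_start_pred[of K E] E(3) PQ by (simp add: rho_def)
        ultimately have Xe: "block_end K P = ?X" by simp
        have "j < block_end K P"
        proof (rule ccontr)
          assume "\<not> j < block_end K P"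
          then have "block_end K P \<in> K \<or> block_end K P = j" using block_start_mem[of K j "block_end K P"] bj block_end_props(1)[OF D(3), of P] by force
          then show False using j block_end_props(2)[OF D(3), of P] by auto
        qed
        then have jX: "E < j" "j < ?X" using True Xe by auto
        have "f (sigma K j) = f (Suc j)" using j by (simp add: sigma_def)
        then have "?y j = f (Suc j)" using xl[of j] jX by (simp add: transpose_def)
        moreover have "\<not> (?y E < ?y j \<and> ?y j < ?y ?X)" using cb(1) EP jX by (auto simp: bcover_def)
        moreover have "f (Suc j) \<noteq> g0" using fSE fin_perm_eq_iff[OF D(2), of "Suc j" "Suc E"] True by auto
        ultimately show False using a fj lt2 \<open>?y E = e\<close> E(4) cb(3) by simp
      qed
      then show ?thesis using fE \<open>block_start ?K j = Suc E\<close> by simp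
    next
      case False
      have "block_start ?K j = block_start K j"
        using False j block_start_mem[of K j] block_start_pred[of K j] block_start_le[of K j]
        by (intro block_start_eqI) auto
      then show ?thesis using lt by simp
    qed
  qed
  have line: "?f \<circ> sigma ?K = chain_line (es @ [(e, f Q)]) g"
  proof -
    have e1: "sigma ?K = transpose P (Suc E) \<circ> sigma K" using sigma_remove[OF E(2)] E(3) by simp
    have "chain_line (es @ [(e, g0)]) g = transpose e g0 \<circ> chain_line es g" by (rule chain_line_snoc)
    then have y: "chain_line es g = transpose e g0 \<circ> (f \<circ> sigma K)" using D(7) by (simp add: fun_eq_iff)
    have "g0 \<noteq> f Q" using fSE SEQ fin_perm_eq_iff[OF D(2), of "Suc E" Q] by auto
    then have "?f (transpose P (Suc E) p) = transpose e (f Q) (transpose e g0 (f p))" for p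
      using E(4) fSE SEQ PQ PE fin_perm_eq_iff[OF D(2), of p P] fin_perm_eq_iff[OF D(2), of p Q] fin_perm_eq_iff[OF D(2), of p "Suc E"] g0
      by (auto simp: transpose_def)
    then show ?thesis unfolding chain_line_snoc y e1 by (simp add: fun_eq_iff)
  qed
  have fin': "finite ?K" "0 \<notin> ?K" using D by auto
  have "ninv (?f \<circ> sigma ?K) = ninv ?f + card ?K" using ninv_row[OF fin'(1) f' fin'(2)] reduced_row'' by simp
  moreover have "Suc (card ?K) = card K" using card_Suc_Diff1[OF D(3) E(2)] .
  ultimately have "ninv (chain_line (es @ [(e, f Q)]) g) = ninv g + Suc (length es)" using line D(9) n by simp
  then have ok: "chain_ok r g (es @ [(e, f Q)])" using D(6) PQ E(4) by (auto simp: chain_ok_snoc)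
  then show "row_state r g ?f ?K (es @ [(e, f Q)])" using D f' fin' reduced_row'' line by (simp add: row_state_def)
  have fp: "fin_perm (chain_line (es @ [(e, f Q)]) g)" by (rule fin_perm_chain_line[OF D(1) ok])
  have "block_start ?K E = P" using E(3) by (simp add: block_start_remove_below)
  then have "chain_line (es @ [(e, f Q)]) g E = f Q" using fun_cong[OF line, of E] by (simp add: sigma_def)
  then have "inv (chain_line (es @ [(e, f Q)]) g) (f Q) = E" using inv_fin_perm_f[OF fp, of E] by simp
  then show "chain_entries g (es @ [(e, f Q)]) = chain_entries g (es @ [(e, g0)])" using E(1) by (simp add: chain_entries_snoc)
qed

lemma search:
  assumes S: "row_state r g f K es" and H: "P - 1 \<notin> K" "r < f P" "P \<le> j0" "\<forall>j. P \<le> j \<longrightarrow> j < j0 \<longrightarrow> j \<in> K"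
  shows "\<exists>k1. last_allowed r f K (last_name es) j0 k1"
proof -
  note D = row_stateD[OF S]
  have "\<exists>k<P. allowed r f K (last_name es) k" by (rule allowed_ex[OF D(2,5)]) (use H in auto)
  then show ?thesis using last_allowed_ex[of _ j0 r f K "last_name es"] H(3) by (meson less_le_trans)
qed

lemma search_first:
  assumes S: "row_state r g f K es" and H: "P - 1 \<notin> K" "r < f P" "P \<le> j0" "\<forall>j. P \<le> j \<longrightarrow> j < j0 \<longrightarrow> j \<in> K"
    and la: "last_allowed r f K (last_name es) j0 k1" and c: "f (block_start K k1) \<le> r"
    and k1: "1 \<le> k1"
  defines "es' \<equiv> es @ [(f (block_start K k1), f (Suc k1))]"
  shows "row_state r g f (insert k1 K) es'" "chain_entries g es' = chain_entries g es @ [k1]" "k1 < P"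
    "rowinv r f (insert k1 K) (f (Suc k1)) k1 P" "colinv r f (insert k1 K) (f (block_start K k1)) k1 {..<P}"
    "\<And>p. k1 < p \<Longrightarrow> p \<le> P \<Longrightarrow> r < f p"
proof -
  note D = row_stateD[OF S]
  have a: "k1 \<notin> K" "r < f (Suc k1)" using la by (auto simp: last_allowed_def allowed_def)
  have hd: "P = 0 \<or> P - 1 \<notin> K" using H by simp
  note z = zone[OF D(2,3,5) hd H(2,3,4) la]
  show "k1 < P" by (rule z(1))
  show "row_state r g f (insert k1 K) es'" "chain_entries g es' = chain_entries g es @ [k1]"
    unfolding es'_def using insert_row_state[OF S a(1) k1 c a(2)] by auto
  show "\<And>p. k1 < p \<Longrightarrow> p \<le> P \<Longrightarrow> r < f p" by (rule z(3))
  have zall: "\<forall>p. k1 < p \<longrightarrow> p \<le> P \<longrightarrow> r < f p" using z(3) by blast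
  show "rowinv r f (insert k1 K) (f (Suc k1)) k1 P" by (rule merge_rowinv[OF D(3) z(1) a(1) zall c])
  show "colinv r f (insert k1 K) (f (block_start K k1)) k1 {..<P}" by (rule merge_colinv) (use z(3) in auto)
qed

text \<open>Joining label \<open>k1\<close> exchanges the strands \<open>g0\<close> and
  \<open>d = f (Suc k1)\<close>, both \<open>> r\<close>, which is no legal entry. The identity
  \<open>(g0 d)(e g0) = (e g0)(e d)\<close> rewrites this exchange together with the last entry as
  the two entries \<open>(e, d)\<close>, \<open>(e, g0)\<close>.\<close>

lemma search_second:
  assumes S: "row_state r g f K es" and H: "P - 1 \<notin> K" "r < f P" "P \<le> j0" "\<forall>j. P \<le> j \<longrightarrow> j < j0 \<longrightarrow> j \<in> K"
    and la: "last_allowed r f K (last_name es) j0 k1" and c: "r < f (block_start K k1)"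
    and k1: "1 \<le> k1"
  obtains es0 e g0 where "es = es0 @ [(e, g0)]" "g0 = f (block_start K k1)" "last (chain_entries g es) = k1" "k1 < P"
    "row_state r g f (insert k1 K) (es0 @ [(e, f (Suc k1)), (e, g0)])"
    "chain_entries g (es0 @ [(e, f (Suc k1)), (e, g0)]) = chain_entries g es @ [rho (insert k1 K) (block_start K k1)]"
    "rowinv r f (insert k1 K) g0 (rho (insert k1 K) (block_start K k1)) P"
    "k1 < rho (insert k1 K) (block_start K k1)" "bcover r (chain_line es0 g) k1 (inv (chain_line es0 g) g0)"
    "k1 < rho K (Suc k1)" "rho K (Suc k1) < inv (chain_line es0 g) g0" "chain_line es0 g (rho K (Suc k1)) = f (Suc k1)" "g0 < f (Suc k1)"
proof -
  note D = row_stateD[OF S]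
  have a: "k1 \<notin> K" "r < f (Suc k1)" "f (block_start K k1) \<in> last_name es"
    using la c by (auto simp: last_allowed_def allowed_def)
  then have "es \<noteq> []" by (auto simp: last_name_def)
  then obtain es0 e g0 where es: "es = es0 @ [(e, g0)]" by (metis append_butlast_last_id surj_pair)
  then have g0: "g0 = f (block_start K k1)" using a(3) by (simp add: last_name_def)
  have hd: "P = 0 \<or> P - 1 \<notin> K" using H by simp
  note z = zone[OF D(2,3,5) hd H(2,3,4) la]
  let ?y = "chain_line es0 g" let ?K = "insert k1 K" let ?d = "f (Suc k1)" let ?h = "block_start K k1"
  have ok: "chain_ok r g (es0 @ [(e, g0)])" using D(6) es by simp
  note cb = chain_bcover[OF D(1) ok]
  have ok0: "chain_ok r g es0" "1 \<le> e" "e \<le> r" "r < g0" using ok by (auto simp: chain_ok_snoc)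
  have y: "fin_perm ?y" by (rule fin_perm_chain_line[OF D(1) ok0(1)])
  let ?X = "inv ?y g0"
  have line: "f \<circ> sigma K = transpose e g0 \<circ> ?y" using D(7) es chain_line_snoc by simp
  have "f (sigma K k1) = g0" using g0 a by (simp add: sigma_def)
  then have "transpose e g0 (?y k1) = g0" using fun_cong[OF line, of k1] by simp
  then have yk: "?y k1 = e" by (metis transpose_apply_second transpose_eq_iff)
  then have ie: "inv ?y e = k1" using inv_fin_perm_f[OF y, of k1] by simp
  have cov: "bcover r ?y k1 ?X" using cb(1) ie by simp
  have line2: "f \<circ> sigma K = ?y \<circ> transpose k1 ?X" using cb(4) D(7) es ie by simp
  have zall: "\<forall>p. k1 < p \<longrightarrow> p \<le> P \<longrightarrow> r < f p" using z(3) by blast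
  note dm = double_merge[OF D(2,3,5) z(1) a(1) zall y line2 cov]
  have yX: "?y ?X = g0" by (rule cb(3))
  let ?D = "rho K (Suc k1)"
  have gd: "g0 < ?d" using dm(1) yX by simp
  have reduced_row': "reduced_row ?K f" by (rule reduced_row_insert_any[OF D(5) a(1)]) (use gd g0 in simp)
  have fin': "finite ?K" "0 \<notin> ?K" using D k1 by auto
  let ?e1 = "es0 @ [(e, ?d)]" let ?e2 = "?e1 @ [(e, g0)]"
  have chain_line1: "chain_line ?e1 g = ?y \<circ> transpose k1 ?D"
    unfolding chain_line_snoc using transpose_comp_fin_perm[OF y, of k1 ?D] yk dm(4) by simp
  have kD: "k1 < ?D" "?D < ?X" by (rule dm(2), rule dm(3))
  have l2: "f \<circ> sigma ?K = transpose g0 ?d \<circ> (transpose e g0 \<circ> ?y)"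
    unfolding sigma_insert_any[OF a(1)] line[symmetric]
    using transpose_comp_fin_perm[OF D(2), of ?h "Suc k1"] g0 by (simp add: fun_eq_iff)
  have lt: "e < g0" using ok0 by simp
  have tr: "transpose g0 ?d (transpose e g0 x) = transpose e g0 (transpose e ?d x)" for x
    using lt gd by (auto simp: transpose_def)
  have line': "f \<circ> sigma ?K = chain_line ?e2 g" unfolding l2 chain_line_snoc using tr by (simp add: fun_eq_iff)
  have f1: "fin_perm (chain_line ?e1 g)" unfolding chain_line1 using y k1 kD by (intro fin_perm_comp fin_perm_transpose) auto
  have up1: "ninv ?y < ninv (chain_line ?e1 g)" unfolding chain_line1
    by (rule ninv_swap_up[OF y k1 kD(1)]) (use yk dm(4) lt gd in simp)
  have "chain_line ?e2 g = chain_line ?e1 g \<circ> transpose ?D ?X"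
  proof -
    have "chain_line ?e1 g ?D = e" "chain_line ?e1 g ?X = g0" using chain_line1 kD yk yX by (auto simp: transpose_def)
    then show ?thesis unfolding chain_line_snoc[of ?e1] using transpose_comp_fin_perm[OF f1, of ?D ?X] by simp
  qed
  moreover have "ninv (chain_line ?e1 g) < ninv (chain_line ?e1 g \<circ> transpose ?D ?X)"
    by (rule ninv_swap_up[OF f1]) (use chain_line1 kD yk yX lt k1 in \<open>auto simp: transpose_def\<close>)
  ultimately have up2: "ninv (chain_line ?e1 g) < ninv (chain_line ?e2 g)" by simp
  have "ninv (f \<circ> sigma ?K) = ninv f + card ?K" using ninv_row[OF fin'(1) D(2) fin'(2)] reduced_row' by simp
  then have tot: "ninv (chain_line ?e2 g) = ninv g + Suc (Suc (length es0))" using line' D(9) D(3) a es by simp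
  have n0: "ninv ?y = ninv g + length es0" by (rule chain_ok_ninv[OF ok0(1)])
  \<comment> \<open>Each of the two swaps raises the count and together they raise it by two, so
    each raises it by exactly one.\<close>
  have n1: "ninv (chain_line ?e1 g) = ninv g + Suc (length es0)" using up1 up2 tot n0 by linarith
  have ok1: "chain_ok r g ?e1" using n1 ok0 a(2) by (simp add: chain_ok_snoc)
  have ok2: "chain_ok r g ?e2" unfolding chain_ok_snoc[of r g ?e1] using ok1 tot ok0 by simp
  have S': "row_state r g f ?K ?e2" using D fin' reduced_row' line' ok2 by (simp add: row_state_def)
  have lastE: "chain_entries g es = chain_entries g es0 @ [k1]" using cb(5) ie es by (simp add: chain_entries_snoc)
  have "chain_line ?e1 g k1 = ?d" using chain_line1 dm(4) by simp
  then have E1: "inv (chain_line ?e1 g) ?d = k1" using inv_fin_perm_f[OF f1, of k1] by simp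
  have f2: "fin_perm (chain_line ?e2 g)" by (rule fin_perm_chain_line[OF D(1) ok2])
  let ?E = "rho ?K ?h"
  have "chain_line ?e2 g ?E = g0" using fun_cong[OF line', of ?E] sigma_rho[OF fin'(1), of ?h] g0 by simp
  then have E2: "inv (chain_line ?e2 g) g0 = ?E" using inv_fin_perm_f[OF f2, of ?E] by simp
  have EE: "chain_entries g ?e2 = chain_entries g es @ [?E]" unfolding chain_entries_snoc[of g ?e1] chain_entries_snoc[of g es0] lastE using E1 E2 by simp
  have row: "rowinv r f ?K g0 ?E P" using double_merge_rowinv[OF D(3) reduced_row' z(1) a(1)] g0 ok0 by simp
  have kE: "k1 < ?E"
  proof -
    have "k1 \<le> ?E"
    proof -
      have head: "?h = 0 \<or> ?h - 1 \<notin> ?K" using block_start_pred[of ?K k1] by (auto simp: block_start_insert_below)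
      have "block_start ?K k1 = ?h" by (simp add: block_start_insert_below)
      then show ?thesis unfolding rho_head[OF head]
        using block_end_props[OF fin'(1), of ?h] block_start_mem[of ?K k1 "block_end ?K ?h"] by (metis not_le)
    qed
    moreover have "?E \<noteq> k1" using sigma_rho[OF fin'(1), of ?h] block_start_le[of K k1] by (auto simp: sigma_def)
    ultimately show ?thesis by simp
  qed
  show thesis
    by (rule that[of es0 e g0]) (use es g0 lastE z(1) S' EE row kE cov kD dm(4) gd in simp_all)
qed

section \<open>Rectification steps\<close>

definition put_entry :: "nat \<Rightarrow> (nat \<times> nat) list \<Rightarrow> nat \<Rightarrow> nat \<Rightarrow> (nat \<times> nat) list" where
  "put_entry r es c d = (if c \<le> r then es @ [(c, d)]
     else butlast es @ [(fst (last es), d), (fst (last es), snd (last es))])"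

text \<open>A form of \<open>rectification_step\<close> that speaks of lines only, with
  \<open>P\<close>, \<open>Q\<close> the positions of \<open>a\<close>, \<open>b\<close>. In
  \<open>head\<close> the removed label is \<open>Q - 1\<close>, where \<open>b\<close>, moved to
  the head \<open>P\<close>, crosses \<open>a\<close>, moved to \<open>Q\<close>; in
  \<open>column\<close> it is the label at which \<open>b\<close> crosses the second strand of the
  last filled box. Failures of any other kind have no rule, and the invariants must exclude
  them.\<close>

inductive rect_out :: "nat \<Rightarrow> (nat \<Rightarrow> nat) \<Rightarrow> (nat list \<Rightarrow> bool) \<Rightarrow> (nat \<Rightarrow> nat) \<Rightarrow> nat set \<Rightarrow> (nat \<times> nat) list \<Rightarrow>
    nat \<Rightarrow> nat \<Rightarrow> nat set \<Rightarrow> (nat \<times> nat) list \<Rightarrow> bool"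
  for r g strict f K es P Q where
  keep: "block_start K Q \<noteq> P \<Longrightarrow> strict (chain_entries g es @ [rho K P]) \<Longrightarrow>
     rect_out r g strict f K es P Q K (es @ [(f P, f Q)])"
| head: "block_start K Q = P \<Longrightarrow> f' = f \<circ> transpose P Q \<Longrightarrow> K' = K - {Q - 1} \<Longrightarrow>
     last_allowed r f' K' (last_name es) (Q - 1) k \<Longrightarrow>
     rect_out r g strict f K es P Q (insert k K') (put_entry r es (f' (block_start K' k)) (f' (Suc k)))"
| column: "block_start K Q \<noteq> P \<Longrightarrow> \<not> strict (chain_entries g es @ [rho K P]) \<Longrightarrow> es \<noteq> [] \<Longrightarrow> fst (last es) = f P \<Longrightarrow>
     E \<in> K \<Longrightarrow> block_start K E = P \<Longrightarrow> f (Suc E) = snd (last es) \<Longrightarrow>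
     f' = f \<circ> transpose P Q \<Longrightarrow> K' = K - {E} \<Longrightarrow> es' = butlast es @ [(f P, f Q)] \<Longrightarrow>
     last_allowed r f' K' (last_name es') E k \<Longrightarrow>
     rect_out r g strict f K es P Q (insert k K') (put_entry r es' (f' (block_start K' k)) (f' (Suc k)))"

lemma snoc_pair: "es \<noteq> [] \<Longrightarrow> \<exists>es0 e g0. es = es0 @ [(e, g0)]"
  by (cases es rule: rev_cases) auto

text \<open>Hypothesis \<open>H\<close> excludes the failures for which the algorithm has no
  instruction. Of the four alternatives for the result, the one without \<open>colinv\<close> is the
  second-type insertion. It is refuted later: in the first column of a hook because \<open>P\<close>
  is not after the last entry, and for semi-shuffles because all lines of the chain satisfy
  \<open>big_sorted\<close>.\<close>

lemma rect_outcome_raw: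
  assumes S: "row_state r g f K es" and c: "bcover r f P Q" and n: "ninv (f \<circ> transpose P Q) = Suc (ninv f)"
    and f1: "(f \<circ> transpose P Q) 1 \<le> r"
    and H: "block_start K Q = P \<or> strict (chain_entries g es @ [rho K P]) \<or>
      (es \<noteq> [] \<and> last (chain_entries g es) \<in> K \<and> block_start K (last (chain_entries g es)) = P \<and> f P = fst (last es))"
  defines "f' \<equiv> f \<circ> transpose P Q"
  obtains K' es' E where "rect_out r g strict f K es P Q K' es'" "row_state r g f' K' es'"
    "chain_entries g es' = chain_entries g es @ [E]" "rowinv r f' K' (snd (last es')) E P"
    "(block_start K Q \<noteq> P \<and> strict (chain_entries g es @ [rho K P]) \<and> E = rho K P \<and> K' = K \<and> colinv r f' K' (fst (last es')) E {..<P}) \<or>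
     (block_start K Q = P \<and> K' = insert E (K - {Q - 1}) \<and> E < P \<and> (\<forall>p. E < p \<longrightarrow> p \<le> P \<longrightarrow> r < f' p) \<and>
        colinv r f' K' (fst (last es')) E {..<P}) \<or>
     (block_start K Q = P \<and> es \<noteq> [] \<and> last (chain_entries g es) < P \<and> \<not> big_sorted r (chain_line (butlast es) g)) \<or>
     (block_start K Q \<noteq> P \<and> \<not> strict (chain_entries g es @ [rho K P]) \<and> E < P \<and> P \<le> last (chain_entries g es) \<and> colinv r f' K' (fst (last es')) E {..<P})"
    "\<And>\<kappa>. block_start K Q = P \<Longrightarrow> es \<noteq> [] \<Longrightarrow> rowinv r f K (snd (last es)) (last (chain_entries g es)) \<kappa> \<Longrightarrow> \<kappa> < P \<Longrightarrow> last (chain_entries g es) < E"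
proof -
  note D = row_stateD[OF S]
  have PQ: "1 \<le> P" "P < Q" "f P \<le> r" "r < f Q" using c by (auto simp: bcover_def)
  \<comment> \<open>Position 1 carries a strand \<open><= r\<close>, so label 0 is never
    allowed.\<close>
  have k1pos: "1 \<le> k" if "last_allowed r f' A B j k" for k A B j
  proof (rule ccontr)
    assume "\<not> 1 \<le> k"
    then have "k = 0" by simp
    then show False using that f1 unfolding last_allowed_def allowed_def f'_def by auto
  qed
  consider (head) "block_start K Q = P" | (keep) "block_start K Q \<noteq> P" "strict (chain_entries g es @ [rho K P])"
    | (col) "block_start K Q \<noteq> P" "\<not> strict (chain_entries g es @ [rho K P])" using H by blast
  then show thesis
  proof cases
    case keep
    let ?es = "es @ [(f P, f Q)]"
    have out: "rect_out r g strict f K es P Q K ?es" by (rule rect_out.keep) (use keep in auto)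
    have R1: "row_state r g f' K ?es" "chain_entries g ?es = chain_entries g es @ [rho K P]"
      unfolding f'_def using keep_row_state[OF S c keep(1) n] by auto
    have R3: "rowinv r f' K (snd (last ?es)) (rho K P) P"
      unfolding f'_def using keep_rowinv[OF D(2,3,5) c keep(1)] by simp
    have "colinv r f' K (fst (last ?es)) (rho K P) {..<P}"
      unfolding f'_def by (rule keep_colinv[OF D(2,3,5) c keep(1)])
    then have c1: "block_start K Q \<noteq> P \<and> strict (chain_entries g es @ [rho K P]) \<and> rho K P = rho K P \<and> K = K \<and>
         colinv r f' K (fst (last ?es)) (rho K P) {..<P}" using keep by blast
    show thesis
      by (rule that[OF out R1 R3]) (rule disjI1, rule c1, use keep(1) in blast)
  next
    case head
    let ?K = "K - {Q - 1}"
    note S' = cut_row_state[OF S c head]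
    note ch = cut_head[OF D(2,5) c head]
    have H: "P - 1 \<notin> ?K" "r < f' P" "P \<le> Q - 1" "\<forall>j. P \<le> j \<longrightarrow> j < Q - 1 \<longrightarrow> j \<in> ?K"
      using ch(5,6) PQ by (auto simp: f'_def)
    note S'' = S'[folded f'_def]
    obtain k where la: "last_allowed r f' ?K (last_name es) (Q - 1) k" using search[OF S'' H] by blast
    have k1: "1 \<le> k" by (rule k1pos[OF la])
    have out: "rect_out r g strict f K es P Q (insert k ?K) (put_entry r es (f' (block_start ?K k)) (f' (Suc k)))"
      by (rule rect_out.head[OF head f'_def[THEN meta_eq_to_obj_eq] refl la])
    have rn: "last (chain_entries g es) \<le> k \<and> (f' (block_start ?K k) \<le> r \<longrightarrow> last (chain_entries g es) < k)"
      if "es \<noteq> []" "rowinv r f K (snd (last es)) (last (chain_entries g es)) \<kappa>" "\<kappa> < P" for \<kappa>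
    proof -
      have ne: "es \<noteq> []" by (rule that(1))
      obtain es0 e g0 where es: "es = es0 @ [(e, g0)]" using snoc_pair[OF ne] by blast
      have fs: "f (sigma K (last (chain_entries g es))) = snd (last es)" using row_state_last[of r g f K es0 e g0] S es by simp
      have big: "r < snd (last es)" using D(6) es by (simp add: chain_ok_snoc)
      have nm: "last_name es = {snd (last es)}" using that(1) by (simp add: last_name_def)
      show ?thesis
        using row_next_cut[OF D(2,3,5) that(2,3) c head _ fs big] la unfolding f'_def nm by auto
    qed
    show thesis
    proof (cases "f' (block_start ?K k) \<le> r")
      case True
      note sf = search_first[OF S'' H la True k1]
      have u: "put_entry r es (f' (block_start ?K k)) (f' (Suc k)) = es @ [(f' (block_start ?K k), f' (Suc k))]"
        using True by (simp add: put_entry_def)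
      have R1: "row_state r g f' (insert k ?K) (put_entry r es (f' (block_start ?K k)) (f' (Suc k)))"
        "chain_entries g (put_entry r es (f' (block_start ?K k)) (f' (Suc k))) = chain_entries g es @ [k]"
        unfolding u by (rule sf(1), rule sf(2))
      have R3: "rowinv r f' (insert k ?K) (snd (last (put_entry r es (f' (block_start ?K k)) (f' (Suc k))))) k P"
        unfolding u using sf(4) by simp
      have "colinv r f' (insert k ?K) (fst (last (put_entry r es (f' (block_start ?K k)) (f' (Suc k))))) k {..<P}"
        unfolding u using sf(5) by simp
      then have c2: "block_start K Q = P \<and> insert k ?K = insert k ?K \<and> k < P \<and> (\<forall>p. k < p \<longrightarrow> p \<le> P \<longrightarrow> r < f' p) \<and>
        colinv r f' (insert k ?K) (fst (last (put_entry r es (f' (block_start ?K k)) (f' (Suc k))))) k {..<P}"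
        using head sf(3,6) by blast
      show thesis
        by (rule that[OF out R1 R3]) (rule disjI2, rule disjI1, rule c2, use rn True in blast)
    next
      case False
      then have F: "r < f' (block_start ?K k)" by simp
      obtain es0 e g0 where sc: "es = es0 @ [(e, g0)]" "g0 = f' (block_start ?K k)" "last (chain_entries g es) = k" "k < P"
        "row_state r g f' (insert k ?K) (es0 @ [(e, f' (Suc k)), (e, g0)])"
        "chain_entries g (es0 @ [(e, f' (Suc k)), (e, g0)]) = chain_entries g es @ [rho (insert k ?K) (block_start ?K k)]"
        "rowinv r f' (insert k ?K) g0 (rho (insert k ?K) (block_start ?K k)) P"
        "k < rho (insert k ?K) (block_start ?K k)" "bcover r (chain_line es0 g) k (inv (chain_line es0 g) g0)"
        "k < rho ?K (Suc k)" "rho ?K (Suc k) < inv (chain_line es0 g) g0" "chain_line es0 g (rho ?K (Suc k)) = f' (Suc k)" "g0 < f' (Suc k)"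
        by (rule search_second[OF S'' H la F k1])
      have u: "put_entry r es (f' (block_start ?K k)) (f' (Suc k)) = es0 @ [(e, f' (Suc k)), (e, g0)]"
        using False sc(1) by (simp add: put_entry_def)
      have ok: "chain_ok r g es0" "r < g0" using D(6) sc(1) by (auto simp: chain_ok_snoc)
      have "chain_line es0 g (inv (chain_line es0 g) g0) = g0" using fin_perm_chain_line[OF D(1) ok(1)] by (simp add: f_inv_fin_perm)
      then have ns: "\<not> big_sorted r (chain_line (butlast es) g)"
        unfolding big_sorted_def sc(1) butlast_snoc using sc(11,12,13) ok(2) by (metis less_asym order_less_trans)
      let ?E = "rho (insert k ?K) (block_start ?K k)"
      have R1: "row_state r g f' (insert k ?K) (put_entry r es (f' (block_start ?K k)) (f' (Suc k)))"
        "chain_entries g (put_entry r es (f' (block_start ?K k)) (f' (Suc k))) = chain_entries g es @ [?E]"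
        unfolding u by (rule sc(5), rule sc(6))
      have R3: "rowinv r f' (insert k ?K) (snd (last (put_entry r es (f' (block_start ?K k)) (f' (Suc k))))) ?E P"
        unfolding u using sc(7) by simp
      have c3: "block_start K Q = P \<and> es \<noteq> [] \<and> last (chain_entries g es) < P \<and> \<not> big_sorted r (chain_line (butlast es) g)"
        using head sc(1,3,4) ns by blast
      have l: "last (chain_entries g es) < ?E" using sc(3,8) by simp
      show thesis
        by (rule that[OF out R1 R3]) (rule disjI2, rule disjI2, rule disjI1, rule c3, rule l)
    qed
  next
    case col
    let ?E = "last (chain_entries g es)"
    have h: "es \<noteq> []" "?E \<in> K" "block_start K ?E = P" "f P = fst (last es)" using H col by auto
    obtain es0 e g0 where es: "es = es0 @ [(e, g0)]" using snoc_pair[OF h(1)] by blast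
    have fe: "f P = e" using h es by simp
    note cs = column_row_state[OF S[unfolded es] c col(1) n refl, folded es, OF h(2,3) fe, folded f'_def]
    let ?K = "K - {?E}" let ?es = "es0 @ [(e, f Q)]"
    have H: "P - 1 \<notin> ?K" "r < f' P" "P \<le> ?E" "\<forall>j. P \<le> j \<longrightarrow> j < ?E \<longrightarrow> j \<in> ?K"
      using block_start_pred[of K ?E] h(3) block_start_mem[of K ?E] PQ cs(4) by (auto simp: f'_def)
    obtain k where la: "last_allowed r f' ?K (last_name ?es) ?E k" using search[OF cs(1) H] by blast
    have k1: "1 \<le> k" by (rule k1pos[OF la])
    have hd: "P = 0 \<or> P - 1 \<notin> ?K" using H(1) by simp
    note D' = row_stateD[OF cs(1)]
    have kP: "k < P" by (rule zone(1)[OF D'(2,3,5) hd H(2,3,4) la])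
    \<comment> \<open>The second strand of the changed last box is \<open>f Q\<close>, which after
      the swap sits at \<open>P\<close>. The search ends to the left of \<open>P\<close>, so it
      cannot meet this strand as a head.\<close>
    have first: "f' (block_start ?K k) \<le> r"
    proof (rule ccontr)
      assume "\<not> f' (block_start ?K k) \<le> r"
      then have "f' (block_start ?K k) = f Q" using la by (auto simp: last_allowed_def allowed_def last_name_def)
      then have "f' (block_start ?K k) = f' P" by (simp add: f'_def)
      then have "block_start ?K k = P" using fin_perm_eq_iff[OF D'(2)] by blast
      then show False using block_start_le[of ?K k] kP by simp
    qed
    note sf = search_first[OF cs(1) H la first k1]
    have es': "butlast es @ [(f P, f Q)] = ?es" using es fe by simp
    have u: "put_entry r ?es (f' (block_start ?K k)) (f' (Suc k)) = ?es @ [(f' (block_start ?K k), f' (Suc k))]"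
      using first by (simp add: put_entry_def)
    have out: "rect_out r g strict f K es P Q (insert k ?K) (put_entry r ?es (f' (block_start ?K k)) (f' (Suc k)))"
      by (rule rect_out.column[where strict=strict, OF col h(1) h(4)[symmetric] h(2,3) _ f'_def[THEN meta_eq_to_obj_eq] refl es'[symmetric] la])
        (use cs(3) es in simp)
    have R1: "row_state r g f' (insert k ?K) (put_entry r ?es (f' (block_start ?K k)) (f' (Suc k)))"
      "chain_entries g (put_entry r ?es (f' (block_start ?K k)) (f' (Suc k))) = chain_entries g es @ [k]"
      unfolding u using sf(1,2) cs(2) by auto
    have R3: "rowinv r f' (insert k ?K) (snd (last (put_entry r ?es (f' (block_start ?K k)) (f' (Suc k))))) k P"
      unfolding u using sf(4) by simp
    have "colinv r f' (insert k ?K) (fst (last (put_entry r ?es (f' (block_start ?K k)) (f' (Suc k))))) k {..<P}"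
      unfolding u using sf(5) by simp
    then have c4: "block_start K Q \<noteq> P \<and> \<not> strict (chain_entries g es @ [rho K P]) \<and> k < P \<and> P \<le> last (chain_entries g es) \<and>
      colinv r f' (insert k ?K) (fst (last (put_entry r ?es (f' (block_start ?K k)) (f' (Suc k))))) k {..<P}"
      using col kP cs(4) by blast
    show thesis
      by (rule that[OF out R1 R3]) (rule disjI2, rule disjI2, rule disjI2, rule c4, use col(1) in blast)
  qed
qed

definition rect_case where
  "rect_case r g strict f K es P Q f' K' es' E \<longleftrightarrow>
    (block_start K Q \<noteq> P \<and> strict (chain_entries g es @ [rho K P]) \<and> E = rho K P \<and> K' = K \<and> colinv r f' K' (fst (last es')) E {..<P}) \<or>
    (block_start K Q = P \<and> K' = insert E (K - {Q - 1}) \<and> E < P \<and> (\<forall>p. E < p \<longrightarrow> p \<le> P \<longrightarrow> r < f' p) \<and>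
       colinv r f' K' (fst (last es')) E {..<P}) \<or>
    (block_start K Q = P \<and> es \<noteq> [] \<and> last (chain_entries g es) < P \<and> \<not> big_sorted r (chain_line (butlast es) g)) \<or>
    (block_start K Q \<noteq> P \<and> \<not> strict (chain_entries g es @ [rho K P]) \<and> E < P \<and> P \<le> last (chain_entries g es) \<and> colinv r f' K' (fst (last es')) E {..<P})"

lemma rect_outcome:
  assumes S: "row_state r g f K es" and c: "bcover r f P Q" and n: "ninv (f \<circ> transpose P Q) = Suc (ninv f)"
    and f1: "(f \<circ> transpose P Q) 1 \<le> r"
    and H: "block_start K Q = P \<or> strict (chain_entries g es @ [rho K P]) \<or>
      (es \<noteq> [] \<and> last (chain_entries g es) \<in> K \<and> block_start K (last (chain_entries g es)) = P \<and> f P = fst (last es))"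
  shows "\<exists>K' es' E. rect_out r g strict f K es P Q K' es' \<and> row_state r g (f \<circ> transpose P Q) K' es' \<and>
    chain_entries g es' = chain_entries g es @ [E] \<and> rowinv r (f \<circ> transpose P Q) K' (snd (last es')) E P \<and>
    rect_case r g strict f K es P Q (f \<circ> transpose P Q) K' es' E \<and>
    (\<forall>\<kappa>. block_start K Q = P \<longrightarrow> es \<noteq> [] \<longrightarrow> rowinv r f K (snd (last es)) (last (chain_entries g es)) \<kappa> \<longrightarrow> \<kappa> < P \<longrightarrow> last (chain_entries g es) < E)"
proof (rule rect_outcome_raw[where strict = strict, OF S c n f1 H], goal_cases)
  case (1 K' es' E)
  show ?case
    by (intro exI[of _ K'] exI[of _ es'] exI[of _ E] conjI 1(1-4) allI impI 1(6))
      (use 1(5) in \<open>simp only: rect_case_def\<close>)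
qed

section \<open>The numbering of the boxes and strict fillings\<close>

definition before :: "nat \<times> nat \<Rightarrow> nat \<times> nat \<Rightarrow> bool" where
  "before x y \<longleftrightarrow> fst y < fst x \<or> (fst x = fst y \<and> snd x < snd y)"

lemma set_boxes: "set (boxes sh) = {(p, q). 1 \<le> p \<and> p \<le> length sh \<and> 1 \<le> q \<and> q \<le> sh ! (p - 1)}"
  unfolding boxes_def by (auto simp: Suc_le_eq less_Suc_eq_le image_iff simp del: upt_Suc)

lemma sorted_boxes: "sorted_wrt before (boxes sh)"
proof -
  have gen: "sorted_wrt before (concat (map (\<lambda>i. map (\<lambda>j. (i, j)) [1..<h i]) ys))"
    if "sorted_wrt (>) ys" for ys :: "nat list" and h :: "nat \<Rightarrow> nat"
    using that
  proof (induction ys)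
    case (Cons y ys)
    have "sorted_wrt before (map (\<lambda>j. (y, j)) [1..<h y])"
      by (simp add: sorted_wrt_map before_def)
    then show ?case using Cons by (simp add: sorted_wrt_append) (auto simp: before_def)
  qed simp
  have "sorted_wrt (>) (rev [1..<length sh + 1])" by (simp add: sorted_wrt_rev del: upt_Suc)
  then show ?thesis unfolding boxes_def by (rule gen)
qed

lemma boxes_before: "i < j \<Longrightarrow> j < length (boxes sh) \<Longrightarrow> before (boxes sh ! i) (boxes sh ! j)"
  using sorted_boxes[of sh] by (simp add: sorted_wrt_iff_nth_less)

lemma boxes_before_iff:
  "i < length (boxes sh) \<Longrightarrow> j < length (boxes sh) \<Longrightarrow> before (boxes sh ! i) (boxes sh ! j) \<longleftrightarrow> i < j"
  using boxes_before[of i j sh] boxes_before[of j i sh]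
  by (metis before_def linorder_neqE_nat not_less_iff_gr_or_eq)

lemma distinct_boxes: "distinct (boxes sh)"
  using boxes_before[of _ _ sh] unfolding distinct_conv_nth before_def
  by (metis linorder_neqE_nat not_less_iff_gr_or_eq)

lemma boxes_index:
  assumes "i < length (boxes sh)" "x \<in> set (boxes sh)" "before x (boxes sh ! i)"
  obtains j where "j < i" "boxes sh ! j = x"
  using assms by (metis boxes_before_iff in_set_conv_nth)

lemma boxes_left:
  assumes i: "i < length (boxes sh)" "boxes sh ! i = (p, q)" "1 < q"
  shows "0 < i" "boxes sh ! (i - 1) = (p, q - 1)"
proof -
  have m: "(p, q) \<in> set (boxes sh)" using i by (metis nth_mem)
  then have "(p, q - 1) \<in> set (boxes sh)" using i(3) by (auto simp: set_boxes)
  then obtain j where j: "j < i" "boxes sh ! j = (p, q - 1)"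
    using boxes_index[OF i(1), of "(p, q - 1)"] i by (auto simp: before_def)
  show "0 < i" using j by simp
  have "j = i - 1"
  proof (rule ccontr)
    assume "j \<noteq> i - 1"
    then have "j < i - 1" using j by simp
    then have "before (boxes sh ! j) (boxes sh ! (i - 1))" "before (boxes sh ! (i - 1)) (boxes sh ! i)"
      using boxes_before[of j "i - 1" sh] boxes_before[of "i - 1" i sh] i by auto
    then show False using j i by (auto simp: before_def)
  qed
  then show "boxes sh ! (i - 1) = (p, q - 1)" using j by simp
qed

definition decreasing :: "nat list \<Rightarrow> bool" where "decreasing sh \<longleftrightarrow> sorted_wrt (\<ge>) sh"

lemma decreasing_nth: "decreasing sh \<Longrightarrow> i \<le> j \<Longrightarrow> j < length sh \<Longrightarrow> sh ! j \<le> sh ! i"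
  unfolding decreasing_def by (cases "i = j") (auto simp: sorted_wrt_iff_nth_less)

lemma decreasing_boxes:
  assumes "decreasing sh" "(p, q) \<in> set (boxes sh)" "1 \<le> p'" "p' \<le> p"
  shows "(p', q) \<in> set (boxes sh)"
  using assms decreasing_nth[of sh "p' - 1" "p - 1"] by (fastforce simp: set_boxes)

lemma boxes_first:
  assumes pt: "decreasing sh" and i: "i < length (boxes sh)" "boxes sh ! i = (p, 1)" "0 < i"
  shows "fst (boxes sh ! (i - 1)) = Suc p"
proof -
  obtain p' q' where b: "boxes sh ! (i - 1) = (p', q')" by fastforce
  have m: "(p', q') \<in> set (boxes sh)" using b i by (metis less_imp_diff_less nth_mem)
  have bf: "before (p', q') (p, 1)" using boxes_before[of "i - 1" i sh] i b by simp
  have q': "1 \<le> q'" "1 \<le> p'" using m by (auto simp: set_boxes)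
  then have pp: "p < p'" using bf by (auto simp: before_def)
  show ?thesis
  proof (rule ccontr)
    assume "\<not> ?thesis"
    then have lt: "Suc p < p'" using pp b by auto
    have "(p', 1) \<in> set (boxes sh)" using m by (auto simp: set_boxes)
    then have "(Suc p, 1) \<in> set (boxes sh)" using decreasing_boxes[OF pt, of p' 1 "Suc p"] lt by auto
    then obtain j where j: "j < i" "boxes sh ! j = (Suc p, 1)"
      using boxes_index[OF i(1), of "(Suc p, 1)"] i by (auto simp: before_def)
    have "j \<noteq> i - 1" using j b lt by auto
    then have "j < i - 1" using j by simp
    then have "before (boxes sh ! j) (boxes sh ! (i - 1))" using boxes_before[of j "i - 1" sh] i by simp
    then show False using j b lt by (auto simp: before_def)
  qed
qed

text \<open>Row and column strictness together, in terms of box numbers. Within a row of boxes the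
  smaller number is on the left, within a column it is below; hence the two inequalities point in
  opposite directions.\<close>

definition strictE :: "nat list \<Rightarrow> nat list \<Rightarrow> bool" where
  "strictE sh E \<longleftrightarrow> (\<forall>k<length E. \<forall>k'<k.
     (fst (boxes sh ! k') = fst (boxes sh ! k) \<longrightarrow> E ! k' < E ! k) \<and>
     (snd (boxes sh ! k') = snd (boxes sh ! k) \<longrightarrow> E ! k < E ! k'))"

lemma strictE_Nil [simp]: "strictE sh []" by (simp add: strictE_def)

text \<open>The left neighbour of the new box is the box filled just before, and the neighbour below
  is already filled because a diagram has no gaps in its columns. All other comparisons follow from
  these two by transitivity.\<close>

lemma strictE_snoc:
  assumes pt: "decreasing sh" and st: "strictE sh E" and i: "length E < length (boxes sh)" "boxes sh ! length E = (p, q)"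
    and left: "1 < q \<Longrightarrow> last E < e" and below: "\<And>s. s < length E \<Longrightarrow> boxes sh ! s = (Suc p, q) \<Longrightarrow> e < E ! s"
  shows "strictE sh (E @ [e])"
  unfolding strictE_def
proof (intro allI impI)
  fix k k' assume k: "k < length (E @ [e])" "k' < k"
  let ?b = "boxes sh" let ?i = "length E"
  show "(fst (?b ! k') = fst (?b ! k) \<longrightarrow> (E @ [e]) ! k' < (E @ [e]) ! k) \<and>
     (snd (?b ! k') = snd (?b ! k) \<longrightarrow> (E @ [e]) ! k < (E @ [e]) ! k')"
  proof (cases "k < ?i")
    case True then show ?thesis using st k by (auto simp: strictE_def nth_append)
  next
    case False
    then have ki: "k = ?i" using k by simp
    obtain p' q' where b': "?b ! k' = (p', q')" by fastforce
    have bf: "before (p', q') (p, q)" using boxes_before[of k' k sh] k ki i b' by simp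
    have m': "(p', q') \<in> set ?b" using b' k ki i by (metis nth_mem order_less_trans)
    have m: "(p, q) \<in> set ?b" using i by (metis nth_mem)
    have pq: "1 \<le> q'" "1 \<le> q" "1 \<le> p" using m m' by (simp_all add: set_boxes)
    note st' = st[unfolded strictE_def, rule_format]
    have "E ! k' < e" if "p' = p"
    proof -
      have q1: "1 < q" using bf that pq by (auto simp: before_def)
      have L: "0 < ?i" "?b ! (?i - 1) = (p, q - 1)" using boxes_left[OF i q1] by auto
      have le: "last E = E ! (?i - 1)" using L by (metis last_conv_nth length_greater_0_conv)
      show ?thesis
      proof (cases "k' = ?i - 1")
        case True then show ?thesis using left[OF q1] le by simp
      next
        case F: False
        then have "E ! k' < E ! (?i - 1)"
          using conjunct1[OF st'[of "?i - 1" k']] k ki L b' that by simp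
        then show ?thesis using left[OF q1] le by simp
      qed
    qed
    moreover have "e < E ! k'" if "q' = q"
    proof -
      have pp: "p < p'" using bf that by (auto simp: before_def)
      then have "(Suc p, q) \<in> set ?b" using decreasing_boxes[OF pt, of p' q "Suc p"] m' that pp pq by simp
      then obtain s where s: "s < ?i" "?b ! s = (Suc p, q)"
        using boxes_index[OF i(1), of "(Suc p, q)"] i by (auto simp: before_def)
      show ?thesis
      proof (cases "k' = s")
        case True then show ?thesis using below s by simp
      next
        case F: False
        have "p' \<noteq> Suc p" 
          using F s b' that distinct_boxes[of sh] i k ki by (metis nth_eq_iff_index_eq order_less_trans)
        then have "before (?b ! k') (?b ! s)" using b' s pp by (auto simp: before_def)
        then have "k' < s" using boxes_before_iff[of k' sh s] s i k ki by simp
        then have "E ! s < E ! k'" using conjunct2[OF st'[of s k']] s b' that by simp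
        then show ?thesis using below[OF s] by simp
      qed
    qed
    ultimately show ?thesis using ki b' i k by (auto simp: nth_append)
  qed
qed

section \<open>Invariants of a row pass\<close>

text \<open>
  The semi-shuffle case compares the entry \<open>e\<close> of a box with the later entry of the box above it. Here \<open>U\<close>
  contains the positions up to the one at which the box was rectified (all positions if it was inserted), and
  the row of boxes above has only changed positions up to \<open>F\<close>. The strands \<open>> r\<close> in \<open>U\<close> stop every strand \<open>\<le> r\<close>
  coming from the left at \<open>e + 1\<close>, and at \<open>e\<close> itself the label \<open>e \<in> K\<close> pushes the new entry below \<open>e\<close>.
\<close>

definition big_above :: "nat \<Rightarrow> (nat \<Rightarrow> nat) \<Rightarrow> nat set \<Rightarrow> nat \<Rightarrow> nat \<Rightarrow> nat set \<Rightarrow> bool" where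
  "big_above r f K F e U \<longleftrightarrow> (\<exists>h\<in>U. (h = Suc e \<and> e \<in> K \<or> h = e \<and> U = {..e}) \<and> (\<forall>p\<in>U. h \<le> p \<longrightarrow> F < p \<longrightarrow> r < f p))"

definition old_bound :: "nat list \<Rightarrow> (nat \<times> nat) set \<Rightarrow> (nat \<Rightarrow> nat) \<Rightarrow> nat \<Rightarrow> nat set" where
  "old_bound lam Mu Ps s = (if boxes lam ! s \<in> Mu then {..Ps s} else UNIV)"

text \<open>Only the last box is remembered. If it was rectified, at \<open>Ps (i - 1)\<close>, the
  box above it in the first column is rectified at a smaller position, hence the set
  \<open>{..<Ps (i - 1)}\<close>. After an insertion there is no such bound, hence
  \<open>UNIV\<close>.\<close>

definition hook_inv where
  "hook_inv r g lam Mu Ps f K es i \<longleftrightarrow> (0 < i \<longrightarrow>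
     (if boxes lam ! (i - 1) \<in> Mu
      then snd (boxes lam ! (i - 1)) = 1 \<longrightarrow> colinv r f K (fst (last es)) (last (chain_entries g es)) {..<Ps (i - 1)}
      else colinv r f K (fst (last es)) (last (chain_entries g es)) UNIV))"

text \<open>The first record concerns the current row of boxes and serves when the row above it is
  filled. The second concerns the boxes of the row below to the right of the last filled column,
  which are still to be compared. A strand \<open><= r\<close> moved to a position up to
  \<open>F\<close> does no harm to them, since the current row continues at \<open>F\<close> or
  later.\<close>

definition semi_inv where
  "semi_inv r g lam Mu Ps f K es i \<longleftrightarrow> big_sorted r g \<and> big_sorted r f \<and> (0 < i \<longrightarrow>
     (\<forall>s<i. fst (boxes lam ! s) = fst (boxes lam ! (i - 1)) \<longrightarrow> big_above r f K 0 (chain_entries g es ! s) (old_bound lam Mu Ps s)) \<and>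
     (boxes lam ! (i - 1) \<in> Mu \<longrightarrow> (\<exists>F. (\<forall>P2 Q2. Ps (i - 1) < P2 \<longrightarrow> bcover r f P2 Q2 \<longrightarrow> F \<le> P2) \<and>
        (\<forall>s<i. fst (boxes lam ! s) = Suc (fst (boxes lam ! (i - 1))) \<longrightarrow> snd (boxes lam ! (i - 1)) < snd (boxes lam ! s) \<longrightarrow>
           big_above r f K F (chain_entries g es ! s) (old_bound lam Mu Ps s) \<and> F \<le> chain_entries g es ! s))))"

definition pass_inv where
  "pass_inv r g lam Mu Ps f K es i \<longleftrightarrow> row_state r g f K es \<and> length es = i \<and> strictE lam (chain_entries g es) \<and>
     (0 < i \<longrightarrow> boxes lam ! (i - 1) \<in> Mu \<longrightarrow> rowinv r f K (snd (last es)) (last (chain_entries g es)) (Ps (i - 1))) \<and>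
     (is_hook lam \<and> hook_inv r g lam Mu Ps f K es i \<or> semi_inv r g lam Mu Ps f K es i)"

text \<open>What a row pass inherits from the previous one: \<open>Mu\<close> is the set of boxes of
  the smaller diagram, and \<open>Ps s\<close> is the old entry of \<open>E\<close> for box
  \<open>s\<close>, the position at which this box is rectified. The fourth clause says that the new
  boxes form a horizontal strip.\<close>

definition pass_setup where
  "pass_setup lam Mu Ps \<longleftrightarrow> decreasing lam \<and> Mu \<subseteq> set (boxes lam) \<and>
     (\<forall>p q q'. (p, q) \<in> Mu \<longrightarrow> 1 \<le> q' \<longrightarrow> q' \<le> q \<longrightarrow> (p, q') \<in> Mu) \<and>
     (\<forall>p q. (p, q) \<in> set (boxes lam) - Mu \<longrightarrow> (Suc p, q) \<notin> set (boxes lam)) \<and>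
     (\<forall>t<length (boxes lam). \<forall>s<t. boxes lam ! s \<in> Mu \<longrightarrow> boxes lam ! t \<in> Mu \<longrightarrow>
        (fst (boxes lam ! s) = fst (boxes lam ! t) \<longrightarrow> Ps s < Ps t) \<and>
        (snd (boxes lam ! s) = snd (boxes lam ! t) \<longrightarrow> Ps t < Ps s))"

lemma pass_setup_same:
  assumes "pass_setup lam Mu Ps" "t < length (boxes lam)" "s < t" "boxes lam ! s \<in> Mu" "boxes lam ! t \<in> Mu"
  shows "fst (boxes lam ! s) = fst (boxes lam ! t) \<Longrightarrow> Ps s < Ps t"
    "snd (boxes lam ! s) = snd (boxes lam ! t) \<Longrightarrow> Ps t < Ps s"
  using assms unfolding pass_setup_def by blast+

lemma pass_inv_start:
  assumes "row_state r g f K []" "is_hook lam \<or> big_sorted r g \<and> big_sorted r f"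
  shows "pass_inv r g lam Mu Ps f K [] 0"
  using assms by (auto simp: pass_inv_def hook_inv_def semi_inv_def)

lemma semi_chain_line:
  assumes "fin_perm g" "big_sorted r g"
  shows "chain_ok r g es \<Longrightarrow> big_sorted r (chain_line es g)"
proof (induction es rule: rev_induct)
  case (snoc x xs)
  obtain a b where x: "x = (a, b)" by fastforce
  have ok: "chain_ok r g (xs @ [(a, b)])" using snoc x by simp
  then have ok': "chain_ok r g xs" by (simp add: chain_ok_snoc)
  show ?case unfolding x chain_bcover(4)[OF assms(1) ok]
    by (rule semi_swap[OF fin_perm_chain_line[OF assms(1) ok'] snoc.IH[OF ok'] chain_bcover(1)[OF assms(1) ok]])
qed (use assms in simp)

text \<open>The witness \<open>h\<close> is a position to the right of \<open>P\<close> with a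
  strand \<open>> r\<close>, and by \<open>semi_cover_small\<close> the strand of \<open>P\<close>
  is swapped there at the latest. The assumptions on \<open>F\<close> deal with the boundary case
  \<open>P = F\<close>, in which \<open>P\<close> is still permitted to carry a strand
  \<open><= r\<close>.\<close>

lemma big_above_fit:
  assumes i: "big_above r f K F e U" and U: "Suc P \<in> U" "P \<in> U" and F: "F \<le> P" "F \<le> e \<or> F < P"
    and f: "fin_perm f" "big_sorted r f" and c: "bcover r f P Q"
  shows "P \<le> e" "P = e \<Longrightarrow> e \<in> K" "Q \<le> Suc e"
proof -
  obtain h where h: "h \<in> U" "h = Suc e \<and> e \<in> K \<or> h = e \<and> U = {..e}" "\<forall>p\<in>U. h \<le> p \<longrightarrow> F < p \<longrightarrow> r < f p"
    using i unfolding big_above_def by auto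
  have PQ: "1 \<le> P" "P < Q" "f P \<le> r" "r < f Q" using c by (auto simp: bcover_def)
  have Ph: "P < h"
  proof (rule ccontr)
    assume "\<not> P < h"
    then have "\<not> F < P" using h(3) U PQ by force
    then have "P = F" "F \<le> e" using F by auto
    then have "h = e" "U = {..e}" "e = P" using h(2) \<open>\<not> P < h\<close> by auto
    then show False using U by auto
  qed
  then show "P \<le> e" using h(2) by auto
  show "P = e \<Longrightarrow> e \<in> K" using h(2) Ph by auto
  have "r < f h" using h Ph F by auto
  then have "\<not> h < Q" using semi_cover_small(1)[OF f c Ph] by force
  then show "Q \<le> Suc e" using h(2) by auto
qed

lemma big_above_keep_row:
  assumes "big_above r f K 0 e {..u}" "u < P" "P < Q" "K - {P} \<subseteq> K'"
  shows "big_above r (f \<circ> transpose P Q) K' 0 e {..u}"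
proof -
  obtain h where h: "h \<le> u" "h = Suc e \<and> e \<in> K \<or> h = e \<and> {..u} = {..e}" "\<forall>p\<in>{..u}. h \<le> p \<longrightarrow> 0 < p \<longrightarrow> r < f p"
    using assms(1) unfolding big_above_def by auto
  have "h = Suc e \<and> e \<in> K' \<or> h = e \<and> {..u} = {..e}" using h assms by auto
  moreover have "\<forall>p\<in>{..u}. h \<le> p \<longrightarrow> 0 < p \<longrightarrow> r < (f \<circ> transpose P Q) p"
    using h(3) assms(2,3) by (auto simp: transpose_def)
  ultimately show ?thesis using h(1) unfolding big_above_def by (intro bexI[of _ h] conjI; simp)
qed

lemma big_above_mono:
  assumes "big_above r f K F e U" "K \<subseteq> K'"
  shows "big_above r f K' F e U"
proof -
  obtain h where h: "h \<in> U" "h = Suc e \<and> e \<in> K \<or> h = e \<and> U = {..e}" "\<forall>p\<in>U. h \<le> p \<longrightarrow> F < p \<longrightarrow> r < f p"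
    using assms(1) unfolding big_above_def by auto
  then have "h = Suc e \<and> e \<in> K' \<or> h = e \<and> U = {..e}" using assms(2) by auto
  then show ?thesis using h(1,3) unfolding big_above_def by (intro bexI[of _ h]) auto
qed

lemma big_above_keep_below:
  assumes "big_above r f K F e U" "F \<le> Q" "P < Q" "e \<noteq> P" "K - {P} \<subseteq> K'"
  shows "big_above r (f \<circ> transpose P Q) K' Q e U"
proof -
  obtain h where h: "h \<in> U" "h = Suc e \<and> e \<in> K \<or> h = e \<and> U = {..e}" "\<forall>p\<in>U. h \<le> p \<longrightarrow> F < p \<longrightarrow> r < f p"
    using assms(1) unfolding big_above_def by auto
  have "h = Suc e \<and> e \<in> K' \<or> h = e \<and> U = {..e}" using h assms by auto
  moreover have "\<forall>p\<in>U. h \<le> p \<longrightarrow> Q < p \<longrightarrow> r < (f \<circ> transpose P Q) p"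
    using h(3) assms(2,3) by (auto simp: transpose_def)
  ultimately show ?thesis using h(1) unfolding big_above_def by (intro bexI[of _ h] conjI; simp)
qed

text \<open>The position \<open>X\<close> is where the last swap put its small strand. It lies to
  the right of the last entry, and this is what makes a following insertion produce a larger
  entry.\<close>

lemma last_chain_entries_props:
  assumes S: "row_state r g f K es" and ne: "es \<noteq> []"
  shows "f (sigma K (last (chain_entries g es))) = snd (last es)" "r < snd (last es)"
    "\<exists>X. last (chain_entries g es) < X \<and> f (sigma K X) \<le> r"
proof -
  note D = row_stateD[OF S]
  obtain es0 e g0 where es: "es = es0 @ [(e, g0)]" using snoc_pair[OF ne] by blast
  show "f (sigma K (last (chain_entries g es))) = snd (last es)" using row_state_last[of r g f K es0 e g0] S es by simp
  have ok: "chain_ok r g (es0 @ [(e, g0)])" using D(6) es by simp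
  then show "r < snd (last es)" using es by (simp add: chain_ok_snoc)
  note cb = chain_bcover[OF D(1) ok]
  have E: "last (chain_entries g es) = inv (chain_line es0 g) e" using cb(5) es by (simp add: chain_entries_snoc)
  let ?X = "inv (chain_line es0 g) g0"
  have "f (sigma K ?X) = e" unfolding D(8) es cb(4) using cb(2) by simp
  moreover have "inv (chain_line es0 g) e < ?X" using cb(1) by (auto simp: bcover_def)
  moreover have "e \<le> r" using ok by (simp add: chain_ok_snoc)
  ultimately show "\<exists>X. last (chain_entries g es) < X \<and> f (sigma K X) \<le> r" unfolding E by auto
qed

definition ins_at where
  "ins_at r f K k \<longleftrightarrow> allowed r f K {} k \<and> (\<forall>k'. allowed r f K {} k' \<longrightarrow> k' \<le> k)"

text \<open>The search from far right finds a label, and \<open>zone\<close> shows that all strands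
  beyond it are \<open>> r\<close>. Therefore no head beyond it is \<open><= r\<close>, and the
  label found is the rightmost allowed one.\<close>

lemma ins_exists:
  assumes S: "row_state r g f K es" and f1: "f 1 \<le> r"
  obtains k where "ins_at r f K k" "1 \<le> k" "\<And>p. k < p \<Longrightarrow> r < f p"
proof -
  note D = row_stateD[OF S]
  obtain n where n: "\<forall>k>n. f k = k" using D(2) by (auto simp: fin_perm_def)
  obtain m where m: "\<forall>k\<in>K. k < m" using D(3) finite_nat_set_iff_bounded by auto
  \<comment> \<open>A position beyond the support of \<open>f\<close>, beyond all labels and beyond
    \<open>r\<close>: from there on the line is the identity with strands
    \<open>> r\<close>.\<close>
  define H where "H = n + m + r + 2"
  have H: "H = 0 \<or> H - 1 \<notin> K" "r < f H" "H \<le> H" "\<forall>j. H \<le> j \<longrightarrow> j < H \<longrightarrow> j \<in> K"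
    using n m unfolding H_def by force+
  have big: "r < f p" "f p = p" if "H \<le> p" for p using that n unfolding H_def by auto
  obtain k0 where "k0 < H" "allowed r f K {} k0" using allowed_ex[OF D(2,5) H(1,2)] by blast
  then obtain k where la: "last_allowed r f K {} H k" using last_allowed_ex by blast
  have z: "r < f p" if "k < p" for p
    using zone(3)[OF D(2,3,5) H la that] big(1)[of p] by (cases "p \<le> H") auto
  have kp: "1 \<le> k"
  proof (rule ccontr)
    assume "\<not> 1 \<le> k" then have "k = 0" by simp
    then show False using la f1 by (auto simp: last_allowed_def allowed_def)
  qed
  have "k' \<le> k" if a: "allowed r f K {} k'" for k'
  proof (rule ccontr)
    assume "\<not> k' \<le> k"
    then have kk: "k < k'" by simp
    have "k \<notin> K" using la by (auto simp: last_allowed_def allowed_def)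
    then have "k < block_start K k'" using block_start_mem[of K k' k] kk by force
    then have "r < f (block_start K k')" by (rule z)
    then show False using a by (auto simp: allowed_def)
  qed
  then have "ins_at r f K k" using la by (auto simp: ins_at_def last_allowed_def)
  then show thesis by (rule that[OF _ kp z])
qed

lemma hook_boxes:
  assumes "is_hook lam" "(p, q) \<in> set (boxes lam)" "2 \<le> p"
  shows "q = 1"
proof -
  define p' where "p' = p - 2"
  have p': "p = Suc (Suc p')" using assms(3) by (simp add: p'_def)
  have b: "Suc (Suc p') \<le> length lam" "1 \<le> q" "q \<le> lam ! Suc p'" using assms(2) p' by (simp_all add: set_boxes)
  have "p' < length (tl lam)" using b by simp
  then have "tl lam ! p' \<in> set (tl lam)" "tl lam ! p' = lam ! Suc p'" by (rule nth_mem, rule nth_tl)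
  then have "lam ! Suc p' \<le> 1" using assms(1) by (simp add: is_hook_def)
  then show ?thesis using b by simp
qed

text \<open>The small strand of the last entry leaves the row no further right than
  \<open>k\<close>, as all strands beyond \<open>k\<close> are \<open>> r\<close>; so
  \<open>k\<close> exceeds the last entry. Nothing has to be compared downwards, because an inserted
  box belongs to the horizontal strip and has no box beneath it.\<close>

lemma ins_step:
  assumes st: "pass_setup lam Mu Ps" and I: "pass_inv r g lam Mu Ps f K es i" and i: "i < length (boxes lam)"
    and nin: "boxes lam ! i \<notin> Mu" and f1: "f 1 \<le> r"
  obtains k where "ins_at r f K k" "pass_inv r g lam Mu Ps f (insert k K) (es @ [(f (block_start K k), f (Suc k))]) (Suc i)"
proof -
  have S: "row_state r g f K es" and len: "length es = i" and sE: "strictE lam (chain_entries g es)"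
    and mode: "is_hook lam \<and> hook_inv r g lam Mu Ps f K es i \<or> semi_inv r g lam Mu Ps f K es i"
    using I by (auto simp: pass_inv_def)
  note D = row_stateD[OF S]
  obtain k where k: "ins_at r f K k" "1 \<le> k" "\<And>p. k < p \<Longrightarrow> r < f p" using ins_exists[OF S f1] by blast
  have a: "k \<notin> K" "f (block_start K k) \<le> r" "r < f (Suc k)" using k(1) by (auto simp: ins_at_def allowed_def)
  let ?es = "es @ [(f (block_start K k), f (Suc k))]"
  note IS = insert_row_state[OF S a(1) k(2) a(2,3)]
  obtain p q where pq: "boxes lam ! i = (p, q)" by fastforce
  have m: "(p, q) \<in> set (boxes lam)" using pq i by (metis nth_mem)
  have left: "last (chain_entries g es) < k" if "es \<noteq> []"
  proof -
    have ne: "es \<noteq> []" by (rule that)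
    obtain X where X: "last (chain_entries g es) < X" "f (sigma K X) \<le> r" using last_chain_entries_props(3)[OF S ne] by blast
    have "X \<le> k"
    proof (rule ccontr)
      assume "\<not> X \<le> k"
      then have "k < X" by simp
      then have "k < sigma K X" using block_start_mem[of K X k] a(1) by (force simp: sigma_def)
      then show False using k(3) X by force
    qed
    then show ?thesis using X by simp
  qed
  have below: "(Suc p, q) \<notin> set (boxes lam)" using st m nin pq unfolding pass_setup_def by auto
  have sE': "strictE lam (chain_entries g es @ [k])"
  proof (rule strictE_snoc[OF _ sE])
    show "decreasing lam" using st by (simp add: pass_setup_def)
    show "length (chain_entries g es) < length (boxes lam)" "boxes lam ! length (chain_entries g es) = (p, q)" using i len pq by auto
    show "last (chain_entries g es) < k" if "1 < q"
    proof (rule left)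
      have "0 < i" using boxes_left(1)[OF i pq that] .
      then show "es \<noteq> []" using len by auto
    qed
    show "k < chain_entries g es ! s" if "s < length (chain_entries g es)" "boxes lam ! s = (Suc p, q)" for s
    proof -
      have "s < length (boxes lam)" using that len i by simp
      then show ?thesis using that(2) below by (metis nth_mem)
    qed
  qed
  have colU: "colinv r f (insert k K) (f (block_start K k)) k UNIV" by (rule merge_colinv) (use k(3) in auto)
  have mode': "is_hook lam \<and> hook_inv r g lam Mu Ps f (insert k K) ?es (Suc i) \<or> semi_inv r g lam Mu Ps f (insert k K) ?es (Suc i)"
    using mode
  proof
    assume "is_hook lam \<and> hook_inv r g lam Mu Ps f K es i"
    then show ?thesis using colU nin IS(2) by (auto simp: hook_inv_def)
  next
    assume sm: "semi_inv r g lam Mu Ps f K es i"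
    have "big_above r f (insert k K) 0 (chain_entries g ?es ! s) (old_bound lam Mu Ps s)"
      if s: "s < Suc i" "fst (boxes lam ! s) = fst (boxes lam ! i)" for s
    proof (cases "s = i")
      case True
      have "big_above r f (insert k K) 0 k UNIV" unfolding big_above_def using k(3) by (auto intro!: bexI[of _ "Suc k"])
      then show ?thesis using True nin IS(2) len by (simp add: old_bound_def nth_append)
    next
      case False
      then have si: "s < i" using s by simp
      have "fst (boxes lam ! (i - 1)) = p"
      proof (cases "1 < q")
        case True then show ?thesis using boxes_left(2)[OF i pq] by simp
      next
        case False
        have "before (boxes lam ! s) (boxes lam ! i)" using boxes_before[OF si i] .
        moreover have "1 \<le> snd (boxes lam ! s)" using si i nth_mem[of s "boxes lam"] by (auto simp: set_boxes)
        ultimately show ?thesis using s pq False by (auto simp: before_def)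
      qed
      then have "big_above r f K 0 (chain_entries g es ! s) (old_bound lam Mu Ps s)" using sm si s pq by (auto simp: semi_inv_def)
      then show ?thesis using IS(2) len si by (auto simp: nth_append intro: big_above_mono)
    qed
    then show ?thesis using sm nin by (auto simp: semi_inv_def)
  qed
  have "pass_inv r g lam Mu Ps f (insert k K) ?es (Suc i)"
    unfolding pass_inv_def using IS sE' mode' len nin by simp
  then show thesis by (rule that[OF k(1)])
qed

text \<open>Outside the first column a hook has no box below, so \<open>rowinv\<close> is enough. In
  the first column the box below is the preceding one, and \<open>col_next\<close> both provides the
  hypothesis of \<open>rect_outcome\<close> and bounds the new entry by the last one.\<close>

lemma rect_step_hook:
  assumes st: "pass_setup lam Mu Ps" and I: "pass_inv r g lam Mu Ps f K es i" and i: "i < length (boxes lam)"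
    and inn: "boxes lam ! i \<in> Mu" and c: "bcover r f (Ps i) Q"
    and n: "ninv (f \<circ> transpose (Ps i) Q) = Suc (ninv f)" and f1: "(f \<circ> transpose (Ps i) Q) 1 \<le> r"
    and hook: "is_hook lam" "hook_inv r g lam Mu Ps f K es i"
  obtains K' es' where "rect_out r g (strictE lam) f K es (Ps i) Q K' es'"
    "pass_inv r g lam Mu Ps (f \<circ> transpose (Ps i) Q) K' es' (Suc i)"
proof -
  have S: "row_state r g f K es" and len: "length es = i" and sE: "strictE lam (chain_entries g es)"
    and row: "0 < i \<Longrightarrow> boxes lam ! (i - 1) \<in> Mu \<Longrightarrow> rowinv r f K (snd (last es)) (last (chain_entries g es)) (Ps (i - 1))"
    using I by (auto simp: pass_inv_def)
  note D = row_stateD[OF S]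
  let ?P = "Ps i" let ?f = "f \<circ> transpose ?P Q"
  obtain p q where pq: "boxes lam ! i = (p, q)" by fastforce
  have m: "(p, q) \<in> set (boxes lam)" using pq i by (metis nth_mem)
  then have q1: "1 \<le> q" "1 \<le> p" by (auto simp: set_boxes)
  have pt: "decreasing lam" using st by (simp add: pass_setup_def)
  have snoc: "strictE lam (chain_entries g es @ [e])" if "1 < q \<Longrightarrow> last (chain_entries g es) < e"
    "\<And>s. s < i \<Longrightarrow> boxes lam ! s = (Suc p, q) \<Longrightarrow> e < chain_entries g es ! s" for e
    by (rule strictE_snoc[OF pt sE]) (use that i pq len in auto)
  have ne: "es \<noteq> []" if "0 < i" using len that by auto
  have ll: "last (chain_entries g es) = chain_entries g es ! (i - 1)" if "0 < i"
    using len that by (metis last_conv_nth length_chain_entries list.size(3) less_numeral_extra(3))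
  show thesis
  proof (cases "1 < q")
    case True
    have i0: "0 < i" and bl: "boxes lam ! (i - 1) = (p, q - 1)" using boxes_left[OF i pq True] by auto
    have blM: "boxes lam ! (i - 1) \<in> Mu" using st inn pq True unfolding bl pass_setup_def by auto
    have lt: "Ps (i - 1) < ?P" using pass_setup_same(1)[OF st i _ blM inn] bl pq i0 by simp
    note rw = row[OF i0 blM]
    have nb: "boxes lam ! s \<noteq> (Suc p, q)" if "s < i" for s
    proof
      assume "boxes lam ! s = (Suc p, q)"
      then have "(Suc p, q) \<in> set (boxes lam)" using that i by (metis nth_mem order_less_trans)
      then show False using hook_boxes[OF hook(1), of "Suc p" q] q1 True by simp
    qed
    have str: "strictE lam (chain_entries g es @ [rho K ?P])"
      using snoc row_next[OF D(2,3,5) rw lt c] nb by blast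
    obtain K' es' E where o: "rect_out r g (strictE lam) f K es ?P Q K' es'" "row_state r g ?f K' es'"
      "chain_entries g es' = chain_entries g es @ [E]" "rowinv r ?f K' (snd (last es')) E ?P"
      "rect_case r g (strictE lam) f K es ?P Q ?f K' es' E"
      "\<forall>\<kappa>. block_start K Q = ?P \<longrightarrow> es \<noteq> [] \<longrightarrow> rowinv r f K (snd (last es)) (last (chain_entries g es)) \<kappa> \<longrightarrow> \<kappa> < ?P \<longrightarrow> last (chain_entries g es) < E"
      using rect_outcome[where strict = "strictE lam", OF S c n f1 disjI2[OF disjI1[OF str]]] by blast
    have "block_start K Q \<noteq> ?P \<Longrightarrow> E = rho K ?P" using o(5) str unfolding rect_case_def by blast
    moreover have "block_start K Q = ?P \<Longrightarrow> last (chain_entries g es) < E" using o(6) rw lt ne[OF i0] by blast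
    ultimately have "last (chain_entries g es) < E" using row_next[OF D(2,3,5) rw lt c] by fastforce
    then have sE': "strictE lam (chain_entries g es')" unfolding o(3) using snoc nb by blast
    have "length es' = Suc i" using arg_cong[OF o(3), of length] len by simp
    moreover have "hook_inv r g lam Mu Ps ?f K' es' (Suc i)" using inn pq True by (simp add: hook_inv_def)
    ultimately have "pass_inv r g lam Mu Ps ?f K' es' (Suc i)"
      unfolding pass_inv_def using o sE' hook(1) by simp
    then show thesis by (rule that[OF o(1)])
  next
    case False
    then have qq: "q = 1" using q1 by simp
    define Hyp where "Hyp \<longleftrightarrow> block_start K Q = ?P \<or> strictE lam (chain_entries g es @ [rho K ?P]) \<or>
      (es \<noteq> [] \<and> last (chain_entries g es) \<in> K \<and> block_start K (last (chain_entries g es)) = ?P \<and> f ?P = fst (last es))"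
    have key: "Hyp \<and> (0 < i \<longrightarrow> ?P \<le> last (chain_entries g es)) \<and> (\<forall>s<i. boxes lam ! s = (Suc p, q) \<longrightarrow> chain_entries g es ! s = last (chain_entries g es))"
    proof (cases "i = 0")
      case True
      then have "strictE lam (chain_entries g es @ [rho K ?P])" by (intro snoc) (use qq in auto)
      then show ?thesis using True by (simp add: Hyp_def)
    next
      case F: False
      then have i0: "0 < i" by simp
      have "boxes lam ! i = (p, 1)" using pq qq by simp
      then have r1: "fst (boxes lam ! (i - 1)) = Suc p" using boxes_first[OF pt i _ i0] by blast
      have mem: "boxes lam ! (i - 1) \<in> set (boxes lam)" using i by (simp add: less_imp_diff_less)
      then have s1: "snd (boxes lam ! (i - 1)) = 1"
        using hook_boxes[OF hook(1), of "Suc p" "snd (boxes lam ! (i - 1))"] r1 q1 by (metis Suc_le_mono numeral_2_eq_2 prod.collapse One_nat_def)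
      have b1: "boxes lam ! (i - 1) = (Suc p, q)" using r1 s1 qq by (metis prod.collapse)
      define N where "N = (if boxes lam ! (i - 1) \<in> Mu then {..<Ps (i - 1)} else UNIV)"
      have ci: "colinv r f K (fst (last es)) (last (chain_entries g es)) N"
        using hook(2) i0 s1 by (auto simp: hook_inv_def N_def)
      have "?P < Ps (i - 1)" if "boxes lam ! (i - 1) \<in> Mu"
        using pass_setup_same(2)[OF st i _ that inn] b1 pq i0 by simp
      then have PN: "?P \<in> N" by (simp add: N_def)
      have big: "r < f (sigma K (last (chain_entries g es)))" using last_chain_entries_props(1,2)[OF S ne[OF i0]] by simp
      note cn = col_next[OF D(2,3) ci PN c big]
      have eq: "chain_entries g es ! s = last (chain_entries g es)" if "s < i" "boxes lam ! s = (Suc p, q)" for s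
      proof -
        have "s = i - 1" using that b1 i nth_eq_iff_index_eq[OF distinct_boxes[of lam], of s "i - 1"] by simp
        then show ?thesis using ll[OF i0] by simp
      qed
      have "rho K ?P < last (chain_entries g es) \<Longrightarrow> strictE lam (chain_entries g es @ [rho K ?P])"
        using snoc eq qq by simp
      then have Hyp using cn(2) ne[OF i0] unfolding Hyp_def by blast
      then show ?thesis using cn(1) eq by blast
    qed
    have hyp: "block_start K Q = ?P \<or> strictE lam (chain_entries g es @ [rho K ?P]) \<or>
      (es \<noteq> [] \<and> last (chain_entries g es) \<in> K \<and> block_start K (last (chain_entries g es)) = ?P \<and> f ?P = fst (last es))"
      using key unfolding Hyp_def by blast
    obtain K' es' E where o: "rect_out r g (strictE lam) f K es ?P Q K' es'" "row_state r g ?f K' es'"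
      "chain_entries g es' = chain_entries g es @ [E]" "rowinv r ?f K' (snd (last es')) E ?P"
      "rect_case r g (strictE lam) f K es ?P Q ?f K' es' E"
      using rect_outcome[where strict = "strictE lam", OF S c n f1 hyp] by blast
    have "\<not> (es \<noteq> [] \<and> last (chain_entries g es) < ?P)" using key len by (cases "i = 0") auto
    then have d: "(strictE lam (chain_entries g es @ [rho K ?P]) \<and> E = rho K ?P) \<or> E < ?P"
      and co: "colinv r ?f K' (fst (last es')) E {..<?P}" using o(5) unfolding rect_case_def by blast+
    have sE': "strictE lam (chain_entries g es')" unfolding o(3)
      using d
    proof
      assume "E < ?P"
      then show "strictE lam (chain_entries g es @ [E])"
        using key qq by (intro snoc) (auto simp: less_le_trans)
    qed simp
    have "length es' = Suc i" using arg_cong[OF o(3), of length] len by simp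
    moreover have "hook_inv r g lam Mu Ps ?f K' es' (Suc i)" using inn co o(3) by (simp add: hook_inv_def)
    ultimately have "pass_inv r g lam Mu Ps ?f K' es' (Suc i)"
      unfolding pass_inv_def using o sE' hook(1) by simp
    then show thesis by (rule that[OF o(1)])
  qed
qed

text \<open>The record for the box below, with entry \<open>e\<close>, gives \<open>P <= e\<close>,
  and \<open>e\<close> is a label in case of equality. Together with \<open>semi_no_cut\<close> this
  keeps \<open>rho K P\<close> below \<open>e\<close>, so strictness never fails unless the strand
  at \<open>P\<close> heads the block of \<open>Q\<close>; the column case does not arise.\<close>

lemma rect_step_semi:
  assumes st: "pass_setup lam Mu Ps" and I: "pass_inv r g lam Mu Ps f K es i" and i: "i < length (boxes lam)"
    and inn: "boxes lam ! i \<in> Mu" and c: "bcover r f (Ps i) Q"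
    and n: "ninv (f \<circ> transpose (Ps i) Q) = Suc (ninv f)" and f1: "(f \<circ> transpose (Ps i) Q) 1 \<le> r"
    and sm: "semi_inv r g lam Mu Ps f K es i"
  obtains K' es' where "rect_out r g (strictE lam) f K es (Ps i) Q K' es'"
    "pass_inv r g lam Mu Ps (f \<circ> transpose (Ps i) Q) K' es' (Suc i)"
proof -
  let ?b = "boxes lam"
  have S: "row_state r g f K es" and len: "length es = i" and sE: "strictE lam (chain_entries g es)"
    and row: "0 < i \<Longrightarrow> ?b ! (i - 1) \<in> Mu \<Longrightarrow> rowinv r f K (snd (last es)) (last (chain_entries g es)) (Ps (i - 1))"
    using I by (auto simp: pass_inv_def)
  note D = row_stateD[OF S]
  define P where "P = Ps i"
  let ?f = "f \<circ> transpose P Q"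
  have c: "bcover r f P Q" and n: "ninv ?f = Suc (ninv f)" and f1: "?f 1 \<le> r" using c n f1 by (simp_all add: P_def)
  have PQ: "1 \<le> P" "P < Q" "f P \<le> r" "r < f Q" using c by (auto simp: bcover_def)
  have sg: "big_sorted r g" and sf: "big_sorted r f" using sm by (auto simp: semi_inv_def)
  obtain p q where pq: "?b ! i = (p, q)" by fastforce
  have m: "(p, q) \<in> set ?b" using pq i by (metis nth_mem)
  then have q1: "1 \<le> q" "1 \<le> p" by (auto simp: set_boxes)
  have pt: "decreasing lam" using st by (simp add: pass_setup_def)
  have ne: "es \<noteq> []" if "0 < i" using len that by auto
  have prev: "0 < i \<and> ?b ! (i - 1) = (p, q - 1) \<and> ?b ! (i - 1) \<in> Mu \<and> Ps (i - 1) < P" if q: "1 < q"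
  proof -
    have bl: "0 < i" "?b ! (i - 1) = (p, q - 1)" using boxes_left[OF i pq q] by auto
    moreover have blM: "?b ! (i - 1) \<in> Mu" using st inn pq q unfolding bl pass_setup_def by auto
    moreover have "Ps (i - 1) < P" unfolding P_def using pass_setup_same(1)[OF st i _ blM inn] bl pq by simp
    ultimately show ?thesis by simp
  qed
  have colge: "1 \<le> snd (?b ! s)" if "s < i" for s
    using that i nth_mem[of s ?b] by (auto simp: set_boxes)
  have bef: "before (?b ! s) (?b ! i)" if "s < i" for s using boxes_before[OF that i] .
  \<comment> \<open>At the first box of a row the record of the row below is still in its original
    form with \<open>F = 0\<close>. Later in the row the previous step supplies \<open>F\<close>,
    and the present cover cannot start before it.\<close>
  have "\<exists>F. F \<le> P \<and> (\<forall>s<i. fst (?b ! s) = Suc p \<longrightarrow> q \<le> snd (?b ! s) \<longrightarrow>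
     big_above r f K F (chain_entries g es ! s) (old_bound lam Mu Ps s) \<and> (F \<le> chain_entries g es ! s \<or> F = 0))"
  proof (cases "1 < q")
    case True
    note pv = prev[OF True]
    from sm pv obtain F where F: "\<forall>P2 Q2. Ps (i - 1) < P2 \<longrightarrow> bcover r f P2 Q2 \<longrightarrow> F \<le> P2"
      "\<forall>s<i. fst (?b ! s) = Suc (fst (?b ! (i - 1))) \<longrightarrow> snd (?b ! (i - 1)) < snd (?b ! s) \<longrightarrow>
         big_above r f K F (chain_entries g es ! s) (old_bound lam Mu Ps s) \<and> F \<le> chain_entries g es ! s"
      unfolding semi_inv_def by auto
    have "F \<le> P" using F(1) pv c by auto
    moreover have "big_above r f K F (chain_entries g es ! s) (old_bound lam Mu Ps s) \<and> (F \<le> chain_entries g es ! s \<or> F = 0)"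
      if "s < i" "fst (?b ! s) = Suc p" "q \<le> snd (?b ! s)" for s
      using F(2)[rule_format, of s] that pv True by auto
    ultimately show ?thesis by (intro exI[of _ F]) auto
  next
    case False
    then have qq: "q = 1" using q1 by simp
    have "big_above r f K 0 (chain_entries g es ! s) (old_bound lam Mu Ps s)" if s: "s < i" "fst (?b ! s) = Suc p" for s
    proof -
      have b1: "?b ! i = (p, 1)" using pq qq by simp
      have "0 < i" using s by simp
      then have "fst (?b ! (i - 1)) = Suc p" using boxes_first[OF pt i b1] by simp
      then show ?thesis using sm s \<open>0 < i\<close> by (simp add: semi_inv_def)
    qed
    then show ?thesis by (intro exI[of _ 0]) auto
  qed
  then obtain F where F: "F \<le> P" "\<And>s. s < i \<Longrightarrow> fst (?b ! s) = Suc p \<Longrightarrow> q \<le> snd (?b ! s) \<Longrightarrow>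
     big_above r f K F (chain_entries g es ! s) (old_bound lam Mu Ps s) \<and> (F \<le> chain_entries g es ! s \<or> F = 0)" by auto
  have fit: "P \<le> chain_entries g es ! s \<and> (P = chain_entries g es ! s \<longrightarrow> chain_entries g es ! s \<in> K) \<and> Q \<le> Suc (chain_entries g es ! s)"
    if s: "s < i" "?b ! s = (Suc p, q)" for s
  proof -
    have iF: "big_above r f K F (chain_entries g es ! s) (old_bound lam Mu Ps s)" "F \<le> chain_entries g es ! s \<or> F < P"
      using F(2)[of s] s PQ by auto
    have U: "Suc P \<in> old_bound lam Mu Ps s" "P \<in> old_bound lam Mu Ps s"
      using pass_setup_same(2)[OF st i s(1) _ inn] s(2) pq unfolding old_bound_def P_def by auto
    show ?thesis using big_above_fit[OF iF(1) U F(1) iF(2) D(2) sf c] by blast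
  qed
  have snoc: "strictE lam (chain_entries g es @ [e])" if "1 < q \<Longrightarrow> last (chain_entries g es) < e"
    "\<And>s. s < i \<Longrightarrow> ?b ! s = (Suc p, q) \<Longrightarrow> e < chain_entries g es ! s" for e
    by (rule strictE_snoc[OF pt sE]) (use that i pq len in auto)
  have rw: "rowinv r f K (snd (last es)) (last (chain_entries g es)) (Ps (i - 1))" if "1 < q"
    using prev[OF that] by (intro row) auto
  have str: "strictE lam (chain_entries g es @ [rho K P])" if nh: "block_start K Q \<noteq> P"
  proof (rule snoc)
    show "last (chain_entries g es) < rho K P" if q: "1 < q"
      using row_next[OF D(2,3,5) rw[OF q] _ c] prev[OF q] by simp
    show "rho K P < chain_entries g es ! s" if s: "s < i" "?b ! s = (Suc p, q)" for s
    proof (cases "P - 1 \<in> K")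
      case True
      then have "rho K P = P - 1" using PQ by (simp add: rho_tail)
      then show ?thesis using fit[OF s] PQ by linarith
    next
      case False
      have "P \<notin> K" "rho K P = P" using semi_no_cut[OF D(2,3,5) sf c nh False] by auto
      then show ?thesis using fit[OF s] by (metis le_neq_implies_less)
    qed
  qed
  have hyp: "block_start K Q = P \<or> strictE lam (chain_entries g es @ [rho K P]) \<or>
      (es \<noteq> [] \<and> last (chain_entries g es) \<in> K \<and> block_start K (last (chain_entries g es)) = P \<and> f P = fst (last es))"
    using str by (cases "block_start K Q = P") simp_all
  obtain K' es' E where o: "rect_out r g (strictE lam) f K es P Q K' es'" "row_state r g ?f K' es'"
    "chain_entries g es' = chain_entries g es @ [E]" "rowinv r ?f K' (snd (last es')) E P"
    "rect_case r g (strictE lam) f K es P Q ?f K' es' E"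
    "\<forall>\<kappa>. block_start K Q = P \<longrightarrow> es \<noteq> [] \<longrightarrow> rowinv r f K (snd (last es)) (last (chain_entries g es)) \<kappa> \<longrightarrow> \<kappa> < P \<longrightarrow> last (chain_entries g es) < E"
    using rect_outcome[where strict = "strictE lam", OF S c n f1 hyp] by blast
  have sb: "big_sorted r (chain_line (butlast es) g)" if e: "es \<noteq> []"
  proof -
    obtain es0 x y where "es = es0 @ [(x, y)]" using snoc_pair[OF e] by blast
    then show ?thesis using semi_chain_line[OF D(1) sg, of es0] D(6) by (simp add: chain_ok_snoc)
  qed
  have cs: "(block_start K Q \<noteq> P \<and> E = rho K P \<and> K' = K) \<or>
    (block_start K Q = P \<and> K' = insert E (K - {Q - 1}) \<and> E < P \<and> (\<forall>p. E < p \<longrightarrow> p \<le> P \<longrightarrow> r < ?f p))"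
    using o(5) sb str unfolding rect_case_def by blast
  have sE': "strictE lam (chain_entries g es')"
    using cs
  proof
    assume "block_start K Q \<noteq> P \<and> E = rho K P \<and> K' = K"
    then show ?thesis unfolding o(3) using str by simp
  next
    assume a: "block_start K Q = P \<and> K' = insert E (K - {Q - 1}) \<and> E < P \<and> (\<forall>p. E < p \<longrightarrow> p \<le> P \<longrightarrow> r < ?f p)"
    show ?thesis unfolding o(3)
    proof (rule snoc)
      show "last (chain_entries g es) < E" if q: "1 < q"
        using o(6)[rule_format, of "Ps (i - 1)"] a rw[OF q] prev[OF q] ne by simp
      show "E < chain_entries g es ! s" if "s < i" "?b ! s = (Suc p, q)" for s using fit[OF that] a by linarith
    qed
  qed
  have sub: "K - {P} \<subseteq> K'"
    using cs
  proof
    assume a: "block_start K Q = P \<and> K' = insert E (K - {Q - 1}) \<and> E < P \<and> (\<forall>p. E < p \<longrightarrow> p \<le> P \<longrightarrow> r < ?f p)"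
    then have "Q = Suc P" using semi_cut[OF D(2,5) sf c] by simp
    then show ?thesis using a by auto
  qed auto
  have len': "length es' = Suc i" using arg_cong[OF o(3), of length] len by simp
  have Eold: "chain_entries g es' ! s = chain_entries g es ! s" if "s < i" for s using that o(3) len by (simp add: nth_append)
  have Enew: "chain_entries g es' ! i = E" using o(3) len by (simp add: nth_append)
  have new: "big_above r ?f K' 0 E {..P}"
    using cs
  proof
    assume a: "block_start K Q \<noteq> P \<and> E = rho K P \<and> K' = K"
    have "(P = Suc E \<and> E \<in> K') \<or> P = E"
    proof (cases "P - 1 \<in> K")
      case True then show ?thesis using a PQ by (simp add: rho_tail)
    next
      case False then show ?thesis using semi_no_cut[OF D(2,3,5) sf c _ False] a by simp
    qed
    moreover have "r < ?f P" using PQ by simp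
    ultimately show ?thesis unfolding big_above_def by (intro bexI[of _ P]) auto
  next
    assume a: "block_start K Q = P \<and> K' = insert E (K - {Q - 1}) \<and> E < P \<and> (\<forall>p. E < p \<longrightarrow> p \<le> P \<longrightarrow> r < ?f p)"
    then show ?thesis unfolding big_above_def by (intro bexI[of _ "Suc E"]) auto
  qed
  have UP: "old_bound lam Mu Ps i = {..P}" using inn by (simp add: old_bound_def P_def)
  have cur: "big_above r ?f K' 0 (chain_entries g es' ! s) (old_bound lam Mu Ps s)" if s: "s < Suc i" "fst (?b ! s) = p" for s
  proof (cases "s = i")
    case True then show ?thesis using new Enew UP by simp
  next
    case False
    then have si: "s < i" using s by simp
    have sq: "snd (?b ! s) < q" using bef[OF si] s pq by (auto simp: before_def)
    then have qq: "1 < q" using colge[OF si] by simp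
    note pv = prev[OF qq]
    have "(p, q) \<in> Mu" using inn pq by simp
    moreover have "?b ! s = (p, snd (?b ! s))" using s by (simp add: prod_eq_iff)
    ultimately have sM: "?b ! s \<in> Mu" using st sq colge[OF si] unfolding pass_setup_def by (metis less_imp_le)
    have "Ps s < P" unfolding P_def using pass_setup_same(1)[OF st i si sM inn] s pq by simp
    moreover have "big_above r f K 0 (chain_entries g es ! s) (old_bound lam Mu Ps s)"
      using sm si s pv by (simp add: semi_inv_def)
    ultimately show ?thesis unfolding Eold[OF si] old_bound_def using sM big_above_keep_row[OF _ _ PQ(2) sub] by simp
  qed
  \<comment> \<open>For the boxes of the row below that come next, the bound becomes
    \<open>Q\<close>: the swap has put a strand \<open><= r\<close> there, and by
    \<open>semi_row\<close> the row continues at \<open>Q\<close> or later.\<close>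
  have below: "big_above r ?f K' Q (chain_entries g es' ! s) (old_bound lam Mu Ps s) \<and> Q \<le> chain_entries g es' ! s"
    if s: "s < Suc i" "fst (?b ! s) = Suc p" "q < snd (?b ! s)" for s
  proof -
    have si: "s < i" using s pq by (cases "s = i") auto
    have sl: "s < length ?b" using si i by simp
    have "(Suc p, snd (?b ! s)) \<in> set ?b" using nth_mem[OF sl] s by (metis prod.collapse)
    then have "(Suc p, q) \<in> set ?b" using s q1 by (auto simp: set_boxes)
    moreover have "before (Suc p, q) (?b ! i)" using pq by (simp add: before_def)
    ultimately obtain t where t: "t < i" "?b ! t = (Suc p, q)" using boxes_index[OF i] by blast
    have "before (?b ! t) (?b ! s)" using t s by (simp add: before_def)
    then have ts: "t < s" using boxes_before_iff[of t lam s] t i sl by simp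
    have lt: "chain_entries g es ! t < chain_entries g es ! s"
      using sE[unfolded strictE_def, rule_format, of s t] ts si len t s by simp
    have Qs: "Q \<le> chain_entries g es ! s" using fit[OF t] lt by linarith
    have "chain_entries g es ! s \<noteq> P" using fit[OF t] lt by linarith
    moreover have "big_above r f K F (chain_entries g es ! s) (old_bound lam Mu Ps s)" using F(2)[OF si s(2)] s(3) by simp
    moreover have "F \<le> Q" using F(1) PQ by simp
    ultimately have "big_above r ?f K' Q (chain_entries g es ! s) (old_bound lam Mu Ps s)"
      using big_above_keep_below[OF _ _ PQ(2) _ sub] by blast
    then show ?thesis unfolding Eold[OF si] using Qs by simp
  qed
  have land: "\<forall>P2 Q2. P < P2 \<longrightarrow> bcover r ?f P2 Q2 \<longrightarrow> Q \<le> P2"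
    using semi_row[OF D(2) sf c] by blast
  have "semi_inv r g lam Mu Ps ?f K' es' (Suc i)"
    unfolding semi_inv_def
  proof (intro conjI impI)
    show "big_sorted r g" by (rule sg)
    show "big_sorted r ?f" by (rule semi_swap[OF D(2) sf c])
    show "\<forall>s<Suc i. fst (?b ! s) = fst (?b ! (Suc i - 1)) \<longrightarrow> big_above r ?f K' 0 (chain_entries g es' ! s) (old_bound lam Mu Ps s)"
      using cur pq by simp
    show "\<exists>F. (\<forall>P2 Q2. Ps (Suc i - 1) < P2 \<longrightarrow> bcover r ?f P2 Q2 \<longrightarrow> F \<le> P2) \<and>
        (\<forall>s<Suc i. fst (?b ! s) = Suc (fst (?b ! (Suc i - 1))) \<longrightarrow> snd (?b ! (Suc i - 1)) < snd (?b ! s) \<longrightarrow>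
           big_above r ?f K' F (chain_entries g es' ! s) (old_bound lam Mu Ps s) \<and> F \<le> chain_entries g es' ! s)"
      using land below pq by (intro exI[of _ Q]) (simp add: P_def)
  qed
  then have "pass_inv r g lam Mu Ps ?f K' es' (Suc i)"
    unfolding pass_inv_def using o(2,3,4) sE' len' by (simp add: P_def)
  then show thesis using o(1) that[of K' es'] unfolding P_def by simp
qed

lemma rect_step:
  assumes st: "pass_setup lam Mu Ps" and I: "pass_inv r g lam Mu Ps f K es i" and i: "i < length (boxes lam)"
    and inn: "boxes lam ! i \<in> Mu" and c: "bcover r f (Ps i) Q"
    and n: "ninv (f \<circ> transpose (Ps i) Q) = Suc (ninv f)" and f1: "(f \<circ> transpose (Ps i) Q) 1 \<le> r"
  obtains K' es' where "rect_out r g (strictE lam) f K es (Ps i) Q K' es'"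
    "pass_inv r g lam Mu Ps (f \<circ> transpose (Ps i) Q) K' es' (Suc i)"
proof -
  consider "is_hook lam" "hook_inv r g lam Mu Ps f K es i" | "semi_inv r g lam Mu Ps f K es i"
    using I by (auto simp: pass_inv_def)
  then show thesis
  proof cases
    case 1 show thesis by (rule rect_step_hook[OF st I i inn c n f1 1]) (rule that)
  next
    case 2 show thesis by (rule rect_step_semi[OF st I i inn c n f1 2]) (rule that)
  qed
qed

section \<open>Graphs of shuffles\<close>

definition shuffled :: "nat \<Rightarrow> (nat \<Rightarrow> nat) \<Rightarrow> bool" where
  "shuffled r f \<longleftrightarrow> big_sorted r f \<and> (\<forall>p q. p < q \<longrightarrow> f p \<le> r \<longrightarrow> f q \<le> r \<longrightarrow> f p < f q)"

text \<open>A row reverses the order of two strands only if the left one is the head of the block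
  containing the right one, that is, only if they cross in this row.\<close>

lemma rho_less:
  assumes fin: "finite K" and pq: "p < q" and ne: "block_start K q \<noteq> p"
  shows "rho K p < rho K q"
proof -
  have bp: "block_end K p < q" if "p = 0 \<or> p - 1 \<notin> K"
  proof (rule ccontr)
    assume "\<not> block_end K p < q"
    then have "block_start K q = block_start K p" using block_start_block_end[OF fin, of p q] pq by simp
    then show False using block_start_head[OF that] ne by simp
  qed
  note b = block_end_props[OF fin]
  show ?thesis
  proof (cases "0 < p \<and> p - 1 \<in> K")
    case True
    then have rp: "rho K p = p - 1" by (simp add: rho_def)
    show ?thesis
    proof (cases "q - 1 \<in> K")
      case q: True
      have "rho K q = q - 1" using q pq by (simp add: rho_def)
      then show ?thesis using rp True pq by linarith
    next
      case False
      have "rho K q = block_end K q" using False by (simp add: rho_def)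
      then show ?thesis using rp b(1)[of q] pq by linarith
    qed
  next
    case False
    then have h: "p = 0 \<or> p - 1 \<notin> K" by auto
    then have rp: "rho K p = block_end K p" by (rule rho_head)
    show ?thesis
    proof (cases "q - 1 \<in> K")
      case q: True
      then have "rho K q = q - 1" using pq by (simp add: rho_def)
      moreover have "block_end K p \<noteq> q - 1" using q b(2)[of p] by metis
      ultimately show ?thesis using rp bp[OF h] by linarith
    next
      case False
      then have "rho K q = block_end K q" by (simp add: rho_def)
      then show ?thesis using rp bp[OF h] b(1)[of q] by linarith
    qed
  qed
qed

text \<open>In a reduced row a head is smaller than its tails, so two strands that are already
  inverted do not cross again.\<close>

lemma row_order:
  assumes fin: "finite K" and reduced_row: "reduced_row K f" and pq: "p < q" and gt: "f q < f p"
  shows "rho K p < rho K q"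
proof (rule rho_less[OF fin pq])
  show "block_start K q \<noteq> p"
  proof
    assume a: "block_start K q = p"
    then have "f p < f q" using reduced_row_tail[OF reduced_row, of q] pq by simp
    then show False using gt by simp
  qed
qed

text \<open>By \<open>row_order\<close> an inversion is never undone on the way up. So if the line
  above the row has no inversion among strands \<open>> r\<close>, neither has the line
  below.\<close>

lemma semi_down:
  assumes f: "fin_perm f" and fin: "finite K" and reduced_row: "reduced_row K f" and s: "big_sorted r (f \<circ> sigma K)"
  shows "big_sorted r f"
  unfolding big_sorted_def
proof (intro allI impI)
  fix p q assume a: "p < q" "r < f p" "r < f q"
  show "f p < f q"
  proof (rule ccontr)
    assume "\<not> f p < f q"
    then have gt: "f q < f p" using fin_perm_eq_iff[OF f, of p q] a by linarith
    note lt = row_order[OF fin reduced_row a(1) gt]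
    have "f (sigma K (rho K p)) < f (sigma K (rho K q))"
      using s[unfolded big_sorted_def comp_apply, rule_format, of "rho K p" "rho K q"] lt a sigma_rho[OF fin] by simp
    then show False using gt sigma_rho[OF fin] by simp
  qed
qed

lemma shuffled_down:
  assumes f: "fin_perm f" and fin: "finite K" and reduced_row: "reduced_row K f" and s: "shuffled r (f \<circ> sigma K)"
  shows "shuffled r f"
  unfolding shuffled_def
proof (intro conjI allI impI)
  show "big_sorted r f" using semi_down[OF f fin reduced_row] s by (simp add: shuffled_def)
  fix p q assume a: "p < q" "f p \<le> r" "f q \<le> r"
  show "f p < f q"
  proof (rule ccontr)
    assume "\<not> f p < f q"
    then have gt: "f q < f p" using fin_perm_eq_iff[OF f, of p q] a by linarith
    note lt = row_order[OF fin reduced_row a(1) gt]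
    have "f (sigma K (rho K p)) < f (sigma K (rho K q))"
      using conjunct2[OF s[unfolded shuffled_def comp_apply], rule_format, of "rho K p" "rho K q"] lt a sigma_rho[OF fin] by simp
    then show False using gt sigma_rho[OF fin] by simp
  qed
qed

text \<open>Two strands that cross in a reduced row are inverted in the line above, and in a shuffle
  only a strand \<open><= r\<close> and a strand \<open>> r\<close> can be inverted.\<close>

lemma shuffled_cross:
  assumes f: "fin_perm f" and fin: "finite K" and reduced_row: "reduced_row K f" and s: "shuffled r (f \<circ> sigma K)" and k: "k \<in> K"
  shows "f (block_start K k) \<le> r" "r < f (Suc k)"
proof -
  show h: "f (block_start K k) \<le> r"
    using semi_heads[OF fin reduced_row _ k] s by (simp add: shuffled_def)
  let ?e = "block_end K k"
  have e: "k < ?e" "?e \<notin> K" using block_end_props[OF fin, of k] k by (auto simp: le_less)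
  have lt: "f (block_start K k) < f (Suc k)" using reduced_row k by (auto simp: reduced_row_def)
  have "block_start K ?e = block_start K k" using block_start_block_end[OF fin, of k ?e] e by simp
  then have "f (sigma K ?e) = f (block_start K k)" "f (sigma K k) = f (Suc k)" using e k by (auto simp: sigma_def)
  then have "\<not> f (Suc k) \<le> r" using s e(1) h lt unfolding shuffled_def by (metis comp_apply less_asym)
  then show "r < f (Suc k)" by simp
qed

locale shuffle_graph =
  fixes r :: nat and Y :: graph
  assumes rc: "rc_graph Y" and r1: "1 \<le> r" and sh1: "shuffled r (strand_line Y 1)"
begin

lemma pg: "pos_graph Y" and redY: "1 \<le> i \<Longrightarrow> reduced_row (labels Y i) (strand_line Y (Suc i))"
  using rc by (auto simp: rc_graph_iff)

abbreviation L where "L i \<equiv> strand_line Y i"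
abbreviation KY where "KY i \<equiv> labels Y i"

definition rows_perm :: "nat \<Rightarrow> nat \<Rightarrow> nat" where "rows_perm i = graph_perm (rows_ge Y i)"

lemma fpL: "fin_perm (L i)" by (rule fin_perm_strand_line[OF pg])
lemma finK: "finite (KY i)" by (rule finite_labels[OF pg])
lemma L_rec: "L i = L (Suc i) \<circ> sigma (KY i)" by (rule strand_line_rec[OF pg])

lemma fpv: "fin_perm (rows_perm i)" unfolding rows_perm_def by (intro fin_perm_graph pos_graph_rows_ge pg)

lemma L_rows_perm: "L i (rows_perm i s) = s" unfolding strand_line_def rows_perm_def[symmetric] by (rule inv_fin_perm_f[OF fpv])
lemma rows_perm_L: "rows_perm i (L i p) = p" unfolding strand_line_def rows_perm_def[symmetric] by (rule f_inv_fin_perm[OF fpv])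

lemma shufL: "1 \<le> i \<Longrightarrow> shuffled r (L i)"
proof (induction i rule: dec_induct)
  case base show ?case by (rule sh1)
next
  case (step n)
  show ?case by (rule shuffled_down[OF fpL finK redY[OF step(1)] step.IH[unfolded L_rec[of n]]])
qed

lemma cross:
  assumes "1 \<le> i" "k \<in> KY i"
  shows "L (Suc i) (block_start (KY i) k) \<le> r" "r < L (Suc i) (Suc k)"
  using shuffled_cross[OF fpL finK redY _ assms(2)] shufL[OF assms(1)] L_rec[of i] assms(1) by auto

text \<open>Below row \<open>i > r\<close> a strand \<open>n <= r\<close> is still at position
  \<open>n < i\<close>. But the head of a block with a label sits at a position \<open>>= i\<close>,
  and its strand is \<open><= r\<close> by \<open>cross\<close>.\<close>

lemma no_rows: assumes "r < i" shows "KY i = {}"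
proof (rule ccontr)
  assume "KY i \<noteq> {}"
  then obtain k where k: "k \<in> KY i" by blast
  let ?h = "block_start (KY i) k"
  have i1: "1 \<le> i" using assms r1 by simp
  have hi: "i \<le> ?h"
  proof (rule ccontr)
    assume h: "\<not> i \<le> ?h"
    have "i \<le> k" using labels_ge[OF pg k] by simp
    then have "?h < k" using h by simp
    then have "?h \<in> KY i" using block_start_mem[of "KY i" k ?h] by simp
    then show False using labels_ge[OF pg, of ?h i] h by simp
  qed
  define n where "n = L (Suc i) ?h"
  have "n \<le> r" unfolding n_def by (rule cross(1)[OF i1 k])
  then have "L (Suc i) n = n" using strand_line_low[OF pg, of n "Suc i"] assms by simp
  then have "L (Suc i) n = L (Suc i) ?h" by (simp add: n_def)
  then have "n = ?h" using fin_perm_eq_iff[OF fpL] by blast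
  then show False using hi \<open>n \<le> r\<close> assms by simp
qed

lemma rows_empty: assumes "r < i" shows "rows_ge Y i = {}"
proof -
  have "(a, b) \<notin> Y" if "i \<le> a" for a b
    using no_rows[of a] that assms unfolding labels_def by auto
  then show ?thesis by (auto simp: rows_ge_def)
qed

lemma rows_perm_rec: "rows_perm i s = rho (KY i) (rows_perm (Suc i) s)"
proof -
  have "L i (rho (KY i) (rows_perm (Suc i) s)) = s"
    unfolding L_rec[of i] comp_apply sigma_rho[OF finK] by (rule L_rows_perm)
  then show ?thesis using rows_perm_L by metis
qed

text \<open>By \<open>cross\<close> every tail carries a strand \<open>> r\<close>. So a strand
  \<open><= r\<close> always runs to the end of its block, and its position only moves to the right
  from row to row.\<close>

lemma small_head:
  assumes "1 \<le> i" "s \<le> r"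
  shows "rows_perm (Suc i) s = 0 \<or> rows_perm (Suc i) s - 1 \<notin> KY i"
proof (rule ccontr)
  assume "\<not> ?thesis"
  then have k: "rows_perm (Suc i) s - 1 \<in> KY i" "0 < rows_perm (Suc i) s" by auto
  have "r < L (Suc i) (Suc (rows_perm (Suc i) s - 1))" by (rule cross(2)[OF assms(1) k(1)])
  then show False using k L_rows_perm assms by simp
qed

lemma rows_perm_small: "1 \<le> i \<Longrightarrow> s \<le> r \<Longrightarrow> rows_perm i s = block_end (KY i) (rows_perm (Suc i) s)"
  using rows_perm_rec rho_head[OF small_head] by metis

lemma rows_perm_mono: "1 \<le> i \<Longrightarrow> s \<le> r \<Longrightarrow> rows_perm (Suc i) s \<le> rows_perm i s"
  using rows_perm_small block_end_props(1)[OF finK] by metis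

lemma rows_perm_incr:
  assumes "1 \<le> i" "s < s'" "s' \<le> r"
  shows "rows_perm i s < rows_perm i s'"
proof (rule ccontr)
  assume "\<not> rows_perm i s < rows_perm i s'"
  then have "rows_perm i s' < rows_perm i s" using fin_perm_eq_iff[OF fpv, of i s s'] assms by linarith
  then have "L i (rows_perm i s') < L i (rows_perm i s)" using conjunct2[OF shufL[OF assms(1), unfolded shuffled_def], rule_format, of "rows_perm i s'" "rows_perm i s"] assms L_rows_perm by simp
  then show False using L_rows_perm assms by simp
qed

text \<open>Since strand \<open>Suc s\<close> starts the row as a head, the block of strand
  \<open>s\<close> ends before it. Read on shapes, this interlacing says that the boxes added in a
  row form a horizontal strip.\<close>

lemma strip:
  assumes "1 \<le> i" "s < r"
  shows "rows_perm i s < rows_perm (Suc i) (Suc s)"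
proof -
  let ?p = "rows_perm (Suc i) s" let ?q = "rows_perm (Suc i) (Suc s)"
  have pq: "?p < ?q" using rows_perm_incr[of "Suc i" s "Suc s"] assms by simp
  have h: "?q = 0 \<or> ?q - 1 \<notin> KY i" using small_head[of i "Suc s"] assms by simp
  have "block_end (KY i) ?p < ?q"
  proof (rule ccontr)
    assume "\<not> block_end (KY i) ?p < ?q"
    then have "?q - 1 \<in> KY i" using block_end_mem[OF finK, of ?p "?q - 1" i] pq by simp
    then show False using h pq by simp
  qed
  then show ?thesis using rows_perm_small[of i s] assms by simp
qed

lemma rows_perm_empty: "r < i \<Longrightarrow> rows_perm i = id"
  using rows_empty[of i] by (simp add: rows_perm_def graph_perm_def graph_word_def)

lemma rows_perm_ge: "1 \<le> i \<Longrightarrow> s \<le> r \<Longrightarrow> s \<le> rows_perm i s"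
proof -
  assume s: "s \<le> r"
  have "1 \<le> i \<longrightarrow> s \<le> rows_perm i s" if "i \<le> Suc r" for i
    using that
  proof (induction i rule: inc_induct)
    case base show ?case using rows_perm_empty[of "Suc r"] by simp
  next
    case (step i) show ?case
    proof
      assume "1 \<le> i"
      then show "s \<le> rows_perm i s" using rows_perm_mono[of i s] s step.IH by simp
    qed
  qed
  moreover assume "1 \<le> i"
  ultimately show ?thesis using rows_perm_empty[of i] by (cases "i \<le> Suc r") auto
qed

text \<open>For \<open>1 <= s <= r\<close> this is the length of row \<open>r + 1 - s\<close> of the
  shape of the rows \<open>>= i\<close> of \<open>Y\<close>, and also the number of crossings of
  strand \<open>s\<close> in these rows.\<close>

definition d :: "nat \<Rightarrow> nat \<Rightarrow> nat" where "d i s = rows_perm i s - s"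

definition sh :: "nat \<Rightarrow> nat list" where "sh i = shuffle_shape r (rows_perm i)"

lemma length_sh [simp]: "length (sh i) = r" by (simp add: sh_def shuffle_shape_def)

lemma sh_nth: "1 \<le> p \<Longrightarrow> p \<le> r \<Longrightarrow> sh i ! (p - 1) = d i (r + 1 - p)"
proof -
  assume p: "1 \<le> p" "p \<le> r"
  then have "[1..<r + 1] ! (p - 1) = p" by (subst nth_upt) auto
  then have "sh i ! (p - 1) = rows_perm i (r + 1 - p) + p - (r + 1)"
    using p unfolding sh_def shuffle_shape_def by (simp del: upt_Suc)
  then show ?thesis using p by (simp add: d_def)
qed

lemma sh_boxes: "(p, q) \<in> set (boxes (sh i)) \<longleftrightarrow> 1 \<le> p \<and> p \<le> r \<and> 1 \<le> q \<and> q \<le> d i (r + 1 - p)"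
  using sh_nth[of p i] by (auto simp: set_boxes)

lemma d_mono: "1 \<le> i \<Longrightarrow> s \<le> r \<Longrightarrow> d (Suc i) s \<le> d i s"
  using rows_perm_mono[of i s] by (simp add: d_def)

lemma d_incr:
  assumes "1 \<le> i" "s \<le> s'" "s' \<le> r"
  shows "d i s \<le> d i s'"
  using assms(2,3)
proof (induction s' rule: dec_induct)
  case (step n)
  then show ?case using rows_perm_incr[of i n "Suc n"] assms(1) by (simp add: d_def)
qed simp

lemma decreasing_sh: "1 \<le> i \<Longrightarrow> decreasing (sh i)"
  unfolding decreasing_def sorted_wrt_iff_nth_less
proof (intro allI impI)
  fix a b assume *: "1 \<le> i" "a < b" "b < length (sh i)"
  then show "sh i ! b \<le> sh i ! a"
    using sh_nth[of "Suc a" i] sh_nth[of "Suc b" i] d_incr[of i "r - b" "r - a"] by simp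
qed

lemma boxes_sub: "1 \<le> i \<Longrightarrow> set (boxes (sh (Suc i))) \<subseteq> set (boxes (sh i))"
proof
  fix x assume i: "1 \<le> i" and x: "x \<in> set (boxes (sh (Suc i)))"
  obtain p q where pq: "x = (p, q)" by fastforce
  have "1 \<le> p" "p \<le> r" "1 \<le> q" "q \<le> d (Suc i) (r + 1 - p)" using x by (simp_all add: pq sh_boxes)
  moreover from this have "d (Suc i) (r + 1 - p) \<le> d i (r + 1 - p)" using i by (intro d_mono) auto
  ultimately show "x \<in> set (boxes (sh i))" by (simp add: pq sh_boxes)
qed

lemma boxes_strip:
  assumes "1 \<le> i" "(p, q) \<in> set (boxes (sh i)) - set (boxes (sh (Suc i)))"
  shows "(Suc p, q) \<notin> set (boxes (sh i))"
proof
  assume a: "(Suc p, q) \<in> set (boxes (sh i))"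
  have b: "1 \<le> p" "Suc p \<le> r" "q \<le> d i (r - p)" "d (Suc i) (r + 1 - p) < q" using a assms(2) by (auto simp: sh_boxes)
  have "rows_perm i (r - p) < rows_perm (Suc i) (Suc (r - p))" using strip[OF assms(1), of "r - p"] b by simp
  then have "d i (r - p) \<le> d (Suc i) (Suc (r - p))" unfolding d_def by simp
  moreover have "Suc (r - p) = r + 1 - p" using b by simp
  ultimately show False using b by simp
qed

lemma boxes_empty: "r < i \<Longrightarrow> boxes (sh i) = []"
proof -
  assume "r < i"
  then have "(p, q) \<notin> set (boxes (sh i))" for p q using rows_perm_empty[of i] by (simp add: sh_boxes d_def)
  then show ?thesis by (cases "boxes (sh i)") auto
qed

text \<open>Strand \<open>s\<close> is a head, so its crossings in row \<open>i\<close> are exactly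
  the labels from its position to the end of its block, and it advances by one position at each of
  them.\<close>

lemma card_fibre:
  assumes "1 \<le> i" "s \<le> r"
  shows "card {k \<in> KY i. L (Suc i) (block_start (KY i) k) = s} = d i s - d (Suc i) s"
proof -
  let ?p = "rows_perm (Suc i) s" let ?e = "block_end (KY i) ?p"
  note hd = small_head[OF assms]
  have "{k \<in> KY i. L (Suc i) (block_start (KY i) k) = s} = {?p..<?e}"
  proof (intro set_eqI iffI)
    fix k assume "k \<in> {k \<in> KY i. L (Suc i) (block_start (KY i) k) = s}"
    then have k: "k \<in> KY i" "block_start (KY i) k = ?p" using rows_perm_L by auto
    then have pk: "?p \<le> k" using block_start_le[of "KY i" k] by simp
    have "\<not> ?e \<le> k"
    proof
      assume "?e \<le> k"
      then have "?e \<in> KY i" using block_start_mem[of "KY i" k ?e] k block_end_props(1)[OF finK, of ?p i] by (cases "?e = k") auto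
      then show False using block_end_props(2)[OF finK] by blast
    qed
    then show "k \<in> {?p..<?e}" using pk by simp
  next
    fix k assume k: "k \<in> {?p..<?e}"
    then have "k \<in> KY i" using block_end_mem[OF finK, of ?p k i] by simp
    moreover have "block_start (KY i) k = ?p" using block_start_block_end[OF finK, of ?p k i] k block_start_head[OF hd] by simp
    ultimately show "k \<in> {k \<in> KY i. L (Suc i) (block_start (KY i) k) = s}" using L_rows_perm by simp
  qed
  moreover have "rows_perm i s = ?e" by (rule rows_perm_small[OF assms])
  moreover have "s \<le> ?p" using rows_perm_ge[of "Suc i" s] assms by simp
  ultimately show ?thesis by (simp add: d_def)
qed

definition A :: "nat \<Rightarrow> nat \<Rightarrow> graph" where
  "A i s = {p \<in> rows_ge Y i. passes (rows_ge Y i) s p}"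

definition W :: "nat \<Rightarrow> nat \<Rightarrow> nat list" where
  "W i s = rev (sorted_list_of_multiset (image_mset fst (mset_set (A i s))))"

lemma rows_ge_le: "i \<le> a \<Longrightarrow> rows_ge (rows_ge Y i) a = rows_ge Y a" by (auto simp: rows_ge_def)

lemma labels_rows_ge: "i \<le> a \<Longrightarrow> labels (rows_ge Y i) a = KY a" by (auto simp: rows_ge_def labels_def)

lemma A_eq:
  assumes "1 \<le> i" "s \<le> r"
  shows "A i s = {(a, b). (a, b) \<in> Y \<and> i \<le> a \<and> L (Suc a) (block_start (KY a) (a + b - 1)) = s}"
proof -
  have "passes (rows_ge Y i) s (a, b) \<longleftrightarrow> L (Suc a) (block_start (KY a) (a + b - 1)) = s"
    if ab: "(a, b) \<in> Y" "i \<le> a" for a b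
  proof -
    have p: "1 \<le> a" "1 \<le> b" using ab pg by (auto simp: pos_graph_def)
    have k: "a + b - 1 \<in> KY a" using labels_iff[OF pg p(2)] ab by simp
    have "r < L (Suc a) (Suc (a + b - 1))" by (rule cross(2)[OF p(1) k])
    then have "L (Suc a) (a + b) \<noteq> s" using p assms by simp
    moreover have "strand_line (rows_ge Y i) (Suc a) = L (Suc a)" unfolding strand_line_def using rows_ge_le[of i "Suc a"] ab by simp
    ultimately show ?thesis unfolding passes_def
      using enters_left_iff[OF pos_graph_rows_ge[OF pg]] enters_below_iff[OF pos_graph_rows_ge[OF pg]] p labels_rows_ge[OF ab(2)]
      by auto
  qed
  then show ?thesis unfolding A_def by (auto simp: rows_ge_def)
qed

lemma finite_A: "finite (A i s)"
proof -
  have "A i s \<subseteq> Y" by (auto simp: A_def rows_ge_def)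
  then show ?thesis using pg finite_subset by (auto simp: pos_graph_def)
qed

lemma sorted_list_add_min:
  assumes "\<forall>x\<in>#M. (i::nat) < x"
  shows "sorted_list_of_multiset (M + replicate_mset c i) = replicate c i @ sorted_list_of_multiset M"
proof -
  have "sorted (replicate c i @ sorted_list_of_multiset M)"
    using assms by (auto simp: sorted_append sorted_replicate less_imp_le)
  moreover have "mset (replicate c i @ sorted_list_of_multiset M) = M + replicate_mset c i"
    by simp
  ultimately show ?thesis by (metis sorted_list_of_multiset_mset sorted_sort_id)
qed

text \<open>Row \<open>i\<close> adds only letters \<open>i\<close>, smaller than all letters from
  the rows below. In weakly decreasing order they come last, just as the boxes added to a row of the
  shape are its rightmost ones.\<close>

lemma W_rec:
  assumes "1 \<le> i" "s \<le> r"
  shows "W i s = W (Suc i) s @ replicate (d i s - d (Suc i) s) i"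
proof -
  let ?B = "{(a, b). (a, b) \<in> Y \<and> a = i \<and> L (Suc i) (block_start (KY i) (i + b - 1)) = s}"
  have i2: "1 \<le> Suc i" by simp
  have un: "A i s = A (Suc i) s \<union> ?B"
  proof (rule set_eqI)
    fix x :: "nat \<times> nat"
    obtain a b where x: "x = (a, b)" by fastforce
    have "i \<le> a \<longleftrightarrow> Suc i \<le> a \<or> a = i" by auto
    then show "x \<in> A i s \<longleftrightarrow> x \<in> A (Suc i) s \<union> ?B"
      unfolding A_eq[OF assms] A_eq[OF i2 assms(2)] x by auto
  qed
  have dis: "A (Suc i) s \<inter> ?B = {}" unfolding A_eq[OF i2 assms(2)] by auto
  have fB: "finite ?B" by (rule finite_subset[OF _ finite_A[of i s]]) (use un in simp)
  have inj: "inj_on (\<lambda>(a, b). a + b - 1) ?B"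
  proof (rule inj_onI)
    fix x y assume x: "x \<in> ?B" and y: "y \<in> ?B" and e: "(\<lambda>(a, b). a + b - 1) x = (\<lambda>(a, b). a + b - 1) y"
    from x y obtain b b' where b: "x = (i, b)" "y = (i, b')" "(i, b) \<in> Y" "(i, b') \<in> Y" by auto
    have "1 \<le> b" "1 \<le> b'" using b(3,4) pg by (auto simp: pos_graph_def)
    then show "x = y" using e b by simp
  qed
  have "(\<lambda>(a, b). a + b - 1) ` ?B = {k \<in> KY i. L (Suc i) (block_start (KY i) k) = s}"
  proof (intro equalityI subsetI)
    fix k assume "k \<in> (\<lambda>(a, b). a + b - 1) ` ?B"
    then obtain b where "(i, b) \<in> Y" "L (Suc i) (block_start (KY i) (i + b - 1)) = s" "k = i + b - 1" by auto
    then show "k \<in> {k \<in> KY i. L (Suc i) (block_start (KY i) k) = s}" unfolding labels_def by blast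
  next
    fix k assume k: "k \<in> {k \<in> KY i. L (Suc i) (block_start (KY i) k) = s}"
    then obtain b where b: "(i, b) \<in> Y" "k = i + b - 1" unfolding labels_def by blast
    then have "(i, b) \<in> ?B" using k by simp
    then show "k \<in> (\<lambda>(a, b). a + b - 1) ` ?B" using b(2) by (intro image_eqI[of _ _ "(i, b)"]) auto
  qed
  then have cB: "card ?B = d i s - d (Suc i) s" using card_image[OF inj] card_fibre[OF assms] by simp
  have "image_mset fst (mset_set ?B) = image_mset (\<lambda>_. i) (mset_set ?B)"
    by (rule image_mset_cong) (use fB in auto)
  also have "\<dots> = replicate_mset (d i s - d (Suc i) s) i"
    using cB by (simp add: image_mset_const_eq)
  finally have mB: "image_mset fst (mset_set ?B) = replicate_mset (d i s - d (Suc i) s) i" .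
  have "mset_set (A i s) = mset_set (A (Suc i) s) + mset_set ?B"
    unfolding un by (rule mset_set_Union[OF finite_A fB dis])
  then have m: "image_mset fst (mset_set (A i s)) =
    image_mset fst (mset_set (A (Suc i) s)) + replicate_mset (d i s - d (Suc i) s) i"
    using mB by simp
  have "\<forall>x\<in>#image_mset fst (mset_set (A (Suc i) s)). i < x"
    using finite_A[of "Suc i" s] A_eq[OF i2 assms(2)] by auto
  then show ?thesis unfolding W_def m by (simp add: sorted_list_add_min)
qed

lemma W_empty: "r < i \<Longrightarrow> W i s = []"
  using rows_empty[of i] by (simp add: W_def A_def)

lemma W_len_mem:
  assumes s: "s \<le> r"
  shows "1 \<le> i \<Longrightarrow> length (W i s) = d i s \<and> (\<forall>x\<in>set (W i s). i \<le> x)"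
proof -
  have "1 \<le> i \<longrightarrow> length (W i s) = d i s \<and> (\<forall>x\<in>set (W i s). i \<le> x)" if "i \<le> Suc r" for i
    using that
  proof (induction i rule: inc_induct)
    case base show ?case using W_empty[of "Suc r"] rows_perm_empty[of "Suc r"] by (simp add: d_def)
  next
    case (step i)
    show ?case
    proof
      assume i: "1 \<le> i"
      have ih: "length (W (Suc i) s) = d (Suc i) s" "\<forall>x\<in>set (W (Suc i) s). Suc i \<le> x" using step by auto
      then show "length (W i s) = d i s \<and> (\<forall>x\<in>set (W i s). i \<le> x)"
        using W_rec[OF i s] d_mono[OF i s] by auto
    qed
  qed
  moreover assume "1 \<le> i"
  ultimately show ?thesis using W_empty[of i] rows_perm_empty[of i] by (cases "i \<le> Suc r") (auto simp: d_def)
qed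

lemma W_nth:
  assumes i: "1 \<le> i" and s: "s \<le> r" and t: "t < d i s"
  shows "W i s ! t = i \<longleftrightarrow> d (Suc i) s \<le> t"
proof -
  have l: "length (W (Suc i) s) = d (Suc i) s" "\<forall>x\<in>set (W (Suc i) s). Suc i \<le> x" using W_len_mem[OF s, of "Suc i"] by auto
  show ?thesis
  proof (cases "t < d (Suc i) s")
    case True
    then have "W i s ! t = W (Suc i) s ! t" using W_rec[OF i s] l by (simp add: nth_append)
    moreover have "W (Suc i) s ! t \<in> set (W (Suc i) s)" using True l by simp
    ultimately have "Suc i \<le> W i s ! t" using l by simp
    then show ?thesis using True by simp
  next
    case False
    then show ?thesis using W_rec[OF i s] l t by (simp add: nth_append)
  qed
qed

lemma boxes_sh: "boxes (sh i) = concat (map (\<lambda>s. map (\<lambda>q. (r + 1 - s, q)) [1..<d i s + 1]) [1..<r + 1])"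
proof -
  have rv: "rev [1..<r + 1] = map (\<lambda>s. r + 1 - s) [1..<r + 1]"
    by (rule nth_equalityI) (auto simp: rev_nth simp del: upt_Suc)
  have "boxes (sh i) = concat (map (\<lambda>s. map (\<lambda>j. (r + 1 - s, j)) [1..<sh i ! (r + 1 - s - 1) + 1]) [1..<r + 1])"
    unfolding boxes_def length_sh rv by (simp add: o_def del: upt_Suc)
  also have "\<dots> = concat (map (\<lambda>s. map (\<lambda>q. (r + 1 - s, q)) [1..<d i s + 1]) [1..<r + 1])"
  proof (rule arg_cong[where f = concat], rule map_cong[OF refl])
    fix s assume "s \<in> set [1..<r + 1]"
    then have s: "1 \<le> s" "s \<le> r" by auto
    then have "sh i ! (r + 1 - s - 1) = d i s" using sh_nth[of "r + 1 - s" i] by simp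
    then show "map (\<lambda>j. (r + 1 - s, j)) [1..<sh i ! (r + 1 - s - 1) + 1] = map (\<lambda>q. (r + 1 - s, q)) [1..<d i s + 1]" by simp
  qed
  finally show ?thesis .
qed

lemma word_sh:
  assumes i: "1 \<le> i"
  shows "word_of r (rows_ge Y i) = map (\<lambda>(p, q). W i (r + 1 - p) ! (q - 1)) (boxes (sh i))"
proof -
  have "W i s = map (\<lambda>(p, q). W i (r + 1 - p) ! (q - 1)) (map (\<lambda>q. (r + 1 - s, q)) [1..<d i s + 1])"
    if "s \<in> set [1..<r + 1]" for s
  proof (rule nth_equalityI)
    have s: "1 \<le> s" "s \<le> r" using that by auto
    show "length (W i s) = length (map (\<lambda>(p, q). W i (r + 1 - p) ! (q - 1)) (map (\<lambda>q. (r + 1 - s, q)) [1..<d i s + 1]))"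
      using W_len_mem[OF s(2) i] by simp
    fix t assume "t < length (W i s)"
    then have t: "t < d i s" using W_len_mem[OF s(2) i] by simp
    then show "W i s ! t = map (\<lambda>(p, q). W i (r + 1 - p) ! (q - 1)) (map (\<lambda>q. (r + 1 - s, q)) [1..<d i s + 1]) ! t"
      using s by (simp del: upt_Suc)
  qed
  then have "map (W i) [1..<r + 1] = map (\<lambda>s. map (\<lambda>(p, q). W i (r + 1 - p) ! (q - 1)) (map (\<lambda>q. (r + 1 - s, q)) [1..<d i s + 1])) [1..<r + 1]"
    by (intro map_cong refl)
  then have "concat (map (W i) [1..<r + 1]) =
    concat (map (\<lambda>s. map (\<lambda>(p, q). W i (r + 1 - p) ! (q - 1)) (map (\<lambda>q. (r + 1 - s, q)) [1..<d i s + 1])) [1..<r + 1])"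
    by (rule arg_cong)
  also have "\<dots> = map (\<lambda>(p, q). W i (r + 1 - p) ! (q - 1)) (boxes (sh i))"
    unfolding boxes_sh map_concat map_map comp_def by (rule refl)
  finally show ?thesis unfolding word_of_def W_def A_def .
qed

text \<open>This links the test of the algorithm, which compares a letter with the row number, to
  the distinction between new and old boxes used in the invariants.\<close>

lemma word_nth:
  assumes i: "1 \<le> i" and t: "t < length (boxes (sh i))"
  shows "word_of r (rows_ge Y i) ! t = i \<longleftrightarrow> boxes (sh i) ! t \<notin> set (boxes (sh (Suc i)))"
proof -
  obtain p q where pq: "boxes (sh i) ! t = (p, q)" by fastforce
  have "(p, q) \<in> set (boxes (sh i))" using pq t by (metis nth_mem)
  then have b: "1 \<le> p" "p \<le> r" "1 \<le> q" "q \<le> d i (r + 1 - p)" by (auto simp: sh_boxes)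
  have "word_of r (rows_ge Y i) ! t = W i (r + 1 - p) ! (q - 1)" using word_sh[OF i] t pq by simp
  moreover have "W i (r + 1 - p) ! (q - 1) = i \<longleftrightarrow> d (Suc i) (r + 1 - p) \<le> q - 1"
    by (rule W_nth[OF i]) (use b in auto)
  ultimately show ?thesis using b pq by (auto simp: sh_boxes)
qed

lemma length_boxes_sh: "length (boxes (sh i)) = (\<Sum>s\<in>{1..r}. d i s)"
proof -
  have "length (boxes (sh i)) = sum_list (map (d i) [1..<r + 1])"
    unfolding boxes_sh length_concat map_map by (simp add: o_def del: upt_Suc)
  also have "\<dots> = sum (d i) (set [1..<r + 1])" by (simp add: sum_list_distinct_conv_sum_set del: upt_Suc)
  also have "set [1..<r + 1] = {1..r}" by auto
  finally show ?thesis .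
qed

lemma card_KY:
  assumes i: "1 \<le> i"
  shows "card (KY i) + length (boxes (sh (Suc i))) = length (boxes (sh i))"
proof -
  let ?h = "\<lambda>k. L (Suc i) (block_start (KY i) k)"
  have "?h ` KY i \<subseteq> {1..r}"
  proof
    fix x assume "x \<in> ?h ` KY i"
    then obtain k where k: "k \<in> KY i" "x = ?h k" by blast
    have "block_start (KY i) k \<noteq> 0"
    proof
      assume a: "block_start (KY i) k = 0"
      have "0 \<in> KY i"
      proof (cases "k = 0")
        case False then show ?thesis using block_start_mem[of "KY i" k 0] a by simp
      qed (use k in simp)
      then show False using zero_labels[OF pg] by blast
    qed
    then have "1 \<le> x" using k fin_perm_zero[OF fpL, of "Suc i" "block_start (KY i) k"] by simp
    then show "x \<in> {1..r}" using cross(1)[OF i k(1)] k by simp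
  qed
  from sum.group[OF finK finite_atLeastAtMost this, of "\<lambda>_. 1::nat"]
  have "card (KY i) = (\<Sum>s\<in>{1..r}. card {k \<in> KY i. ?h k = s})" by (simp only: card_eq_sum)
  also have "\<dots> = (\<Sum>s\<in>{1..r}. d i s - d (Suc i) s)" by (rule sum.cong[OF refl]) (use card_fibre[OF i] in auto)
  finally have "card (KY i) + (\<Sum>s\<in>{1..r}. d (Suc i) s) = (\<Sum>s\<in>{1..r}. (d i s - d (Suc i) s) + d (Suc i) s)"
    by (simp add: sum.distrib)
  also have "\<dots> = (\<Sum>s\<in>{1..r}. d i s)" by (rule sum.cong[OF refl]) (use d_mono[OF i] in auto)
  finally show ?thesis by (simp add: length_boxes_sh)
qed

lemma card_rows_sh: "1 \<le> i \<Longrightarrow> card (rows_ge Y i) = length (boxes (sh i))"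
proof -
  have "1 \<le> i \<longrightarrow> card (rows_ge Y i) = length (boxes (sh i))" if "i \<le> Suc r" for i
    using that
  proof (induction i rule: inc_induct)
    case base show ?case using rows_empty[of "Suc r"] boxes_empty[of "Suc r"] by simp
  next
    case (step i) then show ?case using card_KY[of i] card_rows_ge[OF pg, of i] by simp
  qed
  moreover assume "1 \<le> i"
  ultimately show ?thesis using rows_empty[of i] boxes_empty[of i] by (cases "i \<le> Suc r") auto
qed

lemma hook_sh:
  assumes "is_hook (sh 1)" "1 \<le> i"
  shows "is_hook (sh i)"
  unfolding is_hook_def
proof
  have le: "d i s \<le> d 1 s" if "1 \<le> i" "s \<le> r" for s i
    using that(1)
  proof (induction i rule: dec_induct)
    case (step n) then show ?case using d_mono[of n s] that by simp
  qed simp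
  fix x assume "x \<in> set (tl (sh i))"
  then obtain a where a: "a < length (tl (sh i))" "x = tl (sh i) ! a" by (metis in_set_conv_nth)
  then have ar: "Suc a < r" by simp
  have x: "x = sh i ! Suc a" using a nth_tl[of a "sh i"] ar by simp
  have "sh i ! Suc a \<le> sh 1 ! Suc a"
    using sh_nth[of "Suc (Suc a)"] ar le[OF assms(2), of "r + 1 - Suc (Suc a)"] by simp
  moreover have "sh 1 ! Suc a \<in> set (tl (sh 1))"
    using nth_mem[of a "tl (sh 1)"] nth_tl[of a "sh 1"] ar by (simp del: One_nat_def add: less_diff_conv)
  ultimately show "x \<le> 1" using assms(1) x unfolding is_hook_def by force
qed

end

lemma shuffle_graphI:
  assumes sh: "is_shuffle r v" and Y: "Y \<in> RC v" and r: "1 \<le> r"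
  shows "shuffle_graph r Y"
proof
  show rc: "rc_graph Y" using Y by (simp add: RC_def)
  show "1 \<le> r" by (rule r)
  have pg: "pos_graph Y" using rc by (simp add: rc_graph_iff)
  have v: "fin_perm v" "\<And>i. 1 \<le> i \<Longrightarrow> i \<noteq> r \<Longrightarrow> v i < v (Suc i)" using sh by (auto simp: is_shuffle_def fin_perm_S_inf)
  have L: "strand_line Y 1 = inv v" using Y rows_ge_1[OF pg] by (simp add: strand_line_def RC_def)
  have inc: "v s < v (s + Suc n)" if "1 \<le> s" "s + Suc n \<le> r \<or> r < s" for s n
    using that(2)
  proof (induction n)
    case 0 then show ?case using v(2)[of s] that(1) by auto
  next
    case (Suc n)
    then have "v s < v (s + Suc n)" by auto
    also have "v (s + Suc n) < v (Suc (s + Suc n))" using Suc.prems that(1) by (intro v(2)) auto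
    finally show ?case by simp
  qed
  have inc': "v s < v s'" if "s < s'" "1 \<le> s" "s' \<le> r \<or> r < s" for s s'
    using inc[of s "s' - s - 1"] that by simp
  note fi = f_inv_fin_perm[OF v(1)]
  have "inv v p < inv v q" if pq: "p < q" and b: "r < inv v p \<and> r < inv v q \<or> inv v p \<le> r \<and> inv v q \<le> r" for p q
  proof (rule ccontr)
    assume n: "\<not> inv v p < inv v q"
    have "inv v p \<noteq> inv v q" using fi pq by (metis nat_neq_iff)
    then have lt: "inv v q < inv v p" using n by simp
    have "inv v q \<noteq> 0" using fi[of q] fin_perm_zero[OF v(1), of "inv v q"] pq by auto
    then have "v (inv v q) < v (inv v p)" using lt b by (intro inc') auto
    then show False using fi pq by simp
  qed
  then show "shuffled r (strand_line Y 1)" unfolding L shuffled_def big_sorted_def by blast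
qed

section \<open>Removing crossings\<close>

lemma pos_graph_subset: "pos_graph G \<Longrightarrow> H \<subseteq> G \<Longrightarrow> pos_graph H"
  by (auto simp: pos_graph_def finite_subset)

lemma labels_remove:
  assumes "pos_graph G" "(i, j) \<in> G"
  shows "labels (G - {(i, j)}) a = (if a = i then labels G i - {i + j - 1} else labels G a)"
proof -
  have j: "1 \<le> j" "1 \<le> i" using assms by (auto simp: pos_graph_def)
  have "k \<in> labels (G - {(i, j)}) i \<longleftrightarrow> k \<in> labels G i - {i + j - 1}" for k
  proof
    assume "k \<in> labels (G - {(i, j)}) i"
    then obtain b where b: "(i, b) \<in> G" "b \<noteq> j" "k = i + b - 1" by (auto simp: labels_def)
    then have "1 \<le> b" using assms by (auto simp: pos_graph_def)
    then have "k \<noteq> i + j - 1" using b j by linarith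
    then show "k \<in> labels G i - {i + j - 1}" using b by (auto simp: labels_def)
  next
    assume "k \<in> labels G i - {i + j - 1}"
    then obtain b where "(i, b) \<in> G" "k = i + b - 1" "b \<noteq> j" by (auto simp: labels_def)
    then show "k \<in> labels (G - {(i, j)}) i" by (auto simp: labels_def)
  qed
  then show ?thesis by (auto simp: labels_def)
qed

lemma strand_line_above:
  assumes "rows_ge G (Suc i) = rows_ge H (Suc i)"
  shows "strand_line G (Suc i) = strand_line H (Suc i)"
  using assms by (simp add: strand_line_def)

text \<open>Without the crossing the two strands trade their continuations, so every line above it
  changes by exchanging the names \<open>a\<close> and \<open>b\<close>.\<close>

lemma strand_line_remove:
  assumes G: "pos_graph G" and p: "(i, j) \<in> G"
  defines "a \<equiv> strand_line G (Suc i) (block_start (labels G i) (i + j - 1))" and "b \<equiv> strand_line G (Suc i) (i + j)"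
  shows "m \<le> i \<Longrightarrow> strand_line (G - {(i, j)}) m = transpose a b \<circ> strand_line G m"
proof (induction m rule: inc_induct)
  case base
  have j: "1 \<le> j" "1 \<le> i" using G p by (auto simp: pos_graph_def)
  have G': "pos_graph (G - {(i, j)})" by (rule pos_graph_subset[OF G]) auto
  have e: "strand_line (G - {(i, j)}) (Suc i) = strand_line G (Suc i)" by (rule strand_line_above) (auto simp: rows_ge_def)
  have k: "i + j - 1 \<in> labels G i" using labels_iff[OF G j(1)] p by simp
  have sk: "Suc (i + j - 1) = i + j" using j by simp
  have l: "labels (G - {(i, j)}) i = labels G i - {i + j - 1}" using labels_remove[OF G p, of i] by simp
  have "strand_line (G - {(i, j)}) i = strand_line G (Suc i) \<circ> transpose (block_start (labels G i) (i + j - 1)) (i + j) \<circ> sigma (labels G i)"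
    unfolding strand_line_rec[OF G', of i] e l sigma_remove[OF k] sk by (simp only: comp_assoc)
  also have "\<dots> = transpose a b \<circ> strand_line G i"
    unfolding strand_line_rec[OF G, of i] a_def b_def transpose_comp_fin_perm[OF fin_perm_strand_line[OF G], symmetric] by (simp only: comp_assoc)
  finally show ?case .
next
  case (step n)
  have G': "pos_graph (G - {(i, j)})" by (rule pos_graph_subset[OF G]) auto
  have l: "labels (G - {(i, j)}) n = labels G n" using labels_remove[OF G p, of n] step by simp
  show ?case unfolding strand_line_rec[OF G', of n] strand_line_rec[OF G, of n] l step.IH by (simp only: comp_assoc)
qed

lemma inv_strand_line: "pos_graph G \<Longrightarrow> strand_line G i (inv (strand_line G i) a) = a"
  by (rule f_inv_fin_perm[OF fin_perm_strand_line])

lemma inv_strand_line_eq: "pos_graph G \<Longrightarrow> strand_line G i p = a \<Longrightarrow> inv (strand_line G i) a = p"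
  using inv_fin_perm_f[OF fin_perm_strand_line] by metis

lemma inv_strand_line_rec:
  assumes "pos_graph G"
  shows "inv (strand_line G i) a = rho (labels G i) (inv (strand_line G (Suc i)) a)"
proof (rule inv_strand_line_eq[OF assms])
  show "strand_line G i (rho (labels G i) (inv (strand_line G (Suc i)) a)) = a"
    unfolding strand_line_rec[OF assms, of i] comp_apply sigma_rho[OF finite_labels[OF assms]] by (rule inv_strand_line[OF assms])
qed

lemma crossing_of_iff:
  assumes G: "rc_graph G" and ab: "a < b"
  shows "crossing_of G a b (i, j) \<longleftrightarrow> (i, j) \<in> G \<and>
     a = strand_line G (Suc i) (block_start (labels G i) (i + j - 1)) \<and> b = strand_line G (Suc i) (i + j)"
proof
  have pg: "pos_graph G" using G by (simp add: rc_graph_iff)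
  assume c: "crossing_of G a b (i, j)"
  then have p: "(i, j) \<in> G" by (simp add: crossing_of_def)
  have j: "1 \<le> j" "1 \<le> i" using pg p by (auto simp: pos_graph_def)
  have k: "i + j - 1 \<in> labels G i" using labels_iff[OF pg j(1)] p by simp
  have "reduced_row (labels G i) (strand_line G (Suc i))" using G j by (simp add: rc_graph_iff)
  then have "strand_line G (Suc i) (block_start (labels G i) (i + j - 1)) < strand_line G (Suc i) (i + j)"
    using k j unfolding reduced_row_def by force
  then show "(i, j) \<in> G \<and> a = strand_line G (Suc i) (block_start (labels G i) (i + j - 1)) \<and> b = strand_line G (Suc i) (i + j)"
    using c ab p strands_at_iff[OF pg] unfolding crossing_of_def by auto
next
  have pg: "pos_graph G" using G by (simp add: rc_graph_iff)
  assume c: "(i, j) \<in> G \<and> a = strand_line G (Suc i) (block_start (labels G i) (i + j - 1)) \<and> b = strand_line G (Suc i) (i + j)"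
  have "1 \<le> j" "1 \<le> i" using pg c by (auto simp: pos_graph_def)
  then show "crossing_of G a b (i, j)" using c strands_at_iff[OF pg] unfolding crossing_of_def by auto
qed

lemma inverted_stays:
  assumes G: "rc_graph G" and ab: "a < b" and inv: "inv (strand_line G i) b < inv (strand_line G i) a"
  shows "m \<le> i \<Longrightarrow> 1 \<le> m \<Longrightarrow> inv (strand_line G m) b < inv (strand_line G m) a"
proof (induction m rule: inc_induct)
  case base show ?case by (rule inv)
next
  case (step n)
  have pg: "pos_graph G" using G by (simp add: rc_graph_iff)
  have reduced_row: "reduced_row (labels G n) (strand_line G (Suc n))" using G step.prems by (simp add: rc_graph_iff)
  have lt: "inv (strand_line G (Suc n)) b < inv (strand_line G (Suc n)) a" by (rule step.IH) simp
  show ?case unfolding inv_strand_line_rec[OF pg, of n]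
    by (rule row_order[OF finite_labels[OF pg] reduced_row lt]) (use inv_strand_line[OF pg] ab in simp)
qed

lemma crossing_inverts:
  assumes G: "rc_graph G" and ab: "a < b" and c: "crossing_of G a b (i, j)"
  shows "inv (strand_line G i) b < inv (strand_line G i) a" "inv (strand_line G (Suc i)) a < inv (strand_line G (Suc i)) b" "1 \<le> i"
proof -
  have pg: "pos_graph G" using G by (simp add: rc_graph_iff)
  have c': "(i, j) \<in> G" "a = strand_line G (Suc i) (block_start (labels G i) (i + j - 1))" "b = strand_line G (Suc i) (i + j)"
    using c crossing_of_iff[OF G ab] by auto
  show i: "1 \<le> i" using pg c' by (auto simp: pos_graph_def)
  have j: "1 \<le> j" using pg c' by (auto simp: pos_graph_def)
  let ?K = "labels G i" let ?k = "i + j - 1"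
  have k: "?k \<in> ?K" using labels_iff[OF pg j] c' by simp
  note fin = finite_labels[OF pg, of i]
  have ia: "inv (strand_line G (Suc i)) a = block_start ?K ?k" by (rule inv_strand_line_eq[OF pg]) (simp add: c'(2))
  have ib: "inv (strand_line G (Suc i)) b = i + j" by (rule inv_strand_line_eq[OF pg]) (simp add: c'(3))
  show "inv (strand_line G (Suc i)) a < inv (strand_line G (Suc i)) b" unfolding ia ib using block_start_le[of ?K ?k] j i by linarith
  have rb: "rho ?K (i + j) = ?k" using k j i by (simp add: rho_def)
  have hd: "block_start ?K ?k = 0 \<or> block_start ?K ?k - 1 \<notin> ?K" using block_start_pred by auto
  have ra: "rho ?K (block_start ?K ?k) = block_end ?K (block_start ?K ?k)" by (rule rho_head[OF hd])
  have "?k < block_end ?K (block_start ?K ?k)"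
  proof (rule ccontr)
    assume n: "\<not> ?k < block_end ?K (block_start ?K ?k)"
    let ?e = "block_end ?K (block_start ?K ?k)"
    have e: "block_start ?K ?k \<le> ?e" "?e \<notin> ?K" using block_end_props[OF fin] by auto
    have "?e \<noteq> ?k" using e k by metis
    then have "?e \<in> ?K" using block_start_mem[of ?K ?k ?e] e n by simp
    then show False using e by simp
  qed
  then show "inv (strand_line G i) b < inv (strand_line G i) a" unfolding inv_strand_line_rec[OF pg, of i] ia ib rb ra .
qed

text \<open>The strands start in order and end inverted, so some row reverses them, and by
  \<open>rho_less\<close> they cross there. By \<open>inverted_stays\<close> this happens in one row
  only, and within that row the position of \<open>b\<close> determines the place.\<close>

lemma crossing_unique:
  assumes G: "rc_graph G" and ab: "a < b" and inv: "inv (strand_line G 1) b < inv (strand_line G 1) a"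
  shows "\<exists>!p. crossing_of G a b p"
proof -
  have pg: "pos_graph G" using G by (simp add: rc_graph_iff)
  have "1 \<le> i \<longrightarrow> inv (strand_line G i) b < inv (strand_line G i) a \<longrightarrow> (\<exists>p. crossing_of G a b p)" for i
    using pg
  proof (induction i rule: graph_down_induct)
    case (base i) then show ?case using ab by (simp add: strand_line_empty inv_id)
  next
    case (step i)
    show ?case
    proof (intro impI)
      assume i: "1 \<le> i" and iv: "inv (strand_line G i) b < inv (strand_line G i) a"
      let ?p = "inv (strand_line G (Suc i)) a" let ?q = "inv (strand_line G (Suc i)) b" let ?K = "labels G i"
      show "\<exists>p. crossing_of G a b p"
      proof (cases "?q < ?p")
        case True then show ?thesis using step i by simp
      next
        case False
        have "?p \<noteq> ?q" using inv_strand_line[OF pg] ab by (metis nat_neq_iff)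
        then have pq: "?p < ?q" using False by simp
        note fin = finite_labels[OF pg, of i]
        have h: "block_start ?K ?q = ?p"
        proof (rule ccontr)
          assume "block_start ?K ?q \<noteq> ?p"
          then have "rho ?K ?p < rho ?K ?q" by (rule rho_less[OF fin pq])
          then show False using iv inv_strand_line_rec[OF pg, of i] by simp
        qed
        have k: "?q - 1 \<in> ?K" using block_start_mem[of ?K ?q "?q - 1"] h pq by simp
        then have iq: "i \<le> ?q - 1" using labels_ge[OF pg] by simp
        let ?j = "?q - i"
        have j: "1 \<le> ?j" "i + ?j - 1 = ?q - 1" "i + ?j = ?q" using iq i by auto
        have inG: "(i, ?j) \<in> G" using labels_iff[OF pg j(1), of i] k j by simp
        have "block_start ?K (?q - 1) = ?p" using block_start_same[of ?K ?q "?q - 1"] h pq by simp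
        then have "crossing_of G a b (i, ?j)"
          unfolding crossing_of_iff[OF G ab] j using inG inv_strand_line[OF pg] by simp
        then show ?thesis by blast
      qed
    qed
  qed
  then have ex: "\<exists>p. crossing_of G a b p" using inv by blast
  have "p = p'" if c: "crossing_of G a b p" "crossing_of G a b p'" for p p'
  proof -
    obtain i j i' j' where p: "p = (i, j)" "p' = (i', j')" by fastforce
    have d: "crossing_of G a b (i, j)" "crossing_of G a b (i', j')" using c p by auto
    note X = crossing_inverts[OF G ab d(1)] note X' = crossing_inverts[OF G ab d(2)]
    have "\<not> i' < i"
    proof
      assume "i' < i"
      then have "inv (strand_line G (Suc i')) b < inv (strand_line G (Suc i')) a" by (intro inverted_stays[OF G ab X(1)]) auto
      then show False using X'(2) by simp
    qed
    moreover have "\<not> i < i'"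
    proof
      assume "i < i'"
      then have "inv (strand_line G (Suc i)) b < inv (strand_line G (Suc i)) a" by (intro inverted_stays[OF G ab X'(1)]) auto
      then show False using X(2) by simp
    qed
    ultimately have ii: "i = i'" by simp
    have "b = strand_line G (Suc i) (i + j)" "b = strand_line G (Suc i) (i + j')" using d crossing_of_iff[OF G ab] ii by auto
    then have "i + j = i + j'" using fin_perm_eq_iff[OF fin_perm_strand_line[OF pg]] by metis
    then show ?thesis using p ii by simp
  qed
  then show ?thesis using ex by blast
qed

lemma the_unique_eq: "Q x \<Longrightarrow> (\<And>y. Q y \<Longrightarrow> y = x) \<Longrightarrow> the_unique Q = Some x"
proof -
  assume a: "Q x" "\<And>y. Q y \<Longrightarrow> y = x"
  have "\<exists>!x. Q x" by (rule ex1I[of Q, OF a])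
  moreover have "(THE x. Q x) = x" by (rule the_equality[of Q, OF a])
  ultimately show ?thesis by (simp add: the_unique_def)
qed

text \<open>The removal takes away one crossing and, by \<open>strand_line_remove\<close>, undoes a
  swap worth one inversion. The two numbers still agree, so the smaller graph is reduced.\<close>

lemma remove_crossing:
  assumes G: "rc_graph G" and y: "fin_perm y" and c: "bcover r y P Q"
    and line: "strand_line G 1 = y \<circ> transpose P Q" and n: "ninv (strand_line G 1) = Suc (ninv y)"
  obtains p where "the_unique (crossing_of G (y P) (y Q)) = Some p" "p \<in> G" "rc_graph (G - {p})"
    "strand_line (G - {p}) 1 = y"
proof -
  have pg: "pos_graph G" using G by (simp add: rc_graph_iff)
  have PQ: "1 \<le> P" "P < Q" "y P < y Q" using c by (auto simp: bcover_def)
  have "strand_line G 1 Q = y P" "strand_line G 1 P = y Q" using line by auto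
  then have "inv (strand_line G 1) (y P) = Q" "inv (strand_line G 1) (y Q) = P" using inv_strand_line_eq[OF pg] by blast+
  then have iv: "inv (strand_line G 1) (y Q) < inv (strand_line G 1) (y P)" using PQ by (simp only:)
  have ex: "\<exists>!p. crossing_of G (y P) (y Q) p" by (rule crossing_unique[OF G PQ(3) iv])
  then obtain i j where p: "crossing_of G (y P) (y Q) (i, j)" by fastforce
  have u: "the_unique (crossing_of G (y P) (y Q)) = Some (i, j)"
    by (rule the_unique_eq[of "crossing_of G (y P) (y Q)", OF p]) (use ex p in blast)
  have c': "(i, j) \<in> G" "y P = strand_line G (Suc i) (block_start (labels G i) (i + j - 1))" "y Q = strand_line G (Suc i) (i + j)"
    using p crossing_of_iff[OF G PQ(3)] by auto
  have i: "1 \<le> i" using pg c' by (auto simp: pos_graph_def)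
  have pg': "pos_graph (G - {(i, j)})" by (rule pos_graph_subset[OF pg]) auto
  have "strand_line (G - {(i, j)}) 1 = transpose (y P) (y Q) \<circ> strand_line G 1"
    using strand_line_remove[OF pg c'(1) i] c'(2,3) by simp
  also have "\<dots> = transpose (y P) (y Q) \<circ> (transpose (y P) (y Q) \<circ> y)"
    unfolding line transpose_comp_fin_perm[OF y] ..
  also have "\<dots> = y" by (simp add: fun_eq_iff)
  finally have l: "strand_line (G - {(i, j)}) 1 = y" .
  have fin: "finite G" using pg by (simp add: pos_graph_def)
  have cG: "card G = ninv (strand_line G 1)"
    using ninv_strand_line[OF pg, of 1] G rows_ge_1[OF pg] by (auto simp: rc_graph_iff)
  have "card (G - {(i, j)}) = ninv y" using card_Suc_Diff1[OF fin c'(1)] cG n by simp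
  then have "rc_graph (G - {(i, j)})"
    using pg' cox_length_graph[OF pg', of 1] rows_ge_1[OF pg'] l unfolding rc_graph_def pos_graph_def by simp
  then show thesis using u c'(1) l by (intro that)
qed

section \<open>Bruhat packages expressed by chains of lines\<close>

definition transp_prod :: "(nat \<times> nat) list \<Rightarrow> nat \<Rightarrow> nat" where
  "transp_prod es = foldr (\<lambda>(a, b) u. transpose a b \<circ> u) es id"

lemma transp_prod_snoc: "transp_prod (es @ [(a, b)]) = transp_prod es \<circ> transpose a b"
  by (induction es) (auto simp: transp_prod_def fun_eq_iff)

lemma inv_transp_prod:
  assumes w: "fin_perm w"
  shows "\<forall>(a, b)\<in>set es. 1 \<le> a \<and> 1 \<le> b \<Longrightarrow> fin_perm (w \<circ> transp_prod es) \<and> inv (w \<circ> transp_prod es) = chain_line es (inv w)"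
proof (induction es rule: rev_induct)
  case Nil then show ?case using w by (simp add: transp_prod_def)
next
  case (snoc x xs)
  obtain a b where x: "x = (a, b)" by fastforce
  have ab: "1 \<le> a" "1 \<le> b" using snoc.prems x by auto
  have xs: "\<forall>(a, b)\<in>set xs. 1 \<le> a \<and> 1 \<le> b" using snoc.prems by auto
  note ih = conjunct1[OF snoc.IH[OF xs]] conjunct2[OF snoc.IH[OF xs]]
  have e: "w \<circ> transp_prod (xs @ [x]) = (w \<circ> transp_prod xs) \<circ> transpose a b" unfolding x transp_prod_snoc by (simp only: comp_assoc)
  have 1: "fin_perm (w \<circ> transp_prod (xs @ [x]))" unfolding e by (rule fin_perm_comp[OF ih(1) fin_perm_transpose[OF ab]])
  have 2: "inv (w \<circ> transp_prod (xs @ [x])) = chain_line (xs @ [x]) (inv w)"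
    unfolding e inv_comp_transpose[OF ih(1) ab] ih(2) unfolding x chain_line_snoc ..
  show ?case using 1 2 by (rule conjI)
qed

lemma tab_perm_transp_prod: "tab_perm i T = transp_prod (take i (entries T))" by (simp add: tab_perm_def transp_prod_def)

lemma chain_transp:
  assumes "\<forall>(a, b)\<in>set es. 1 \<le> a \<and> a \<le> r \<and> r < b"
  shows "\<forall>(a, b)\<in>set (take i es). 1 \<le> a \<and> 1 \<le> (b::nat)"
  using assms by (fastforce dest: in_set_takeD)

lemma inv_tab:
  assumes w: "fin_perm w" and t: "\<forall>(a, b)\<in>set (entries T). 1 \<le> a \<and> a \<le> r \<and> r < b"
  shows "inv (w \<circ> tab_perm i T) = chain_line (take i (entries T)) (inv w)" "fin_perm (w \<circ> tab_perm i T)"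
    "cox_length (w \<circ> tab_perm i T) = ninv (chain_line (take i (entries T)) (inv w))"
  using inv_transp_prod[OF w chain_transp[OF t, of i]] cox_length_ninv unfolding tab_perm_transp_prod by auto

lemma bruhat_chain_iff:
  assumes w: "fin_perm w"
  shows "bruhat_chain r w T \<longleftrightarrow> length (entries T) \<le> length (boxes (shape T)) \<and> chain_ok r (inv w) (entries T)"
proof (cases "\<forall>(a, b)\<in>set (entries T). 1 \<le> a \<and> a \<le> r \<and> r < b")
  case True
  have c: "cox_length w = ninv (inv w)" by (rule cox_length_ninv[OF w])
  have "(\<forall>i\<in>{1..length (entries T)}. cox_length (w \<circ> tab_perm i T) = cox_length w + i) \<longleftrightarrow>
    (\<forall>i\<le>length (entries T). ninv (chain_line (take i (entries T)) (inv w)) = ninv (inv w) + i)"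
    unfolding inv_tab(3)[OF w True] c by (auto simp: Suc_le_eq)
  then show ?thesis using True unfolding bruhat_chain_def transp_tableau_def chain_ok_def by auto
next
  case False then show ?thesis unfolding bruhat_chain_def transp_tableau_def chain_ok_def by auto
qed

lemma graph_perm_strand_line: "pos_graph G \<Longrightarrow> inv (graph_perm G) = strand_line G 1"
  using rows_ge_1 by (simp add: strand_line_def)

lemma bruhat_package_iff:
  assumes w: "fin_perm w"
  shows "bruhat_package r (w, G, T) \<longleftrightarrow> rc_graph G \<and> length (entries T) \<le> length (boxes (shape T)) \<and>
    chain_ok r (inv w) (entries T) \<and> strand_line G 1 = chain_line (entries T) (inv w)"
proof -
  have "w \<circ> full_perm T = graph_perm G \<longleftrightarrow> strand_line G 1 = chain_line (entries T) (inv w)"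
    if G: "rc_graph G" and c: "chain_ok r (inv w) (entries T)"
  proof -
    have pg: "pos_graph G" using G by (simp add: rc_graph_iff)
    have t: "\<forall>(a, b)\<in>set (entries T). 1 \<le> a \<and> a \<le> r \<and> r < b" using c by (simp add: chain_ok_def)
    note it = inv_tab[OF w t, of "length (entries T)"]
    have i: "inv (w \<circ> full_perm T) = chain_line (entries T) (inv w)" using it(1) by (simp add: full_perm_def)
    have "w \<circ> full_perm T = graph_perm G \<longleftrightarrow> inv (w \<circ> full_perm T) = inv (graph_perm G)"
      using inv_inv_fin_perm[OF it(2)] inv_inv_fin_perm[OF fin_perm_graph[OF pg]] unfolding full_perm_def by metis
    then show ?thesis unfolding i graph_perm_strand_line[OF pg] by auto
  qed
  then show ?thesis unfolding bruhat_package_def bruhat_chain_iff[OF w] prod.case by blast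
qed

lemma S_down_step:
  assumes w: "fin_perm w" and P: "bruhat_package r (w, G, T)" and k: "k < length (entries T)"
    and d: "S_down r (w, G, T) k = Some B" and B: "rc_graph B"
    and l: "strand_line B 1 = chain_line (take (length (entries T) - k) (entries T)) (inv w)"
  obtains p where "p \<in> B" "S_down r (w, G, T) (Suc k) = Some (B - {p})" "rc_graph (B - {p})"
    "strand_line (B - {p}) 1 = chain_line (take (length (entries T) - Suc k) (entries T)) (inv w)"
proof -
  let ?es = "entries T" let ?n = "length ?es - Suc k"
  have ok: "chain_ok r (inv w) ?es" using P bruhat_package_iff[OF w] by simp
  have n: "?n < length ?es" "length ?es - k = Suc ?n" using k by auto
  obtain a b where ab: "?es ! ?n = (a, b)" by fastforce
  have tk: "take (Suc ?n) ?es = take ?n ?es @ [(a, b)]" using take_Suc_conv_app_nth[OF n(1)] ab by simp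
  have ok': "chain_ok r (inv w) (take ?n ?es @ [(a, b)])"
    unfolding tk[symmetric] using ok unfolding chain_ok_def
    by (auto simp: min_def dest: in_set_takeD)
  let ?y = "chain_line (take ?n ?es) (inv w)"
  note cb = chain_bcover[OF fin_perm_inv[OF w] ok']
  have y: "fin_perm ?y" using fin_perm_chain_line[OF fin_perm_inv[OF w]] ok' by (auto simp: chain_ok_snoc)
  have line: "strand_line B 1 = ?y \<circ> transpose (inv ?y a) (inv ?y b)" unfolding l n(2) tk cb(4) ..
  have nn: "ninv (strand_line B 1) = Suc (ninv ?y)"
    unfolding l n(2) tk using chain_ok_ninv[OF ok'] ok' chain_ok_ninv[of r "inv w" "take ?n ?es"] by (simp add: chain_ok_snoc)
  obtain p where p: "the_unique (crossing_of B a b) = Some p" "p \<in> B" "rc_graph (B - {p})" "strand_line (B - {p}) 1 = ?y"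
    using remove_crossing[OF B y cb(1) line nn] unfolding cb(2,3) by metis
  have "S_down r (w, G, T) (Suc k) = Some (B - {p})"
    using d p ab by (simp add: Let_def)
  then show thesis using p by (intro that)
qed

lemma S_down_all:
  assumes w: "fin_perm w" and P: "bruhat_package r (w, G, T)"
  shows "k \<le> length (entries T) \<Longrightarrow> \<exists>B. S_down r (w, G, T) k = Some B \<and> rc_graph B \<and>
    strand_line B 1 = chain_line (take (length (entries T) - k) (entries T)) (inv w)"
proof (induction k)
  case 0
  then show ?case using P bruhat_package_iff[OF w] by simp
next
  case (Suc k)
  then obtain B where B: "S_down r (w, G, T) k = Some B" "rc_graph B"
    "strand_line B 1 = chain_line (take (length (entries T) - k) (entries T)) (inv w)" by auto
  have k: "k < length (entries T)" using Suc by simp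
  show ?case by (rule S_down_step[OF w P k B]) blast
qed

text \<open>Read backwards, the removals give a sequence of graphs from \<open>B 0\<close> up to
  \<open>B m = G\<close> that grows by one crossing at a time. The next row pass replays it in this
  order when it brings the old crossings back.\<close>

lemma S_graph_family:
  assumes w: "fin_perm w" and P: "bruhat_package r (w, G, T)"
  defines "m \<equiv> length (entries T)"
  obtains B where "\<forall>j\<le>m. S_graph r (w, G, T) j = Some (B j)" "\<forall>j\<le>m. rc_graph (B j)"
    "\<forall>j\<le>m. strand_line (B j) 1 = chain_line (take j (entries T)) (inv w)"
    "\<forall>j<m. \<exists>p. p \<notin> B j \<and> B (Suc j) = insert p (B j)" "B m = G"
proof -
  define B where "B j = the (S_graph r (w, G, T) j)" for j
  have ex: "\<exists>C. S_graph r (w, G, T) j = Some C \<and> rc_graph C \<and> strand_line C 1 = chain_line (take j (entries T)) (inv w)"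
    if "j \<le> m" for j
    using S_down_all[OF w P, of "m - j"] that by (simp add: S_graph_def m_def)
  have B: "S_graph r (w, G, T) j = Some (B j)" "rc_graph (B j)" "strand_line (B j) 1 = chain_line (take j (entries T)) (inv w)"
    if "j \<le> m" for j using ex[OF that] unfolding B_def by auto
  have step: "\<exists>p. p \<notin> B j \<and> B (Suc j) = insert p (B j)" if j: "j < m" for j
  proof -
    have k: "m - Suc j < m" using j by simp
    have d: "S_down r (w, G, T) (m - Suc j) = Some (B (Suc j))" using B(1)[of "Suc j"] j by (simp add: S_graph_def m_def)
    have e: "m - (m - Suc j) = Suc j" using j by simp
    have l: "strand_line (B (Suc j)) 1 = chain_line (take (length (entries T) - (m - Suc j)) (entries T)) (inv w)"
      using B(3)[of "Suc j"] j e unfolding m_def by simp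
    have s: "S_down r (w, G, T) (Suc (m - Suc j)) = Some (B j)" using B(1)[of j] j by (simp add: S_graph_def m_def Suc_diff_Suc)
    obtain p where "p \<in> B (Suc j)" "S_down r (w, G, T) (Suc (m - Suc j)) = Some (B (Suc j) - {p})"
      using S_down_step[OF w P k[unfolded m_def] d[unfolded m_def] B(2)[of "Suc j"]] l[unfolded m_def] j unfolding m_def
      by (metis Suc_leI)
    then have "B j = B (Suc j) - {p}" "p \<in> B (Suc j)" using s by auto
    then show ?thesis by (intro exI[of _ p]) auto
  qed
  have "B m = G" using P B(1)[of m] by (simp add: S_graph_def m_def)
  then show thesis using B step by (intro that[of B]) auto
qed

section \<open>Steps of the algorithm on graphs\<close>

text \<open>\<open>B\<close> is the part of the graph below row \<open>l\<close>, and label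
  \<open>k\<close> of row \<open>l\<close> sits in column \<open>k + 1 - l\<close>. The truncated
  subtraction is harmless under \<open>row_base\<close>, which demands
  \<open>l <= k\<close>.\<close>

definition add_row :: "nat \<Rightarrow> graph \<Rightarrow> nat set \<Rightarrow> graph" where
  "add_row l B K = B \<union> (\<lambda>k. (l, k + 1 - l)) ` K"

definition row_base :: "nat \<Rightarrow> graph \<Rightarrow> nat set \<Rightarrow> bool" where
  "row_base l B K \<longleftrightarrow> 1 \<le> l \<and> rc_graph B \<and> (\<forall>p\<in>B. l < fst p) \<and> finite K \<and> (\<forall>k\<in>K. l \<le> k)"

lemma add_row_mem: "row_base l B K \<Longrightarrow> 1 \<le> j \<Longrightarrow> (l, j) \<in> add_row l B K \<longleftrightarrow> l + j - 1 \<in> K"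
proof -
  assume b: "row_base l B K" and j: "1 \<le> j"
  have "(l, j) \<notin> B" using b by (auto simp: row_base_def)
  moreover have "(l, j) \<in> (\<lambda>k. (l, k + 1 - l)) ` K \<longleftrightarrow> l + j - 1 \<in> K"
  proof
    assume "(l, j) \<in> (\<lambda>k. (l, k + 1 - l)) ` K"
    then obtain k where k: "k \<in> K" "j = k + 1 - l" by auto
    have "l \<le> k" using b k(1) by (auto simp: row_base_def)
    then show "l + j - 1 \<in> K" using k by simp
  next
    assume "l + j - 1 \<in> K"
    moreover have "j = l + j - 1 + 1 - l" using j by simp
    ultimately show "(l, j) \<in> (\<lambda>k. (l, k + 1 - l)) ` K" by (intro image_eqI[of _ _ "l + j - 1"]) auto
  qed
  ultimately show ?thesis unfolding add_row_def by blast
qed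

lemma pos_graph_add_row: "row_base l B K \<Longrightarrow> pos_graph (add_row l B K)"
  unfolding add_row_def row_base_def pos_graph_def rc_graph_iff by fastforce

lemma labels_add_row: "row_base l B K \<Longrightarrow> labels (add_row l B K) l = K"
proof -
  assume b: "row_base l B K"
  show ?thesis
  proof (intro equalityI subsetI)
    fix k assume "k \<in> labels (add_row l B K) l"
    then obtain j where j: "(l, j) \<in> add_row l B K" "k = l + j - 1" by (auto simp: labels_def)
    then have "1 \<le> j" using pos_graph_add_row[OF b] by (auto simp: pos_graph_def)
    then show "k \<in> K" using add_row_mem[OF b] j by simp
  next
    fix k assume k: "k \<in> K"
    then have lk: "l \<le> k" using b by (auto simp: row_base_def)
    have "(l, k + 1 - l) \<in> add_row l B K" using k unfolding add_row_def by blast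
    moreover have "k = l + (k + 1 - l) - 1" using lk by simp
    ultimately show "k \<in> labels (add_row l B K) l" unfolding labels_def by blast
  qed
qed

lemma rows_ge_add_row: "row_base l B K \<Longrightarrow> rows_ge (add_row l B K) (Suc l) = B"
  unfolding add_row_def row_base_def rows_ge_def by auto

lemma rows_ge_base: "row_base l B K \<Longrightarrow> rows_ge B (Suc l) = B"
  unfolding row_base_def rows_ge_def by auto

lemma labels_add_row_other: "i \<noteq> l \<Longrightarrow> labels (add_row l B K) i = labels B i"
  unfolding add_row_def labels_def by auto

lemma strand_line_add_row_Suc: "row_base l B K \<Longrightarrow> strand_line (add_row l B K) (Suc l) = strand_line B (Suc l)"
  by (rule strand_line_above) (simp add: rows_ge_add_row rows_ge_base)

lemma sigma_empty: "sigma {} = id"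
  by (auto simp: sigma_def block_start_self_iff)

lemma strand_line_const:
  assumes G: "pos_graph G" and mi: "m \<le> i" and e: "\<And>a. m \<le> a \<Longrightarrow> a < i \<Longrightarrow> labels G a = {}"
  shows "strand_line G m = strand_line G i"
  using mi e
proof (induction m rule: inc_induct)
  case (step n)
  have "strand_line G (Suc n) = strand_line G i" using step by simp
  then show ?case using step.prems[of n] step.hyps unfolding strand_line_rec[OF G, of n] by (simp add: sigma_empty)
qed simp

lemma row_base_pos_graph: "row_base l B K \<Longrightarrow> pos_graph B" by (simp add: row_base_def rc_graph_iff)

lemma strand_line_base: assumes "row_base l B K" shows "strand_line B 1 = strand_line B (Suc l)"
  by (rule strand_line_const[OF row_base_pos_graph[OF assms]]) (use assms in \<open>force simp: labels_def row_base_def\<close>)+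

lemma strand_line_add_row:
  assumes b: "row_base l B K"
  shows "strand_line (add_row l B K) 1 = strand_line B (Suc l) \<circ> sigma K" "strand_line (add_row l B K) l = strand_line B (Suc l) \<circ> sigma K"
proof -
  note pg = pos_graph_add_row[OF b]
  show l: "strand_line (add_row l B K) l = strand_line B (Suc l) \<circ> sigma K"
    unfolding strand_line_rec[OF pg, of l] strand_line_add_row_Suc[OF b] labels_add_row[OF b] ..
  have "strand_line (add_row l B K) 1 = strand_line (add_row l B K) l"
  proof (rule strand_line_const[OF pg])
    show "1 \<le> l" using b by (simp add: row_base_def)
    fix a assume "a < l"
    then have "labels (add_row l B K) a = labels B a" by (intro labels_add_row_other) simp
    also have "labels B a = {}" using b \<open>a < l\<close> by (force simp: labels_def row_base_def)
    finally show "labels (add_row l B K) a = {}" .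
  qed
  then show "strand_line (add_row l B K) 1 = strand_line B (Suc l) \<circ> sigma K" using l by simp
qed

lemma rc_add_row:
  assumes b: "row_base l B K"
  shows "rc_graph (add_row l B K) \<longleftrightarrow> reduced_row K (strand_line B (Suc l))"
proof -
  note pg = pos_graph_add_row[OF b]
  have "reduced_row (labels (add_row l B K) i) (strand_line (add_row l B K) (Suc i))" if "1 \<le> i" "i \<noteq> l" for i
  proof (cases "l < i")
    case True
    have "rows_ge (add_row l B K) (Suc i) = rows_ge B (Suc i)" using True unfolding add_row_def rows_ge_def by auto
    then have "strand_line (add_row l B K) (Suc i) = strand_line B (Suc i)" by (rule strand_line_above)
    then show ?thesis unfolding labels_add_row_other[OF that(2)] using b that by (simp add: row_base_def rc_graph_iff)
  next
    case False
    then have "labels B i = {}" using b that by (force simp: labels_def row_base_def)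
    then show ?thesis unfolding labels_add_row_other[OF that(2)] by (simp add: reduced_row_def)
  qed
  then have "(\<forall>i\<ge>1. reduced_row (labels (add_row l B K) i) (strand_line (add_row l B K) (Suc i))) \<longleftrightarrow> reduced_row (labels (add_row l B K) l) (strand_line (add_row l B K) (Suc l))"
    using b unfolding row_base_def by metis
  then show ?thesis unfolding rc_graph_iff labels_add_row[OF b] strand_line_add_row_Suc[OF b] using pg by simp
qed

lemma strands_add_row:
  assumes b: "row_base l B K"
  shows "strands_at (add_row l B K) c d l j \<longleftrightarrow> 1 \<le> j \<and> c = strand_line B (Suc l) (block_start K (l + j - 1)) \<and> d = strand_line B (Suc l) (l + j)"
  using b unfolding strands_at_iff[OF pos_graph_add_row[OF b]] labels_add_row[OF b] strand_line_add_row_Suc[OF b] by (auto simp: row_base_def)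

lemma add_row_insert: "l \<le> k \<Longrightarrow> insert (l, k + 1 - l) (add_row l B K) = add_row l B (insert k K)"
  unfolding add_row_def by auto

lemma add_row_remove:
  assumes "row_base l B K" "k \<in> K"
  shows "add_row l B K - {(l, k + 1 - l)} = add_row l B (K - {k})"
proof -
  have k: "l \<le> k" using assms by (auto simp: row_base_def)
  have inj: "inj_on (\<lambda>k. (l, k + 1 - l)) K"
    using assms by (auto simp: inj_on_def row_base_def)
  have "(\<lambda>k. (l, k + 1 - l)) ` (K - {k}) = (\<lambda>k. (l, k + 1 - l)) ` K - (\<lambda>k. (l, k + 1 - l)) ` {k}"
    by (rule inj_on_image_set_diff[OF inj]) (use assms in auto)
  moreover have "(l, k + 1 - l) \<notin> B" using assms by (auto simp: row_base_def)
  ultimately show ?thesis unfolding add_row_def by auto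
qed

lemma rightmost_eq:
  assumes "Q j c d" "\<And>j' c' d'. Q j' c' d' \<Longrightarrow> j' \<le> j" "\<And>c' d'. Q j c' d' \<Longrightarrow> c' = c \<and> d' = d"
  shows "rightmost Q = Some (j, c, d)"
  unfolding rightmost_def
proof (rule the_unique_eq)
  have *: "\<forall>j' c' d'. Q j' c' d' \<longrightarrow> j' \<le> j" using assms(2) by blast
  show "case (j, c, d) of (j, c, d) \<Rightarrow> Q j c d \<and> (\<forall>j' c' d'. Q j' c' d' \<longrightarrow> j' \<le> j)"
    unfolding prod.case using assms(1) * by (rule conjI)
  fix y assume y: "case y of (j, c, d) \<Rightarrow> Q j c d \<and> (\<forall>j' c' d'. Q j' c' d' \<longrightarrow> j' \<le> j)"
  obtain j' c' d' where e: "y = (j', c', d')" by (cases y)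
  note q = y[unfolded e prod.case]
  have "j \<le> j'" using conjunct2[OF q] assms(1) by blast
  then have "j' = j" using assms(2)[OF conjunct1[OF q]] by simp
  then show "y = (j, c, d)" using e conjunct1[OF q] assms(3) by simp
qed

text \<open>A position \<open>Suc k <= l\<close> carries the strand \<open>Suc k <= r\<close>. So a
  label whose vertical strand is \<open>> r\<close> always belongs to an actual column, and
  searching among labels is the same as searching among places.\<close>

lemma big_label:
  assumes b: "row_base l B K" and lr: "l \<le> r" and big: "r < strand_line B (Suc l) (Suc k)"
  shows "l \<le> k"
proof (rule ccontr)
  assume "\<not> l \<le> k"
  then have "strand_line B (Suc l) (Suc k) = Suc k" by (intro strand_line_low[OF row_base_pos_graph[OF b]]) simp
  then show False using big lr \<open>\<not> l \<le> k\<close> by simp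
qed

lemma rightmost_add_row:
  assumes b: "row_base l B K" and lr: "l \<le> r"
    and k: "k \<notin> K" "r < strand_line B (Suc l) (Suc k)" "k < k0" "strand_line B (Suc l) (block_start K k) \<le> r \<or> strand_line B (Suc l) (block_start K k) \<in> N"
    and mx: "\<And>k'. k' < k0 \<Longrightarrow> k' \<notin> K \<Longrightarrow> r < strand_line B (Suc l) (Suc k') \<Longrightarrow>
       strand_line B (Suc l) (block_start K k') \<le> r \<or> strand_line B (Suc l) (block_start K k') \<in> N \<Longrightarrow> k' \<le> k"
    and C: "\<And>j. 1 \<le> j \<Longrightarrow> C j \<longleftrightarrow> l + j - 1 < k0"
  shows "rightmost (\<lambda>j c d. C j \<and> (l, j) \<notin> add_row l B K \<and> strands_at (add_row l B K) c d l j \<and> r < d \<and> (c \<le> r \<or> c \<in> N)) =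
    Some (k + 1 - l, strand_line B (Suc l) (block_start K k), strand_line B (Suc l) (Suc k))"
proof (rule rightmost_eq)
  let ?j = "k + 1 - l"
  have lk: "l \<le> k" by (rule big_label[OF b lr k(2)])
  have l1: "1 \<le> l" using b by (simp add: row_base_def)
  have j: "1 \<le> ?j" "l + ?j - 1 = k" "l + ?j = Suc k" using lk by auto
  show "C ?j \<and> (l, ?j) \<notin> add_row l B K \<and> strands_at (add_row l B K) (strand_line B (Suc l) (block_start K k)) (strand_line B (Suc l) (Suc k)) l ?j \<and>
    r < strand_line B (Suc l) (Suc k) \<and> (strand_line B (Suc l) (block_start K k) \<le> r \<or> strand_line B (Suc l) (block_start K k) \<in> N)"
    using C[OF j(1)] add_row_mem[OF b j(1)] strands_add_row[OF b] j k by simp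
  fix c d
  assume "C ?j \<and> (l, ?j) \<notin> add_row l B K \<and> strands_at (add_row l B K) c d l ?j \<and> r < d \<and> (c \<le> r \<or> c \<in> N)"
  then show "c = strand_line B (Suc l) (block_start K k) \<and> d = strand_line B (Suc l) (Suc k)" using strands_add_row[OF b] j by simp
next
  fix j c d
  assume a: "C j \<and> (l, j) \<notin> add_row l B K \<and> strands_at (add_row l B K) c d l j \<and> r < d \<and> (c \<le> r \<or> c \<in> N)"
  have l1: "1 \<le> l" using b by (simp add: row_base_def)
  have j: "1 \<le> j" "c = strand_line B (Suc l) (block_start K (l + j - 1))" "d = strand_line B (Suc l) (l + j)" using a strands_add_row[OF b] by auto
  have s: "Suc (l + j - 1) = l + j" using j l1 by simp
  have "l + j - 1 \<le> k"
    by (rule mx) (use a C[OF j(1)] add_row_mem[OF b j(1)] j s in auto)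
  then show "j \<le> k + 1 - l" by simp
qed

lemma insertion_add_row:
  assumes b: "row_base l B K" and lr: "l \<le> r" and k: "ins_at r (strand_line B (Suc l)) K k"
  shows "insertion_step r l (add_row l B K, T) =
    Some (add_row l B (insert k K), push T (strand_line B (Suc l) (block_start K k), strand_line B (Suc l) (Suc k)))" "l \<le> k"
proof -
  let ?f = "strand_line B (Suc l)"
  have a: "k \<notin> K" "r < ?f (Suc k)" "?f (block_start K k) \<le> r"
    "\<And>k'. k' \<notin> K \<Longrightarrow> r < ?f (Suc k') \<Longrightarrow> ?f (block_start K k') \<le> r \<Longrightarrow> k' \<le> k"
    using k by (auto simp: ins_at_def allowed_def)
  show lk: "l \<le> k" by (rule big_label[OF b lr a(2)])
  have l1: "1 \<le> l" using b by (simp add: row_base_def)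
  have j: "1 \<le> k + 1 - l" "l + (k + 1 - l) - 1 = k" "l + (k + 1 - l) = Suc k" using lk by auto
  have "rightmost (\<lambda>j c d. (l, j) \<notin> add_row l B K \<and> strands_at (add_row l B K) c d l j \<and> c \<le> r \<and> r < d) =
    Some (k + 1 - l, ?f (block_start K k), ?f (Suc k))"
  proof (rule rightmost_eq)
    show "(l, k + 1 - l) \<notin> add_row l B K \<and> strands_at (add_row l B K) (?f (block_start K k)) (?f (Suc k)) l (k + 1 - l) \<and>
      ?f (block_start K k) \<le> r \<and> r < ?f (Suc k)"
      using add_row_mem[OF b j(1)] strands_add_row[OF b] j a by simp
  next
    fix c d assume "(l, k + 1 - l) \<notin> add_row l B K \<and> strands_at (add_row l B K) c d l (k + 1 - l) \<and> c \<le> r \<and> r < d"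
    then show "c = ?f (block_start K k) \<and> d = ?f (Suc k)" using strands_add_row[OF b] j by simp
  next
    fix j c d assume h: "(l, j) \<notin> add_row l B K \<and> strands_at (add_row l B K) c d l j \<and> c \<le> r \<and> r < d"
    have j: "1 \<le> j" "c = ?f (block_start K (l + j - 1))" "d = ?f (l + j)" using h strands_add_row[OF b] by auto
    have s: "Suc (l + j - 1) = l + j" using j l1 by simp
    have "l + j - 1 \<le> k" by (rule a(4)) (use h add_row_mem[OF b j(1)] j s in auto)
    then show "j \<le> k + 1 - l" by simp
  qed
  then show "insertion_step r l (add_row l B K, T) =
    Some (add_row l B (insert k K), push T (?f (block_start K k), ?f (Suc k)))"
    unfolding insertion_step_def using add_row_insert[OF lk, of B K] by simp
qed

lemma E_tab_chain_entries:
  assumes w: "fin_perm wl" and c: "chain_ok r (inv wl) es"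
  shows "E_tab wl (Tableau lam es) = Tableau lam (chain_entries (inv wl) es)"
proof -
  have t: "\<forall>(a, b)\<in>set (entries (Tableau lam es)). 1 \<le> a \<and> a \<le> r \<and> r < b" using c by (simp add: chain_ok_def)
  have e: "wl \<circ> tab_perm i (Tableau lam es) = inv (chain_line (take i es) (inv wl))" for i
    using inv_tab(1)[OF w t, of i] inv_inv_fin_perm[OF inv_tab(2)[OF w t, of i]] by simp
  have "map (\<lambda>i. (wl \<circ> tab_perm i (Tableau lam es)) (snd (es ! (i - 1)))) [1..<length es + 1] = chain_entries (inv wl) es"
    unfolding e chain_entries_def by (rule nth_equalityI) (auto simp del: upt_Suc)
  then show ?thesis by (simp add: E_tab_def del: upt_Suc)
qed

lemma strict_iff:
  assumes len: "length E \<le> length (boxes lam)"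
  shows "row_strict (Tableau lam E) \<and> col_strict (Tableau lam E) \<longleftrightarrow> strictE lam E"
proof
  let ?b = "boxes lam"
  assume a: "row_strict (Tableau lam E) \<and> col_strict (Tableau lam E)"
  show "strictE lam E" unfolding strictE_def
  proof (intro allI impI)
    fix k k' assume k: "k < length E" "k' < k"
    have bf: "before (?b ! k') (?b ! k)" using boxes_before[of k' k lam] k len by simp
    have r: "fst (?b ! k') = fst (?b ! k) \<longrightarrow> snd (?b ! k') < snd (?b ! k) \<longrightarrow> E ! k' < E ! k"
      using a k unfolding row_strict_def by (auto simp: Let_def)
    have c: "snd (?b ! k) = snd (?b ! k') \<longrightarrow> fst (?b ! k) < fst (?b ! k') \<longrightarrow> E ! k < E ! k'"
      using a k unfolding col_strict_def by (auto simp: Let_def)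
    show "(fst (?b ! k') = fst (?b ! k) \<longrightarrow> E ! k' < E ! k) \<and> (snd (?b ! k') = snd (?b ! k) \<longrightarrow> E ! k < E ! k')"
      using r c bf unfolding before_def by auto
  qed
next
  let ?b = "boxes lam"
  assume s: "strictE lam E"
  have r: "E ! k < E ! k'" if "k < length E" "k' < length E" "fst (?b ! k) = fst (?b ! k')" "snd (?b ! k) < snd (?b ! k')" for k k'
  proof -
    have "before (?b ! k) (?b ! k')" using that by (simp add: before_def)
    then have "k < k'" using boxes_before_iff[of k lam k'] that len by simp
    then show ?thesis using s that unfolding strictE_def by auto
  qed
  have c: "E ! k < E ! k'" if "k < length E" "k' < length E" "snd (?b ! k) = snd (?b ! k')" "fst (?b ! k) < fst (?b ! k')" for k k'
  proof -
    have "before (?b ! k') (?b ! k)" using that by (simp add: before_def)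
    then have "k' < k" using boxes_before_iff[of k' lam k] that len by simp
    then show ?thesis using s that unfolding strictE_def by auto
  qed
  show "row_strict (Tableau lam E) \<and> col_strict (Tableau lam E)"
    unfolding row_strict_def col_strict_def Let_def tableau.sel using r c by (simp add: less_imp_le)
qed

lemma package_add_row:
  assumes b: "row_base l B K" and w: "fin_perm wl" and S: "row_state r (inv wl) (strand_line B (Suc l)) K es"
    and len: "length es \<le> length (boxes lam)"
  shows "bruhat_package r (wl, add_row l B K, Tableau lam es)"
  unfolding bruhat_package_iff[OF w] rc_add_row[OF b] strand_line_add_row(1)[OF b] using row_stateD[OF S] len by simp

text \<open>The decisions of the algorithm agree with the rules of \<open>rect_out\<close>: in
  \<open>head\<close> the test fails because the graph is not reduced, in \<open>column\<close>
  because strictness fails, and in \<open>column\<close> the strands \<open>b\<close> and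
  \<open>a\<close> have no crossing in the row, so the second instruction is the one followed. The
  count of labels in the conclusion comes from comparing inversions before and after.\<close>

lemma rect_add_row:
  assumes o: "rect_out r g (strictE lam) f K es P Q K' es'"
    and b: "row_base l B K" and b': "row_base l (insert p B) K" and lr: "l \<le> r"
    and f: "f = strand_line B (Suc l)" "strand_line (insert p B) (Suc l) = f \<circ> transpose P Q"
    and w: "fin_perm wl" "inv wl = g" and len: "length es < length (boxes lam)"
    and S: "row_state r g f K es" and c: "bcover r f P Q" and S': "row_state r g (f \<circ> transpose P Q) K' es'"
    and n: "ninv (f \<circ> transpose P Q) = Suc (ninv f)"
  shows "rectification_step r wl l p (f P, f Q) (add_row l B K, Tableau lam es) =
    Some (add_row l (insert p B) K', Tableau lam es') \<and> row_base l (insert p B) K' \<and>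
    card K' + Suc (length es) = card K + length es'"
proof -
  let ?B = "insert p B" let ?f = "f \<circ> transpose P Q" let ?T = "push (Tableau lam es) (f P, f Q)"
  note D = row_stateD[OF S] note D' = row_stateD[OF S']
  have PQ: "1 \<le> P" "P < Q" "f P \<le> r" "r < f Q" using c by (auto simp: bcover_def)
  have l1: "1 \<le> l" using b by (simp add: row_base_def)
  have f': "fin_perm ?f" using D PQ by (intro fin_perm_comp fin_perm_transpose) auto
  have R': "insert p (add_row l B K) = add_row l ?B K" by (auto simp: add_row_def)
  have T': "?T = Tableau lam (es @ [(f P, f Q)])" by (simp add: push_def)
  have count_before: "card K' + Suc (length es) = card K + length es'" using D(9) D'(9) n by linarith
  \<comment> \<open>The step of the algorithm is cut into the test, the choice \<open>sel\<close> of
    the crossing to remove and the search \<open>rest\<close>; the last is shared by both kinds of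
    removal.\<close>
  define test where "test \<longleftrightarrow> row_strict (E_tab wl ?T) \<and> col_strict (E_tab wl ?T) \<and> bruhat_package r (wl, add_row l ?B K, ?T)"
  define hc where "hc = (\<lambda>x y. h_cross (add_row l ?B K) x y l)"
  have hc: "hc x y j \<longleftrightarrow> 1 \<le> j \<and> l + j - 1 \<in> K \<and> x = ?f (block_start K (l + j - 1)) \<and> y = ?f (l + j)" for x y j
    unfolding hc_def h_cross_def strands_add_row[OF b'] f(2) using add_row_mem[OF b', of j] by auto
  define sel where "sel = (if \<exists>j. hc (f Q) (f P) j
          then do { j \<leftarrow> the_unique (hc (f Q) (f P)); Some (j, Tableau lam es) }
          else if es \<noteq> [] \<and> fst (last es) = f P
          then do { j \<leftarrow> the_unique (hc (f Q) (snd (last es)));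
                    Some (j, set_last (Tableau lam es) (f P, f Q)) }
          else None)"
  define rest where "rest = (\<lambda>(j0, T'').
       let R'' = add_row l ?B K - {(l, j0)} in do {
       (j, c, d) \<leftarrow> rightmost (\<lambda>j c d. j < j0 \<and> (l, j) \<notin> R'' \<and> strands_at R'' c d l j \<and> r < d \<and>
         (c \<le> r \<or> (entries T'' \<noteq> [] \<and> c = snd (last (entries T'')))));
       Some (insert (l, j) R'',
         if c \<le> r then push T'' (c, d)
         else (let (e, g) = last (entries T'') in push (set_last T'' (e, d)) (e, g)))
     })"
  have step: "rectification_step r wl l p (f P, f Q) (add_row l B K, Tableau lam es) =
     (if test then Some (add_row l ?B K, ?T) else Option.bind sel rest)"
    unfolding rectification_step_def prod.case Let_def R' test_def sel_def hc_def rest_def tableau.sel by simp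
  have rest_eq: "rest (k0 + 1 - l, Tableau lam es1) = Some (add_row l ?B (insert k (K - {k0})), Tableau lam (put_entry r es1 (?f (block_start (K - {k0}) k)) (?f (Suc k))))
      \<and> row_base l ?B (insert k (K - {k0}))"
    if k0: "k0 \<in> K" and la: "last_allowed r ?f (K - {k0}) (last_name es1) k0 k" for k0 k es1
  proof -
    let ?K = "K - {k0}"
    have lk0: "l \<le> k0" using b k0 by (auto simp: row_base_def)
    have bb: "row_base l ?B ?K" using b' by (auto simp: row_base_def)
    have rem: "add_row l ?B K - {(l, k0 + 1 - l)} = add_row l ?B ?K" by (rule add_row_remove[OF b' k0])
    have la': "k \<notin> ?K" "r < ?f (Suc k)" "k < k0" "?f (block_start ?K k) \<le> r \<or> ?f (block_start ?K k) \<in> last_name es1"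
      "\<And>k'. k' < k0 \<Longrightarrow> k' \<notin> ?K \<Longrightarrow> r < ?f (Suc k') \<Longrightarrow> ?f (block_start ?K k') \<le> r \<or> ?f (block_start ?K k') \<in> last_name es1 \<Longrightarrow> k' \<le> k"
      using la by (auto simp: last_allowed_def allowed_def)
    have lk: "l \<le> k" by (rule big_label[OF bb lr]) (use la'(2) f(2) in simp)
    have "rightmost (\<lambda>j c d. j < k0 + 1 - l \<and> (l, j) \<notin> add_row l ?B ?K \<and> strands_at (add_row l ?B ?K) c d l j \<and> r < d \<and> (c \<le> r \<or> c \<in> last_name es1)) =
      Some (k + 1 - l, ?f (block_start ?K k), ?f (Suc k))"
      unfolding f(2)[symmetric]
    proof (rule rightmost_add_row[OF bb lr, of k k0])
      show "j < k0 + 1 - l \<longleftrightarrow> l + j - 1 < k0" if "1 \<le> j" for j using that lk0 l1 by auto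
    qed (use la' f(2) in auto)
    moreover have "c \<in> last_name es1 \<longleftrightarrow> es1 \<noteq> [] \<and> c = snd (last es1)" for c by (simp add: last_name_def)
    ultimately have rm: "rightmost (\<lambda>j c d. j < k0 + 1 - l \<and> (l, j) \<notin> add_row l ?B ?K \<and> strands_at (add_row l ?B ?K) c d l j \<and> r < d \<and>
         (c \<le> r \<or> (es1 \<noteq> [] \<and> c = snd (last es1)))) = Some (k + 1 - l, ?f (block_start ?K k), ?f (Suc k))" by simp
    have "rest (k0 + 1 - l, Tableau lam es1) = Some (insert (l, k + 1 - l) (add_row l ?B ?K),
         if ?f (block_start ?K k) \<le> r then push (Tableau lam es1) (?f (block_start ?K k), ?f (Suc k))
         else (let (e, g) = last es1 in push (set_last (Tableau lam es1) (e, ?f (Suc k))) (e, g)))"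
      unfolding rest_def prod.case Let_def rem tableau.sel rm by simp
    also have "insert (l, k + 1 - l) (add_row l ?B ?K) = add_row l ?B (insert k ?K)" by (rule add_row_insert[OF lk])
    also have "(if ?f (block_start ?K k) \<le> r then push (Tableau lam es1) (?f (block_start ?K k), ?f (Suc k))
         else (let (e, g) = last es1 in push (set_last (Tableau lam es1) (e, ?f (Suc k))) (e, g))) =
        Tableau lam (put_entry r es1 (?f (block_start ?K k)) (?f (Suc k)))"
      unfolding put_entry_def push_def set_last_def Let_def by (cases "last es1") auto
    finally show ?thesis using bb lk by (auto simp: row_base_def)
  qed
  have EE: "E_tab wl ?T = Tableau lam (chain_entries g (es @ [(f P, f Q)]))" "chain_entries g (es @ [(f P, f Q)]) = chain_entries g es @ [rho K P]"
    if ne: "block_start K Q \<noteq> P"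
  proof -
    note KS = keep_row_state[OF S c ne n]
    show "E_tab wl ?T = Tableau lam (chain_entries g (es @ [(f P, f Q)]))"
      unfolding T' using E_tab_chain_entries[OF w(1)] row_stateD(6)[OF KS(1)] w(2) by metis
    show "chain_entries g (es @ [(f P, f Q)]) = chain_entries g es @ [rho K P]" by (rule KS(2))
  qed
  have uniq: "j = j'" if "hc x y j" "hc x' y j'" for x x' y j j'
  proof -
    have "?f (l + j) = ?f (l + j')" using that hc by auto
    then show ?thesis using fin_perm_eq_iff[OF f'] by fastforce
  qed
  show ?thesis
    using o
  proof cases
    case keep
    have t: "strictE lam (chain_entries g (es @ [(f P, f Q)]))" using keep EE(2) by simp
    have "row_strict (E_tab wl ?T) \<and> col_strict (E_tab wl ?T)"
      unfolding EE(1)[OF keep(3)] by (subst strict_iff) (use t len in auto)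
    moreover have "bruhat_package r (wl, add_row l ?B K, ?T)"
      unfolding T' by (rule package_add_row[OF b' w(1)]) (use S' keep f(2) w(2) len in auto)
    ultimately have "test" by (simp add: test_def)
    then show ?thesis unfolding step using keep T' b' count_before by simp
  next
    case (head f1 K1 k)
    have ch: "Q - 1 \<in> K" "\<not> reduced_row K ?f" using cut_head[OF D(2,5) c head(3)] by auto
    have "\<not> rc_graph (add_row l ?B K)" unfolding rc_add_row[OF b'] f(2) by (rule ch(2))
    then have nt: "\<not> test" unfolding test_def T' bruhat_package_iff[OF w(1)] by simp
    let ?j = "Q - 1 + 1 - l"
    have lQ: "l \<le> Q - 1" using b ch(1) by (auto simp: row_base_def)
    have bq: "block_start K (Q - 1) = P" using block_start_same[of K Q "Q - 1"] head(3) PQ by auto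
    have j: "1 \<le> ?j" "l + ?j - 1 = Q - 1" "l + ?j = Q" using lQ PQ by auto
    have h: "hc (f Q) (f P) ?j" unfolding hc j bq using ch(1) j(1) by simp
    have "the_unique (hc (f Q) (f P)) = Some ?j" by (rule the_unique_eq[of "hc (f Q) (f P)", OF h]) (use uniq h in blast)
    then have sel: "sel = Some (?j, Tableau lam es)" using h unfolding sel_def by auto
    have la: "last_allowed r ?f (K - {Q - 1}) (last_name es) (Q - 1) k" using head by simp
    show ?thesis unfolding step using nt sel rest_eq[OF ch(1) la] head count_before by simp
  next
    case (column E f1 K1 es1 k)
    have nE: "\<not> strictE lam (chain_entries g (es @ [(f P, f Q)]))" using column EE(2) by simp
    have "\<not> (row_strict (E_tab wl ?T) \<and> col_strict (E_tab wl ?T))"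
      unfolding EE(1)[OF column(3)] by (subst strict_iff) (use nE len in auto)
    then have nt: "\<not> test" by (auto simp: test_def)
    have nh: "\<not> (\<exists>j. hc (f Q) (f P) j)"
    proof
      assume "\<exists>j. hc (f Q) (f P) j"
      then obtain j where j: "1 \<le> j" "l + j - 1 \<in> K" "f Q = ?f (block_start K (l + j - 1))" "f P = ?f (l + j)" unfolding hc by auto
      have "?f (l + j) = ?f Q" "?f (block_start K (l + j - 1)) = ?f P" using j(3,4) by simp_all
      then have e: "l + j = Q" "block_start K (l + j - 1) = P" using fin_perm_eq_iff[OF f'] by blast+
      have "block_start K (Suc (l + j - 1)) = P" using j(2) e(2) by simp
      then show False using column(3) e(1) l1 by simp
    qed
    have lE: "l \<le> E" using b column(7) by (auto simp: row_base_def)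
    let ?j = "E + 1 - l"
    have j: "1 \<le> ?j" "l + ?j - 1 = E" "l + ?j = Suc E" using lE by auto
    have EP: "P \<le> E" using block_start_le[of K E] column by simp
    have EQ: "Suc E \<noteq> Q" using column(3,7,8) by auto
    have "?f (Suc E) = snd (last es)" using EP EQ column(9) by (simp add: transpose_def)
    then have h: "hc (f Q) (snd (last es)) ?j" unfolding hc j using column j(1) by simp
    have "the_unique (hc (f Q) (snd (last es))) = Some ?j"
      by (rule the_unique_eq[of "hc (f Q) (snd (last es))", OF h]) (use uniq h in blast)
    moreover have "sel = (if es \<noteq> [] \<and> fst (last es) = f P
          then do { j \<leftarrow> the_unique (hc (f Q) (snd (last es)));
                    Some (j, set_last (Tableau lam es) (f P, f Q)) }
          else None)" unfolding sel_def by (rule if_not_P[OF nh])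
    ultimately have sel: "sel = Some (?j, Tableau lam es1)"
      using column by (simp add: set_last_def)
    have la: "last_allowed r ?f (K - {E}) (last_name es1) E k" using column by simp
    show ?thesis unfolding step using nt sel rest_eq[OF column(7) la] column count_before by simp
  qed
qed

section \<open>The algorithm\<close>

lemma before_unique:
  "sorted_wrt before xs \<Longrightarrow> sorted_wrt before ys \<Longrightarrow> set xs = set ys \<Longrightarrow> xs = ys"
proof (induction xs arbitrary: ys)
  case (Cons x xs)
  have asym: "\<not> (before a b \<and> before b a)" for a b by (auto simp: before_def)
  obtain y ys' where ys: "ys = y # ys'" using Cons.prems(3) by (cases ys) auto
  have px: "\<And>z. z \<in> set xs \<Longrightarrow> before x z" and py: "\<And>z. z \<in> set ys' \<Longrightarrow> before y z"
    using Cons.prems ys by auto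
  have xy: "x = y"
  proof (rule ccontr)
    assume "x \<noteq> y"
    then have "x \<in> set ys'" "y \<in> set xs" using Cons.prems(3) ys by auto
    then show False using px py asym by blast
  qed
  have "x \<notin> set xs" "x \<notin> set ys'" using px py xy asym by blast+
  then have "set xs = set ys'" using Cons.prems(3) ys xy by auto
  then show ?case using Cons.IH[of ys'] Cons.prems ys xy by simp
qed simp

lemma sorted_wrt_filter: "sorted_wrt R xs \<Longrightarrow> sorted_wrt R (filter Q xs)"
  by (induction xs) auto

lemma filter_boxes:
  assumes "set (boxes mu) \<subseteq> set (boxes lam)"
  shows "filter (\<lambda>x. x \<in> set (boxes mu)) (boxes lam) = boxes mu"
  by (rule before_unique) (use assms in \<open>auto intro: sorted_wrt_filter sorted_boxes\<close>)

text \<open>With \<open>M\<close> the boxes of the smaller diagram and the box at list index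
  \<open>i\<close> among them, this is its index in the list of boxes of the smaller diagram, one
  less than the box number called \<open>i_+\<close> in the algorithm.\<close>

definition count_before :: "'a list \<Rightarrow> 'a set \<Rightarrow> nat \<Rightarrow> nat" where
  "count_before xs M i = length (filter (\<lambda>x. x \<in> M) (take i xs))"

lemma count_before_0 [simp]: "count_before xs M 0 = 0" by (simp add: count_before_def)

lemma count_before_Suc: "i < length xs \<Longrightarrow> count_before xs M (Suc i) = (if xs ! i \<in> M then Suc (count_before xs M i) else count_before xs M i)"
  by (simp add: count_before_def take_Suc_conv_app_nth)

lemma count_before_mono: "i \<le> j \<Longrightarrow> count_before xs M i \<le> count_before xs M j"
proof -
  assume "i \<le> j"
  then have "take j xs = take i xs @ take (j - i) (drop i xs)" by (metis le_add_diff_inverse take_add)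
  then show ?thesis by (simp add: count_before_def)
qed

lemma count_before_less: "i < j \<Longrightarrow> j \<le> length xs \<Longrightarrow> xs ! i \<in> M \<Longrightarrow> count_before xs M i < count_before xs M j"
  using count_before_mono[of "Suc i" j xs M] count_before_Suc[of i xs M] by simp

lemma nth_count_before:
  assumes "i < length xs" "xs ! i \<in> M"
  shows "filter (\<lambda>x. x \<in> M) xs ! count_before xs M i = xs ! i" "count_before xs M i < length (filter (\<lambda>x. x \<in> M) xs)"
proof -
  have "xs = take i xs @ xs ! i # drop (Suc i) xs" using assms(1) by (rule id_take_nth_drop)
  then have f: "filter (\<lambda>x. x \<in> M) xs = filter (\<lambda>x. x \<in> M) (take i xs) @ xs ! i # filter (\<lambda>x. x \<in> M) (drop (Suc i) xs)"
    using assms(2) by (metis filter.simps(2) filter_append)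
  show "filter (\<lambda>x. x \<in> M) xs ! count_before xs M i = xs ! i" unfolding f count_before_def by simp
  show "count_before xs M i < length (filter (\<lambda>x. x \<in> M) xs)" unfolding f count_before_def by simp
qed

lemma chain_take: "chain_ok r g es \<Longrightarrow> chain_ok r g (take j es)"
  unfolding chain_ok_def by (auto simp: min_def dest: in_set_takeD)

lemma chain_entries_nth_take: "j < length es \<Longrightarrow> chain_entries g es ! j = inv (chain_line (take (Suc j) es) g) (snd (es ! j))"
  by (simp add: chain_entries_def)

context shuffle_graph
begin

lemma pass_setup_sh:
  assumes l: "1 \<le> l" and len: "length E = length (boxes (sh (Suc l)))" and st: "strictE (sh (Suc l)) E"
  shows "pass_setup (sh l) (set (boxes (sh (Suc l)))) (\<lambda>i. E ! count_before (boxes (sh l)) (set (boxes (sh (Suc l)))) i)"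
proof -
  let ?b = "boxes (sh l)" let ?M = "set (boxes (sh (Suc l)))" let ?c = "count_before ?b ?M"
  have fb: "filter (\<lambda>x. x \<in> ?M) ?b = boxes (sh (Suc l))" by (rule filter_boxes[OF boxes_sub[OF l]])
  have "(p, q') \<in> ?M" if "(p, q) \<in> ?M" "1 \<le> q'" "q' \<le> q" for p q q'
    using that by (simp add: sh_boxes)
  moreover have "(Suc p, q) \<notin> set ?b" if "(p, q) \<in> set ?b - ?M" for p q by (rule boxes_strip[OF l that])
  moreover have "(fst (?b ! s) = fst (?b ! t) \<longrightarrow> E ! ?c s < E ! ?c t) \<and> (snd (?b ! s) = snd (?b ! t) \<longrightarrow> E ! ?c t < E ! ?c s)"
    if t: "t < length ?b" "s < t" "?b ! s \<in> ?M" "?b ! t \<in> ?M" for s t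
  proof -
    have sl: "s < length ?b" using t by simp
    have bs: "boxes (sh (Suc l)) ! ?c s = ?b ! s" using nth_count_before(1)[OF sl t(3)] fb by simp
    have bt: "boxes (sh (Suc l)) ! ?c t = ?b ! t" using nth_count_before(1)[OF t(1) t(4)] fb by simp
    have "?c t < length E" using nth_count_before(2)[OF t(1) t(4)] fb len by simp
    moreover have "?c s < ?c t" by (rule count_before_less) (use t in auto)
    ultimately show ?thesis using st[unfolded strictE_def, rule_format, of "?c t" "?c s"] bs bt by simp
  qed
  ultimately show ?thesis unfolding pass_setup_def using decreasing_sh[OF l] boxes_sub[OF l] by blast
qed

text \<open>\<open>eo\<close> are the entries of the previous row pass, \<open>B j\<close> is the
  graph below row \<open>l\<close> once \<open>j\<close> of the old crossings are back, and
  \<open>pp j\<close> is the crossing brought back next. Before box index \<open>i\<close> exactly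
  \<open>?c i\<close> old boxes have been met, so the graph is \<open>B (?c i)\<close> plus the
  labels \<open>K\<close> of row \<open>l\<close>.\<close>

lemma row_pass_correct:
  fixes eo :: "(nat \<times> nat) list" and B :: "nat \<Rightarrow> graph"
  assumes l: "1 \<le> l" "l \<le> r" and rcR: "rc_graph R"
    and mode: "is_hook (sh l) \<or> big_sorted r (strand_line R l)"
    and m: "length eo = length (boxes (sh (Suc l)))"
    and B: "\<And>j. j \<le> length eo \<Longrightarrow> rc_graph (B j)" "\<And>j. j \<le> length eo \<Longrightarrow> \<forall>p\<in>B j. l < fst p"
      "\<And>j. j \<le> length eo \<Longrightarrow> strand_line (B j) 1 = chain_line (take j eo) (strand_line R (Suc l))"
      "\<And>j. j < length eo \<Longrightarrow> B (Suc j) = insert (pp j) (B j)"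
    and eo: "chain_ok r (strand_line R (Suc l)) eo" "strictE (sh (Suc l)) (chain_entries (strand_line R (Suc l)) eo)"
    and old: "\<And>i. i < length (boxes (sh l)) \<Longrightarrow> boxes (sh l) ! i \<in> set (boxes (sh (Suc l))) \<Longrightarrow>
       old (Suc i) = Some (pp (count_before (boxes (sh l)) (set (boxes (sh (Suc l)))) i), eo ! count_before (boxes (sh l)) (set (boxes (sh (Suc l)))) i)"
    and G0: "G0 = B 0 \<union> row_of R l"
  shows "\<exists>K es. row_pass r R Y l G0 old (length (boxes (sh l))) = Some (add_row l (B (length eo)) K, Tableau (sh l) es) \<and>
    row_base l (B (length eo)) K \<and> row_state r (strand_line R l) (strand_line (B (length eo)) (Suc l)) K es \<and> length es = length (boxes (sh l)) \<and>
    strictE (sh l) (chain_entries (strand_line R l) es) \<and> card K + length eo = card (labels R l) + length (boxes (sh l))"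
proof -
  let ?b = "boxes (sh l)" let ?M = "set (boxes (sh (Suc l)))" let ?c = "count_before ?b ?M"
  let ?g = "strand_line R l" let ?g1 = "strand_line R (Suc l)" let ?lam = "sh l" let ?wl = "graph_perm (rows_ge R l)"
  define Ps where "Ps = (\<lambda>i. chain_entries ?g1 eo ! ?c i)"
  have pgR: "pos_graph R" using rcR by (simp add: rc_graph_iff)
  have st: "pass_setup ?lam ?M Ps" unfolding Ps_def by (rule pass_setup_sh[OF l(1) _ eo(2)]) (use m in simp)
  have fb: "filter (\<lambda>x. x \<in> ?M) ?b = boxes (sh (Suc l))" by (rule filter_boxes[OF boxes_sub[OF l(1)]])
  have wl: "fin_perm ?wl" "inv ?wl = ?g" by (auto simp: strand_line_def intro!: fin_perm_graph pos_graph_rows_ge pgR)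
  have g: "fin_perm ?g" "fin_perm ?g1" by (auto intro: fin_perm_strand_line[OF pgR])
  have base0: "row_base l (B j) {}" if "j \<le> length eo" for j using B(1,2)[OF that] l by (simp add: row_base_def)
  have fl: "strand_line (B j) (Suc l) = chain_line (take j eo) ?g1" if "j \<le> length eo" for j
    using strand_line_base[OF base0[OF that]] B(3)[OF that] by simp
  have redR: "reduced_row (labels R l) ?g1" using rcR l by (simp add: rc_graph_iff)
  have gl: "?g = ?g1 \<circ> sigma (labels R l)" by (rule strand_line_rec[OF pgR])
  have finR: "finite (labels R l)" "0 \<notin> labels R l" by (rule finite_labels[OF pgR], rule zero_labels[OF pgR])
  have chain_line_le: "?c i \<le> length eo" if "i \<le> length ?b" for i
  proof -
    have "?c i \<le> ?c (length ?b)" by (rule count_before_mono[OF that])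
    also have "\<dots> = length eo" unfolding count_before_def using fb m by simp
    finally show ?thesis .
  qed
  \<comment> \<open>Below row \<open>l >= 1\<close> strand 1 has not been met, so it is still at
    position 1.\<close>
  have one: "strand_line (B j) (Suc l) 1 \<le> r" if "j \<le> length eo" for j
    using strand_line_low[OF row_base_pos_graph[OF base0[OF that]], of 1 "Suc l"] l by simp
  have "\<exists>K es. row_pass r R Y l G0 old i = Some (add_row l (B (?c i)) K, Tableau ?lam es) \<and> row_base l (B (?c i)) K \<and>
     pass_inv r ?g ?lam ?M Ps (strand_line (B (?c i)) (Suc l)) K es i \<and> card K + ?c i = card (labels R l) + i" if "i \<le> length ?b" for i
    using that
  proof (induction i)
    case 0
    have b0: "row_base l (B 0) (labels R l)" using base0[of 0] finR labels_ge[OF pgR] by (auto simp: row_base_def)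
    have G0': "G0 = add_row l (B 0) (labels R l)"
    proof -
      have "row_of R l = (\<lambda>k. (l, k + 1 - l)) ` labels R l"
      proof (intro equalityI subsetI)
        fix x assume "x \<in> row_of R l"
        then obtain j where j: "x = (l, j)" "(l, j) \<in> R" by (cases x) (auto simp: row_of_def)
        then have "1 \<le> j" using pgR by (auto simp: pos_graph_def)
        then have "l + j - 1 \<in> labels R l" "x = (l, l + j - 1 + 1 - l)" using labels_iff[OF pgR] j by auto
        then show "x \<in> (\<lambda>k. (l, k + 1 - l)) ` labels R l" by (intro image_eqI[of _ _ "l + j - 1"])
      next
        fix x assume "x \<in> (\<lambda>k. (l, k + 1 - l)) ` labels R l"
        then obtain k where k: "k \<in> labels R l" "x = (l, k + 1 - l)" by blast
        then obtain j where j: "(l, j) \<in> R" "k = l + j - 1" by (auto simp: labels_def)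
        then have "1 \<le> j" using pgR by (auto simp: pos_graph_def)
        then show "x \<in> row_of R l" using k(2) j l by (simp add: row_of_def)
      qed
      then show ?thesis unfolding G0 add_row_def by simp
    qed
    have f0: "strand_line (B 0) (Suc l) = ?g1" using fl[of 0] by simp
    have "row_state r ?g ?g1 (labels R l) []" using g finR redR gl by (simp add: row_state_def)
    moreover have "big_sorted r ?g \<Longrightarrow> big_sorted r ?g1" using semi_down[OF g(2) finR(1) redR] gl by simp
    ultimately have "pass_inv r ?g ?lam ?M Ps ?g1 (labels R l) [] 0" using mode by (intro pass_inv_start) auto
    then show ?case using b0 f0 G0' by (intro exI[of _ "labels R l"] exI[of _ "[]"]) (simp add: sh_def rows_perm_def)
  next
    case (Suc i)
    then obtain K es where ih: "row_pass r R Y l G0 old i = Some (add_row l (B (?c i)) K, Tableau ?lam es)" "row_base l (B (?c i)) K"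
      "pass_inv r ?g ?lam ?M Ps (strand_line (B (?c i)) (Suc l)) K es i" "card K + ?c i = card (labels R l) + i" by auto
    have i: "i < length ?b" using Suc.prems by simp
    let ?f = "strand_line (B (?c i)) (Suc l)"
    have cle: "?c i \<le> length eo" by (rule chain_line_le) (use i in simp)
    have S: "row_state r ?g ?f K es" "length es = i" using ih(3) by (auto simp: pass_inv_def)
    note D = row_stateD[OF S(1)]
    show ?case
    proof (cases "?b ! i \<in> ?M")
      case False
      have wd: "word_of r (rows_ge Y l) ! i = l" using word_nth[OF l(1) i] False by simp
      obtain k where k: "ins_at r ?f K k" "pass_inv r ?g ?lam ?M Ps ?f (insert k K) (es @ [(?f (block_start K k), ?f (Suc k))]) (Suc i)"
        by (rule ins_step[OF st ih(3) i False one[OF cle]])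
      note im = insertion_add_row(1)[OF ih(2) l(2) k(1), of "Tableau ?lam es"] insertion_add_row(2)[OF ih(2) l(2) k(1)]
      have cs: "?c (Suc i) = ?c i" using count_before_Suc[OF i] False by simp
      have kK: "k \<notin> K" using k(1) by (auto simp: ins_at_def allowed_def)
      have "row_pass r R Y l G0 old (Suc i) = Some (add_row l (B (?c i)) (insert k K), Tableau ?lam (es @ [(?f (block_start K k), ?f (Suc k))]))"
        using ih(1) wd im(1) by (simp add: push_def)
      moreover have "row_base l (B (?c i)) (insert k K)" using ih(2) im(2) by (simp add: row_base_def)
      moreover have "card (insert k K) + ?c i = card (labels R l) + Suc i" using ih(4) kK D(3) by simp
      ultimately show ?thesis unfolding cs using k(2) by blast
    next
      case True
      have wd: "word_of r (rows_ge Y l) ! i \<noteq> l" using word_nth[OF l(1) i] True by simp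
      have cs: "?c (Suc i) = Suc (?c i)" using count_before_Suc[OF i] True by simp
      have chain_line': "?c i < length eo" using chain_line_le[of "Suc i"] cs i by simp
      obtain a b where ab: "eo ! ?c i = (a, b)" by fastforce
      have tk: "take (Suc (?c i)) eo = take (?c i) eo @ [(a, b)]" using take_Suc_conv_app_nth[OF chain_line'] ab by simp
      have okc: "chain_ok r ?g1 (take (?c i) eo @ [(a, b)])" using chain_take[OF eo(1), of "Suc (?c i)"] unfolding tk .
      have f: "?f = chain_line (take (?c i) eo) ?g1" by (rule fl[OF cle])
      note cb = chain_bcover[OF g(2) okc, folded f]
      let ?P = "inv ?f a" let ?Q = "inv ?f b"
      \<comment> \<open>The old entry of \<open>E\<close> is the position that \<open>a\<close> has
        in the line below the row as restored so far.\<close>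
      have P: "Ps i = ?P" unfolding Ps_def chain_entries_nth_take[OF chain_line'] tk ab snd_conv by (rule cb(5))
      have f': "strand_line (B (Suc (?c i))) (Suc l) = ?f \<circ> transpose ?P ?Q"
        using fl[of "Suc (?c i)"] chain_line' unfolding tk cb(4) by simp
      have n: "ninv (?f \<circ> transpose ?P ?Q) = Suc (ninv ?f)"
        using chain_ok_ninv[OF okc] chain_ok_ninv[OF chain_take[OF eo(1), of "?c i"]] unfolding cb(4) f[symmetric] by simp
      have one': "(?f \<circ> transpose ?P ?Q) 1 \<le> r" using one[of "Suc (?c i)"] chain_line' unfolding f' by simp
      obtain K' es' where o: "rect_out r ?g (strictE ?lam) ?f K es (Ps i) ?Q K' es'"
        "pass_inv r ?g ?lam ?M Ps (?f \<circ> transpose (Ps i) ?Q) K' es' (Suc i)"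
        by (rule rect_step[OF st ih(3) i True, of ?Q]) (use cb(1) n one' P in auto)
      have o': "rect_out r ?g (strictE ?lam) ?f K es ?P ?Q K' es'" using o(1) unfolding P .
      have I': "pass_inv r ?g ?lam ?M Ps (?f \<circ> transpose ?P ?Q) K' es' (Suc i)" using o(2) unfolding P .
      have S': "row_state r ?g (?f \<circ> transpose ?P ?Q) K' es'" "length es' = Suc i" using I' by (auto simp: pass_inv_def)
      have Bs: "B (Suc (?c i)) = insert (pp (?c i)) (B (?c i))" by (rule B(4)[OF chain_line'])
      have b': "row_base l (insert (pp (?c i)) (B (?c i))) K" unfolding Bs[symmetric]
        using base0[of "Suc (?c i)"] chain_line' ih(2) by (simp add: row_base_def)
      have lenb: "length es < length (boxes ?lam)" using S(2) i by simp
      have rm: "rectification_step r ?wl l (pp (?c i)) (?f ?P, ?f ?Q) (add_row l (B (?c i)) K, Tableau ?lam es) =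
        Some (add_row l (insert (pp (?c i)) (B (?c i))) K', Tableau ?lam es') \<and> row_base l (insert (pp (?c i)) (B (?c i))) K' \<and>
        card K' + Suc (length es) = card K + length es'"
        by (rule rect_add_row[OF o' ih(2) b' l(2) refl f'[unfolded Bs] wl lenb S(1) cb(1) S'(1) n])
      have "row_pass r R Y l G0 old (Suc i) = Some (add_row l (B (?c (Suc i))) K', Tableau ?lam es')"
        using ih(1) wd old[OF i True] rm cb(2,3) ab unfolding cs Bs by simp
      moreover have "row_base l (B (?c (Suc i))) K'" unfolding cs Bs using rm by simp
      moreover have "card K' + ?c (Suc i) = card (labels R l) + Suc i" using rm S(2) S'(2) ih(4) cs by simp
      ultimately show ?thesis using I' f' unfolding cs by metis
    qed
  qed
  from this[of "length ?b"] obtain K es where res: "row_pass r R Y l G0 old (length ?b) = Some (add_row l (B (?c (length ?b))) K, Tableau ?lam es)"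
    "row_base l (B (?c (length ?b))) K" "pass_inv r ?g ?lam ?M Ps (strand_line (B (?c (length ?b))) (Suc l)) K es (length ?b)"
    "card K + ?c (length ?b) = card (labels R l) + length ?b" by auto
  have "?c (length ?b) = length eo" unfolding count_before_def using fb m by simp
  then show ?thesis using res by (intro exI[of _ K] exI[of _ es]) (simp add: pass_inv_def)
qed

lemma rc_rows_ge:
  assumes rcR: "rc_graph R"
  shows "rc_graph (rows_ge R i)" "strand_line (rows_ge R i) 1 = strand_line R i"
proof -
  have pgR: "pos_graph R" using rcR by (simp add: rc_graph_iff)
  have pg': "pos_graph (rows_ge R i)" by (rule pos_graph_rows_ge[OF pgR])
  show "strand_line (rows_ge R i) 1 = strand_line R i" using rows_ge_1[OF pg'] by (simp add: strand_line_def)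
  have "reduced_row (labels (rows_ge R i) a) (strand_line (rows_ge R i) (Suc a))" if "1 \<le> a" for a
  proof (cases "i \<le> a")
    case True
    then have "labels (rows_ge R i) a = labels R a" by (auto simp: labels_def rows_ge_def)
    moreover have "strand_line (rows_ge R i) (Suc a) = strand_line R (Suc a)" by (rule strand_line_above) (use True in \<open>auto simp: rows_ge_def\<close>)
    ultimately show ?thesis using rcR that by (simp add: rc_graph_iff)
  next
    case False
    then have "labels (rows_ge R i) a = {}" by (auto simp: labels_def rows_ge_def)
    then show ?thesis by (simp add: reduced_row_def)
  qed
  then show "rc_graph (rows_ge R i)" using pg' by (simp add: rc_graph_iff)
qed

text \<open>The last clause counts crossings row by row; this is what the identity of monomials
  requires.\<close>

definition good_result :: "graph \<Rightarrow> nat \<Rightarrow> graph \<Rightarrow> (nat \<times> nat) list \<Rightarrow> bool" where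
  "good_result R l G es \<longleftrightarrow> rc_graph G \<and> (\<forall>p\<in>G. l \<le> fst p) \<and> chain_ok r (strand_line R l) es \<and> strand_line G 1 = chain_line es (strand_line R l) \<and>
     length es = length (boxes (sh l)) \<and> strictE (sh l) (chain_entries (strand_line R l) es) \<and>
     (\<forall>i\<ge>l. card (labels G i) = card (labels R i) + card (KY i))"

lemma good_add_row:
  assumes l: "1 \<le> l" and b: "row_base l B K" and S: "row_state r (strand_line R l) (strand_line B (Suc l)) K es"
    and len: "length es = length (boxes (sh l))" "strictE (sh l) (chain_entries (strand_line R l) es)"
    and c: "card K + length (boxes (sh (Suc l))) = card (labels R l) + length (boxes (sh l))"
    and up: "\<And>i. l < i \<Longrightarrow> card (labels B i) = card (labels R i) + card (KY i)"
  shows "good_result R l (add_row l B K) es"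
proof -
  note D = row_stateD[OF S]
  have "\<forall>p\<in>add_row l B K. l \<le> fst p" using b by (auto simp: add_row_def row_base_def)
  moreover have "card (labels (add_row l B K) i) = card (labels R i) + card (KY i)" if "l \<le> i" for i
  proof (cases "i = l")
    case True
    then show ?thesis using labels_add_row[OF b] c card_KY[OF l] by simp
  next
    case False
    then show ?thesis using labels_add_row_other[OF False] up[of i] that by simp
  qed
  ultimately show ?thesis
    unfolding good_result_def rc_add_row[OF b] strand_line_add_row(1)[OF b] using D len by simp
qed

lemma row_result_correct:
  assumes rcR: "rc_graph R" and mode: "\<And>l. 1 \<le> l \<Longrightarrow> is_hook (sh l) \<or> big_sorted r (strand_line R l)"
  shows "k < r \<Longrightarrow> \<exists>G es. row_result r R Y k = Some (G, Tableau (sh (r - k)) es) \<and> good_result R (r - k) G es"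
proof (induction k)
  case 0
  have pgR: "pos_graph R" using rcR by (simp add: rc_graph_iff)
  \<comment> \<open>Row \<open>r\<close> has no predecessor: the shape of \<open>Y\<close> below it
    is empty, no old crossings come back, and the graph below is the part of \<open>R\<close> below
    row \<open>r\<close>.\<close>
  let ?B = "\<lambda>_::nat. rows_ge R (Suc r)"
  have be: "boxes (sh (Suc r)) = []" by (rule boxes_empty) simp
  have "\<exists>K es. row_pass r R Y r (rows_ge R r) (\<lambda>_. None) (length (boxes (sh r))) = Some (add_row r (?B (length ([]::(nat\<times>nat) list))) K, Tableau (sh r) es) \<and>
    row_base r (?B (length ([]::(nat\<times>nat) list))) K \<and> row_state r (strand_line R r) (strand_line (?B (length ([]::(nat\<times>nat) list))) (Suc r)) K es \<and> length es = length (boxes (sh r)) \<and>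
    strictE (sh r) (chain_entries (strand_line R r) es) \<and> card K + length ([]::(nat\<times>nat) list) = card (labels R r) + length (boxes (sh r))"
  proof (rule row_pass_correct[OF r1 order_refl rcR mode[OF r1]])
    show "rows_ge R r = rows_ge R (Suc r) \<union> row_of R r" using rows_ge_row(1)[of R r] by auto
    show "\<forall>p\<in>rows_ge R (Suc r). r < fst p" by (auto simp: rows_ge_def)
    show "rc_graph (rows_ge R (Suc r))" by (rule rc_rows_ge(1)[OF rcR])
    show "strand_line (rows_ge R (Suc r)) 1 = chain_line (take j []) (strand_line R (Suc r))" for j using rc_rows_ge(2)[OF rcR] by simp
  qed (use be in auto)
  then obtain K es where res: "row_pass r R Y r (rows_ge R r) (\<lambda>_. None) (length (boxes (sh r))) = Some (add_row r (rows_ge R (Suc r)) K, Tableau (sh r) es)"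
    "row_base r (rows_ge R (Suc r)) K" "row_state r (strand_line R r) (strand_line (rows_ge R (Suc r)) (Suc r)) K es" "length es = length (boxes (sh r))"
    "strictE (sh r) (chain_entries (strand_line R r) es)" "card K = card (labels R r) + length (boxes (sh r))" by auto
  have "good_result R r (add_row r (rows_ge R (Suc r)) K) es"
  proof (rule good_add_row[OF r1 res(2,3,4,5)])
    show "card K + length (boxes (sh (Suc r))) = card (labels R r) + length (boxes (sh r))" using res(6) be by simp
    fix i assume i: "r < i"
    have "labels (rows_ge R (Suc r)) i = labels R i" using i by (auto simp: labels_def rows_ge_def)
    then show "card (labels (rows_ge R (Suc r)) i) = card (labels R i) + card (KY i)" using no_rows[OF i] by simp
  qed
  then show ?case using res(1) card_rows_sh[OF r1] by simp
next
  case (Suc k)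
  have pgR: "pos_graph R" using rcR by (simp add: rc_graph_iff)
  define l where "l = r - Suc k"
  have l: "1 \<le> l" "l \<le> r" "Suc l = r - k" "r - Suc k = l" using Suc.prems by (auto simp: l_def)
  obtain G eo where ih: "row_result r R Y k = Some (G, Tableau (sh (Suc l)) eo)" "good_result R (Suc l) G eo"
    using Suc l(3) by auto
  let ?w = "graph_perm (rows_ge R (Suc l))" let ?T = "Tableau (sh (Suc l)) eo" let ?m = "length eo"
  let ?P = "(?w, G, ?T)"
  have w: "fin_perm ?w" "inv ?w = strand_line R (Suc l)" by (auto simp: strand_line_def intro!: fin_perm_graph pos_graph_rows_ge pgR)
  have gr: "rc_graph G" "\<forall>p\<in>G. Suc l \<le> fst p" "chain_ok r (strand_line R (Suc l)) eo" "strand_line G 1 = chain_line eo (strand_line R (Suc l))"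
    "?m = length (boxes (sh (Suc l)))" "strictE (sh (Suc l)) (chain_entries (strand_line R (Suc l)) eo)"
    "\<And>i. Suc l \<le> i \<Longrightarrow> card (labels G i) = card (labels R i) + card (KY i)"
    using ih(2) unfolding good_result_def by auto
  have pk: "bruhat_package r ?P" unfolding bruhat_package_iff[OF w(1)] w(2) using gr by simp
  obtain B where B': "\<forall>j\<le>?m. S_graph r ?P j = Some (B j)" "\<forall>j\<le>?m. rc_graph (B j)"
    "\<forall>j\<le>?m. strand_line (B j) 1 = chain_line (take j eo) (strand_line R (Suc l))"
    "\<forall>j<?m. \<exists>p. p \<notin> B j \<and> B (Suc j) = insert p (B j)" "B ?m = G"
    by (rule S_graph_family[OF w(1) pk, unfolded w(2) tableau.sel])
  note B = B'(1-4)[rule_format] B'(5)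
  \<comment> \<open>The choice is only nominal: \<open>B (Suc j)\<close> has just one crossing
    outside \<open>B j\<close>, which is the one \<open>old_data\<close> looks for.\<close>
  define pp where "pp j = (SOME p. p \<notin> B j \<and> B (Suc j) = insert p (B j))" for j
  have pp: "pp j \<notin> B j" "B (Suc j) = insert (pp j) (B j)" if "j < ?m" for j
    using someI_ex[OF B(4)[OF that]] unfolding pp_def by auto
  have sub: "B j \<subseteq> G" if "j \<le> ?m" for j
    using that
  proof (induction j rule: inc_induct)
    case base then show ?case using B(5) by simp
  next
    case (step n) then show ?case using pp(2)[of n] by auto
  qed
  let ?b = "boxes (sh l)" let ?M = "set (boxes (sh (Suc l)))" let ?c = "count_before ?b ?M"
  have fb: "filter (\<lambda>x. x \<in> ?M) ?b = boxes (sh (Suc l))" by (rule filter_boxes[OF boxes_sub[OF l(1)]])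
  have old: "old_data r Y l ?P (Suc i) = Some (pp (?c i), eo ! ?c i)" if i: "i < length ?b" "?b ! i \<in> ?M" for i
  proof -
    have bi: "boxes (sh (Suc l)) ! ?c i = ?b ! i" using nth_count_before(1)[OF i] fb by simp
    have ci: "?c i < length (boxes (sh (Suc l)))" using nth_count_before(2)[OF i] fb by simp
    have cm: "?c i < ?m" using ci gr(5) by simp
    have u1: "the_unique (\<lambda>k. 1 \<le> k \<and> k \<le> length (boxes (sh (Suc l))) \<and> boxes (sh (Suc l)) ! (k - 1) = ?b ! i) = Some (Suc (?c i))"
    proof (rule the_unique_eq)
      show "1 \<le> Suc (?c i) \<and> Suc (?c i) \<le> length (boxes (sh (Suc l))) \<and> boxes (sh (Suc l)) ! (Suc (?c i) - 1) = ?b ! i"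
        using bi ci by simp
      fix k assume k: "1 \<le> k \<and> k \<le> length (boxes (sh (Suc l))) \<and> boxes (sh (Suc l)) ! (k - 1) = ?b ! i"
      then have "k - 1 < length (boxes (sh (Suc l)))" by linarith
      then have "k - 1 = ?c i" using k nth_eq_iff_index_eq[OF distinct_boxes[of "sh (Suc l)"], of "k - 1" "?c i"] bi ci by simp
      then show "k = Suc (?c i)" using k by linarith
    qed
    have u2: "the_unique (\<lambda>p. p \<in> B (Suc (?c i)) \<and> p \<notin> B (?c i)) = Some (pp (?c i))"
    proof (rule the_unique_eq)
      show "pp (?c i) \<in> B (Suc (?c i)) \<and> pp (?c i) \<notin> B (?c i)" using pp[OF cm] by simp
      fix p assume "p \<in> B (Suc (?c i)) \<and> p \<notin> B (?c i)"
      then show "p = pp (?c i)" using pp(2)[OF cm] by auto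
    qed
    have s: "S_graph r ?P (Suc (?c i)) = Some (B (Suc (?c i)))" "S_graph r ?P (?c i) = Some (B (?c i))" using B(1) cm by auto
    have shl: "shuffle_shape r (graph_perm (rows_ge Y l)) = sh l" "shuffle_shape r (graph_perm (rows_ge Y (l + 1))) = sh (Suc l)"
      by (simp_all add: sh_def rows_perm_def)
    show ?thesis unfolding old_data_def shl Let_def diff_Suc_1 u1 using s u2 by simp
  qed
  have mod: "is_hook (sh l) \<or> big_sorted r (strand_line R l)" by (rule mode[OF l(1)])
  have "\<exists>K es. row_pass r R Y l (B 0 \<union> row_of R l) (old_data r Y l ?P) (length ?b) = Some (add_row l (B ?m) K, Tableau (sh l) es) \<and>
    row_base l (B ?m) K \<and> row_state r (strand_line R l) (strand_line (B ?m) (Suc l)) K es \<and> length es = length ?b \<and>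
    strictE (sh l) (chain_entries (strand_line R l) es) \<and> card K + ?m = card (labels R l) + length ?b"
  proof (rule row_pass_correct[OF l(1,2) rcR mod gr(5)])
    show "\<forall>p\<in>B j. l < fst p" if "j \<le> ?m" for j
    proof
      fix p assume "p \<in> B j"
      then have "p \<in> G" using sub[OF that] by blast
      then show "l < fst p" using gr(2) Suc_le_lessD by blast
    qed
  qed (use B(2,3) pp(2) gr(3,6) old in auto)
  then obtain K es where res: "row_pass r R Y l (B 0 \<union> row_of R l) (old_data r Y l ?P) (length ?b) = Some (add_row l G K, Tableau (sh l) es)"
    "row_base l G K" "row_state r (strand_line R l) (strand_line G (Suc l)) K es" "length es = length ?b"
    "strictE (sh l) (chain_entries (strand_line R l) es)" "card K + ?m = card (labels R l) + length ?b" unfolding B(5) by auto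
  have good: "good_result R l (add_row l G K) es"
    by (rule good_add_row[OF l(1) res(2,3,4,5)]) (use res(6) gr(5,7) in auto)
  have s0: "S_graph r ?P 0 = Some (B 0)" using B(1)[of 0] by simp
  have "row_result r R Y (Suc k) = Some (add_row l G K, Tableau (sh l) es)"
    using ih(1) s0 res(1) card_rows_sh[OF l(1)] l(4) by (simp add: Let_def)
  then show ?case using good l(4) by auto
qed

end

text \<open>The three products run over different sets of rows. They are first extended to the union
  of these sets, where a row without crossings contributes 1.\<close>

lemma graph_monom_eq:
  assumes "pos_graph U" "pos_graph R" "pos_graph Y"
    and c: "\<And>i. 1 \<le> i \<Longrightarrow> card (labels U i) = card (labels R i) + card (labels Y i)"
  shows "graph_monom U = graph_monom R * graph_monom Y"
proof -
  let ?S = "fst ` U \<union> fst ` R \<union> fst ` Y"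
  have fin: "finite ?S" using assms(1-3) by (auto simp: pos_graph_def)
  have pos: "1 \<le> i" if "i \<in> ?S" for i using that assms(1-3) by (auto simp: pos_graph_def)
  have m: "graph_monom G = (\<Prod>i\<in>?S. xvar i ^ card (labels G i))" if G: "pos_graph G" "fst ` G \<subseteq> ?S" for G
  proof -
    have "graph_monom G = (\<Prod>i\<in>fst ` G. xvar i ^ card (labels G i))"
      unfolding graph_monom_def card_row_of[OF G(1)] ..
    also have "\<dots> = (\<Prod>i\<in>?S. xvar i ^ card (labels G i))"
    proof (rule prod.mono_neutral_left[OF fin G(2)])
      show "\<forall>i\<in>?S - fst ` G. xvar i ^ card (labels G i) = 1"
      proof
        fix i assume "i \<in> ?S - fst ` G"
        then have "labels G i = {}" by (force simp: labels_def)
        then show "xvar i ^ card (labels G i) = 1" by simp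
      qed
    qed
    finally show ?thesis .
  qed
  have "graph_monom U = (\<Prod>i\<in>?S. xvar i ^ card (labels U i))" by (rule m) (use assms in auto)
  also have "\<dots> = (\<Prod>i\<in>?S. xvar i ^ card (labels R i) * xvar i ^ card (labels Y i))"
    by (rule prod.cong[OF refl]) (use c pos in \<open>simp add: power_add\<close>)
  also have "\<dots> = (\<Prod>i\<in>?S. xvar i ^ card (labels R i)) * (\<Prod>i\<in>?S. xvar i ^ card (labels Y i))" by (rule prod.distrib)
  also have "(\<Prod>i\<in>?S. xvar i ^ card (labels R i)) = graph_monom R" by (rule m[symmetric]) (use assms in auto)
  also have "(\<Prod>i\<in>?S. xvar i ^ card (labels Y i)) = graph_monom Y" by (rule m[symmetric]) (use assms in auto)
  finally show ?thesis .
qed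

lemma semi_shuffle_semi:
  assumes "is_semi_shuffle r w"
  shows "big_sorted r (inv w)"
proof -
  have w: "fin_perm w" "\<And>i. r < i \<Longrightarrow> w i < w (Suc i)" using assms by (auto simp: is_semi_shuffle_def fin_perm_S_inf)
  have inc: "w s < w (s + Suc n)" if "r < s" for s n
  proof (induction n)
    case 0 then show ?case using w(2)[OF that] by simp
  next
    case (Suc n)
    also have "w (s + Suc n) < w (Suc (s + Suc n))" by (rule w(2)) (use that in simp)
    finally show ?case by simp
  qed
  show ?thesis unfolding big_sorted_def
  proof (intro allI impI)
    fix p q assume a: "p < q" "r < inv w p" "r < inv w q"
    note fi = f_inv_fin_perm[OF w(1)]
    show "inv w p < inv w q"
    proof (rule ccontr)
      assume n: "\<not> inv w p < inv w q"
      have "inv w p \<noteq> inv w q" using fi a(1) by (metis nat_neq_iff)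
      then have "inv w q < inv w p" using n by simp
      then have "w (inv w q) < w (inv w p)" using inc[OF a(3), of "inv w p - inv w q - 1"] by simp
      then show False using fi a(1) by simp
    qed
  qed
qed

theorem theorem2p2:
  fixes w v :: "nat \<Rightarrow> nat" and r :: nat and lam :: "nat list" and R Y :: graph
  assumes "w \<in> S_inf" and "1 \<le> r"
    and "is_partition r lam" and "is_v lam r v"
    and "is_semi_shuffle r w \<or> is_hook lam"
    and "R \<in> RC w" and "Y \<in> RC v"
  shows "\<exists>U T. rc_insert r R Y = Some (U, T)
    \<and> rc_graph U
    \<and> transp_tableau r T \<and> shape T = lam \<and> length (entries T) = length (boxes lam)
    \<and> row_strict (E_tab w T) \<and> col_strict (E_tab w T)
    \<and> bruhat_package r (w, U, T)
    \<and> graph_monom U = graph_monom R * graph_monom Y"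
proof -
  have w: "fin_perm w" using assms(1) by (simp add: fin_perm_S_inf)
  have rcR: "rc_graph R" "graph_perm R = w" using assms(6) by (auto simp: RC_def)
  have rcY: "rc_graph Y" "graph_perm Y = v" using assms(7) by (auto simp: RC_def)
  have pgR: "pos_graph R" and pgY: "pos_graph Y" using rcR rcY by (auto simp: rc_graph_iff)
  have shv: "is_shuffle r v" using assms(4) by (simp add: is_v_def)
  interpret shuffle_graph r Y by (rule shuffle_graphI[OF shv assms(7,2)])
  have v1: "rows_perm 1 = v" unfolding rows_perm_def rows_ge_1[OF pgY] by (rule rcY(2))
  \<comment> \<open>The integer equation of \<open>is_v\<close> has a natural number on its left, so
    the truncated subtraction in \<open>d\<close> loses nothing.\<close>
  have sh1: "sh 1 = lam"
  proof (rule nth_equalityI)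
    show "length (sh 1) = length lam" using assms(3) by (simp add: is_partition_def)
    fix i assume i: "i < length (sh 1)"
    then have ir: "i < r" by simp
    have "int (lam ! (Suc i - 1)) = int (v (r + 1 - Suc i)) - int r - 1 + int (Suc i)"
      using assms(4) ir unfolding is_v_def by (auto dest!: bspec[of _ _ "Suc i"])
    moreover have "sh 1 ! (Suc i - 1) = d 1 (r + 1 - Suc i)" using sh_nth[of "Suc i" 1] ir by simp
    moreover have "d 1 (r + 1 - Suc i) = v (r + 1 - Suc i) - (r + 1 - Suc i)" unfolding d_def v1 ..
    ultimately show "sh 1 ! i = lam ! i" using ir by simp
  qed
  have g1: "strand_line R 1 = inv w" using graph_perm_strand_line[OF pgR] rcR(2) by simp
  \<comment> \<open>Both hypotheses on the input are inherited by the rows below: the order of the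
    strands \<open>> r\<close> by \<open>semi_down\<close>, the hook shape because the shapes of
    \<open>Y\<close> shrink.\<close>
  have mode: "is_hook (sh l) \<or> big_sorted r (strand_line R l)" if l: "1 \<le> l" for l
    using assms(5)
  proof
    assume "is_semi_shuffle r w"
    then have s1: "big_sorted r (strand_line R 1)" using semi_shuffle_semi g1 by simp
    have "big_sorted r (strand_line R l)" using l
    proof (induction l rule: dec_induct)
      case base show ?case by (rule s1)
    next
      case (step n)
      have "reduced_row (labels R n) (strand_line R (Suc n))" using rcR step(1) by (simp add: rc_graph_iff)
      then show ?case by (rule semi_down[OF fin_perm_strand_line[OF pgR] finite_labels[OF pgR] _ step.IH[unfolded strand_line_rec[OF pgR, of n]]])
    qed
    then show ?thesis by simp
  next
    assume "is_hook lam"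
    then show ?thesis using hook_sh[OF _ l] sh1 by simp
  qed
  have rr: "r - 1 < r" "r - (r - 1) = 1" using assms(2) by auto
  obtain U es where U: "row_result r R Y (r - 1) = Some (U, Tableau lam es)" "good_result R 1 U es"
    using row_result_correct[OF rcR(1) mode rr(1)] unfolding rr(2) sh1 by blast
  let ?T = "Tableau lam es"
  have gr: "rc_graph U" "chain_ok r (inv w) es" "strand_line U 1 = chain_line es (inv w)" "length es = length (boxes lam)"
    "strictE lam (chain_entries (inv w) es)" "\<And>i. 1 \<le> i \<Longrightarrow> card (labels U i) = card (labels R i) + card (labels Y i)"
    using U(2) unfolding good_result_def g1 sh1 by auto
  have pgU: "pos_graph U" using gr(1) by (simp add: rc_graph_iff)
  have E: "E_tab w ?T = Tableau lam (chain_entries (inv w) es)" by (rule E_tab_chain_entries[OF w gr(2)])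
  have "row_strict (E_tab w ?T) \<and> col_strict (E_tab w ?T)"
    unfolding E by (subst strict_iff) (use gr(4,5) in auto)
  moreover have "transp_tableau r ?T" using gr(2,4) unfolding transp_tableau_def chain_ok_def by simp
  moreover have "bruhat_package r (w, U, ?T)" unfolding bruhat_package_iff[OF w] using gr(1-4) by simp
  moreover have "graph_monom U = graph_monom R * graph_monom Y" by (rule graph_monom_eq[OF pgU pgR pgY gr(6)])
  moreover have "rc_insert r R Y = Some (U, ?T)" unfolding rc_insert_def by (rule U(1))
  ultimately show ?thesis using gr(1,4) by (intro exI[of _ U] exI[of _ ?T]) simp
qed

end
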